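(* Let $\Sigma$ be a finite alphabet with a distinguished symbol $0\in\Sigma$, let $X = \bigcup_{n \in \mathbb{Z}_+} \Sigma^{\mathbb{Z}_n}$ (disjoint union), and let $G$ be the smallest group of permutations of $X$ that contains (1) for every $f\in\mathrm{Aut}_0(\Sigma^{\mathbb{Z}})$, the permutation of $X$ induced by $f$; (2) all AFO permutations of $X$; and (3) for every $n\in\mathbb{Z}_+$, all permutations of $X$ that fix every element outside $\Sigma^{\mathbb{Z}_n}$ and map $\Sigma^{\mathbb{Z}_n}$ to itself. Then $G \in \mathcal{G}$.
   Context: $\mathbb{Z}_+=\{1,2,\ldots\}$ and $\mathbb{Z}_n=\mathbb{Z}/n\mathbb{Z}$. For a finite set (alphabet) $\Sigma$, the full shift $\Sigma^{\mathbb{Z}}$ carries the product topology and the shift homeomorphism $\sigma(x)_i = x_{i+1}$. $\mathrm{Aut}(\Sigma^{\mathbb{Z}})$ is the group of homeomorphisms of $\Sigma^{\mathbb{Z}}$ commuting with $\sigma$. $\mathcal{G}$ is the class of groups that embed (as abstract groups) in $\mathrm{Aut}(\Sigma^{\mathbb{Z}})$, where $\Sigma$ is a finite alphabet with at least two elements; it is known that this class does not depend on the choice of such $\Sigma$. For an alphabet $\Sigma\ni 0$, $\mathrm{Aut}_0(\Sigma^{\mathbb{Z}})$ is the stabilizer of the point $0^{\mathbb{Z}}$ in $\mathrm{Aut}(\Sigma^{\mathbb{Z}})$. Elements of $\Sigma^{\mathbb{Z}_n}$ are written as words of length $n$ over $\Sigma$; $\sigma$ also denotes the cyclic shift $\sigma(x)_i=x_{i+1}$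 on $\Sigma^{\mathbb{Z}_n}$. The set $\Sigma^{\mathbb{Z}_n}$ is identified with the set of points $x\in\Sigma^{\mathbb{Z}}$ with $\sigma^n(x)=x$; this set is preserved by every $f\in \mathrm{Aut}(\Sigma^{\mathbb{Z}})$, so every such $f$ induces a permutation of each $\Sigma^{\mathbb{Z}_n}$ and hence of $X$. Safe sets: a finite set of words $\{u_1,\ldots,u_k\}\subset\Sigma^+$ (nonempty finite words) is $n_0$-safe if the words $u_i$ begin and end with nonzero symbols (symbols other than $0$), are distinct, satisfy $\max_i|u_i|\le n_0$, and for every $n\ge n_0$ one can uniquely deduce $u_i$ and $j$ (modulo $n$) from $\sigma^j(u_i0^{n-|u_i|})\in\Sigma^{\mathbb{Z}_n}$. AFO permutations: given $n_0$, an $n_0$-safe finite set $\{u_1,\ldots,u_k\}$, a permutation $\pi\in S_k$, and $n_1,\ldots,n_k\in\mathbb{Z}$, the corresponding AFO permutation of $X$ acts trivially on $\Sigma^{\mathbb{Z}_n}$ for $n<n_0$, and on $\Sigma^{\mathbb{Z}_n}$ for $n\ge n_0$ acts by $$\sigma^j(u_i 0^{n-|u_i|}) \mapsto \sigma^{j+n_i}(u_{\pi(i)}0^{n-|u_{\pi(i)}|})$$ for all $j$ and $i$, and trivially on all elements not of the form $\sigma^j(u_i0^{n-|u_i|})$. *)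

theory Defs
  imports "HOL-Analysis.Analysis" "HOL-Algebra.Bij" "HOL-Algebra.Elementary_Groups" "HOL-Number_Theory.Cong"
begin

definition full_shift :: "'a set \<Rightarrow> (int \<Rightarrow> 'a) topology" where
  "full_shift A = product_topology (\<lambda>_. discrete_topology A) UNIV"

definition shift :: "(int \<Rightarrow> 'a) \<Rightarrow> (int \<Rightarrow> 'a)" where
  "shift x = (\<lambda>i. x (i + 1))"

text \<open>As in \<^const>\<open>Bij\<close>, automorphisms are extensional functions, so that each one is
  represented by exactly one HOL function.\<close>

definition shift_auts :: "'a set \<Rightarrow> ((int \<Rightarrow> 'a) \<Rightarrow> (int \<Rightarrow> 'a)) set" where
  "shift_auts A = {f \<in> extensional (topspace (full_shift A)).
     homeomorphic_map (full_shift A) (full_shift A) f \<and>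
     (\<forall>x \<in> topspace (full_shift A). f (shift x) = shift (f x))}"

definition Aut_shift :: "'a set \<Rightarrow> ((int \<Rightarrow> 'a) \<Rightarrow> (int \<Rightarrow> 'a)) monoid" where
  "Aut_shift A = (BijGroup (topspace (full_shift A))) \<lparr>carrier := shift_auts A\<rparr>"

definition shift_auts0 :: "'a set \<Rightarrow> 'a \<Rightarrow> ((int \<Rightarrow> 'a) \<Rightarrow> (int \<Rightarrow> 'a)) set" where
  "shift_auts0 A z = {f \<in> shift_auts A. f (\<lambda>_. z) = (\<lambda>_. z)}"

text \<open>Up to renaming of symbols, every finite alphabet is a finite set of natural numbers.\<close>

definition embeds_in_Aut_shift :: "('g, 'm) monoid_scheme \<Rightarrow> bool" where
  "embeds_in_Aut_shift G \<longleftrightarrow> group G \<and>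
     (\<exists>B :: nat set. finite B \<and> 2 \<le> card B \<and> (\<exists>h. h \<in> mon G (Aut_shift B)))"

text \<open>Elements of the disjoint union of the sets of cyclic words of length \<open>n \<ge> 1\<close> are
  nonempty lists; the length of the list records \<open>n\<close>.\<close>

definition cyc_words :: "'a set \<Rightarrow> nat \<Rightarrow> 'a list set" where
  "cyc_words A n = {w. set w \<subseteq> A \<and> length w = n}"

definition all_cyc_words :: "'a set \<Rightarrow> 'a list set" where
  "all_cyc_words A = (\<Union>n \<in> {1..}. cyc_words A n)"

text \<open>\<open>cshift j\<close> is the \<open>j\<close>-th power of the cyclic shift:
  \<open>cshift j w ! i = w ! ((i + j) mod length w)\<close>.\<close>

definition cshift :: "int \<Rightarrow> 'a list \<Rightarrow> 'a list" where
  "cshift j w = rotate (nat (j mod int (length w))) w"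

text \<open>\<open>periodic_point\<close> identifies cyclic words of length \<open>n\<close> with points of period \<open>n\<close>; reading
  off the coordinates \<open>0, \<dots>, n - 1\<close> is its inverse.\<close>

definition periodic_point :: "'a list \<Rightarrow> (int \<Rightarrow> 'a)" where
  "periodic_point w = (\<lambda>i. w ! nat (i mod int (length w)))"

definition induced_perm :: "'a set \<Rightarrow> ((int \<Rightarrow> 'a) \<Rightarrow> (int \<Rightarrow> 'a)) \<Rightarrow> 'a list \<Rightarrow> 'a list" where
  "induced_perm A f = (\<lambda>w \<in> all_cyc_words A. map (\<lambda>i. f (periodic_point w) (int i)) [0..<length w])"

definition zero_pad :: "'a \<Rightarrow> nat \<Rightarrow> 'a list \<Rightarrow> 'a list" where
  "zero_pad z n u = u @ replicate (n - length u) z"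

text \<open>The set \<open>{u\<^sub>1, \<dots>, u\<^sub>k}\<close> is given as a list \<open>us\<close> indexed by \<open>0, \<dots>, k - 1\<close>.\<close>

definition safe :: "'a set \<Rightarrow> 'a \<Rightarrow> nat \<Rightarrow> 'a list list \<Rightarrow> bool" where
  "safe A z n0 us \<longleftrightarrow>
     (\<forall>u \<in> set us. u \<noteq> [] \<and> set u \<subseteq> A \<and> hd u \<noteq> z \<and> last u \<noteq> z \<and> length u \<le> n0) \<and>
     distinct us \<and>
     (\<forall>n \<ge> n0. \<forall>i < length us. \<forall>i' < length us. \<forall>j j'.
        cshift j (zero_pad z n (us ! i)) = cshift j' (zero_pad z n (us ! i')) \<longrightarrow>
        i = i' \<and> [j = j'] (mod int n))"

definition AFO_perms :: "'a set \<Rightarrow> 'a \<Rightarrow> ('a list \<Rightarrow> 'a list) set" where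
  "AFO_perms A z = {p \<in> Bij (all_cyc_words A). \<exists>n0 us \<pi> ns.
     safe A z n0 us \<and> \<pi> permutes {..<length us} \<and>
     (\<forall>w \<in> all_cyc_words A. length w < n0 \<longrightarrow> p w = w) \<and>
     (\<forall>n \<ge> n0. \<forall>i < length us. \<forall>j.
        p (cshift j (zero_pad z n (us ! i))) = cshift (j + ns i) (zero_pad z n (us ! \<pi> i))) \<and>
     (\<forall>w \<in> all_cyc_words A. n0 \<le> length w \<longrightarrow>
        (\<nexists>i j. i < length us \<and> w = cshift j (zero_pad z (length w) (us ! i))) \<longrightarrow> p w = w)}"

definition local_perms :: "'a set \<Rightarrow> nat \<Rightarrow> ('a list \<Rightarrow> 'a list) set" where
  "local_perms A n = {p \<in> Bij (all_cyc_words A).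
     (\<forall>w \<in> all_cyc_words A - cyc_words A n. p w = w) \<and> p ` cyc_words A n \<subseteq> cyc_words A n}"

definition generators :: "'a set \<Rightarrow> 'a \<Rightarrow> ('a list \<Rightarrow> 'a list) set" where
  "generators A z =
     induced_perm A ` shift_auts0 A z \<union> AFO_perms A z \<union> (\<Union>n \<in> {1..}. local_perms A n)"

definition perm_group :: "'a set \<Rightarrow> 'a \<Rightarrow> ('a list \<Rightarrow> 'a list) monoid" where
  "perm_group A z =
     (BijGroup (all_cyc_words A)) \<lparr>carrier := generate (BijGroup (all_cyc_words A)) (generators A z)\<rparr>"

end

theory Submission
  imports Defs
begin

text \<open>
  The group is embedded by letting it act on configurations over a larger alphabet.  A configuration
  is cut into maximal runs of cells that fit together, and a run of \<open>n\<close> cells carries a cyclic word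
  of length \<open>n\<close>.  A length-preserving permutation \<open>g\<close> of cyclic words acts by rewriting the word of
  every run.  Such an action commutes with the shift, respects products, and is faithful because every
  word occurs in some run.  The point is to choose the cells so that every element of the group acts by
  a local rule, although runs have unbounded length.

  The hard generators are the AFO permutations: their rule changes a pattern \<open>u\<close> only if the rest of the
  cyclic word is zero.  On a circle a cell cannot keep track of this: each automorphism moves the nonzero
  letters only a little, but when two nonzero blocks merge, no local information tells whether a third
  one is left.  On an interval it can: each cell records whether there is a nonzero cell to its left and
  whether there is one to its right.  An automorphism that fixes zero moves the first and the last nonzero
  cell by a bounded distance, so these labels are updated locally (\<open>local_act_by_spread\<close>), and
  a cell near \<open>u\<close> reads from them that \<open>u\<close> is alone (\<open>act_near\<close>).  Cyclic words are therefore folded: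
  a run lists the positions in the order \<open>0, -1, 1, -2, 2, \<dots>\<close>.  Neighbours on the circle are then at
  distance at most two in the run (\<open>fold_site_succ\<close>), so automorphisms remain local, and
  nothing can leave the run through its ends.

  Labels are consistent if neighbouring cells agree, but the outermost labels of a run may falsely
  claim nonzero cells beyond its ends.  No local rule can tell such a run from an honest one, and
  inside it an AFO permutation never sees an isolated \<open>u\<close>.  There a group element \<open>g\<close> acts
  through its asymptotic part \<open>g'\<close>, which is what \<open>g\<close> does to long repetitions of a word: it is
  \<open>g\<close> itself if an automorphism induces \<open>g\<close>, and the identity for the other generators.  As \<open>g\<close>
  determines \<open>g'\<close> (\<open>good_unique\<close>), the map from \<open>g\<close> to the action of the pair is still a
  homomorphism.

  The action is defined on the configurations all of whose runs are finite.  They are dense, and a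
  local action extends from them to all configurations (\<open>extend_compose\<close>).
\<close>

section \<open>Automorphisms of a full shift as local rules\<close>

definition agree :: "int \<Rightarrow> int \<Rightarrow> (int \<Rightarrow> 'c) \<Rightarrow> (int \<Rightarrow> 'c) \<Rightarrow> bool" where
  "agree i R x y \<longleftrightarrow> (\<forall>k. \<bar>k - i\<bar> \<le> R \<longrightarrow> x k = y k)"

lemma agreeD: "agree i R x y \<Longrightarrow> \<bar>k - i\<bar> \<le> R \<Longrightarrow> x k = y k"
  by (simp add: agree_def)

lemma agree_sym: "agree i R x y \<Longrightarrow> agree i R y x"
  by (simp add: agree_def)

lemma agree_mono: "agree i R x y \<Longrightarrow> \<bar>i - j\<bar> + S \<le> R \<Longrightarrow> agree j S x y"
  by (auto simp: agree_def)

lemma topspace_full_shift: "topspace (full_shift C) = {x. \<forall>i. x i \<in> C}"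
  by (auto simp: full_shift_def PiE_def Pi_def)

lemma openin_cylinder:
  assumes "\<And>i. x i \<in> C"
  shows "openin (full_shift C) {y. (\<forall>i. y i \<in> C) \<and> agree j R x y}"
proof -
  have eq: "{y. (\<forall>i. y i \<in> C) \<and> agree j R x y}
      = (PiE UNIV (\<lambda>k. if \<bar>k - j\<bar> \<le> R then {x k} else C))"
  proof (rule Set.set_eqI, rule iffI)
    fix y assume "y \<in> {y. (\<forall>i. y i \<in> C) \<and> agree j R x y}"
    then show "y \<in> PiE UNIV (\<lambda>k. if \<bar>k - j\<bar> \<le> R then {x k} else C)"
      by (simp add: agree_def PiE_def Pi_def)
  next
    fix y assume "y \<in> PiE UNIV (\<lambda>k. if \<bar>k - j\<bar> \<le> R then {x k} else C)"
    then have y: "y k \<in> (if \<bar>k - j\<bar> \<le> R then {x k} else C)" for k by blast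
    have "y k \<in> C" for k using y[of k] assms[of k] by (cases "\<bar>k - j\<bar> \<le> R") auto
    moreover have "x k = y k" if "\<bar>k - j\<bar> \<le> R" for k using y[of k] that by simp
    ultimately show "y \<in> {y. (\<forall>i. y i \<in> C) \<and> agree j R x y}" by (simp add: agree_def)
  qed
  have "finite {k. (if \<bar>k - j\<bar> \<le> R then {x k} else C) \<noteq> C}"
    by (rule finite_subset[of _ "{j - R..j + R}"]) auto
  then show ?thesis
    unfolding eq full_shift_def
    by (subst openin_PiE_gen) (use assms in auto)
qed

lemma cylinder_basis:
  assumes "openin (full_shift C) U" "x \<in> U"
  shows "\<exists>R\<ge>0. {y. (\<forall>i. y i \<in> C) \<and> agree 0 R x y} \<subseteq> U"
proof -
  obtain V where V: "finite {i. V i \<noteq> C}" "\<And>i. V i \<subseteq> C" "x \<in> PiE UNIV V" "PiE UNIV V \<subseteq> U"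
  proof -
    have "\<exists>V. finite {i \<in> UNIV. V i \<noteq> topspace (discrete_topology C)} \<and>
        (\<forall>i\<in>UNIV. openin (discrete_topology C) (V i)) \<and> x \<in> PiE UNIV V \<and> PiE UNIV V \<subseteq> U"
      by (rule assms(1)[unfolded full_shift_def openin_product_topology_alt, rule_format, OF assms(2)])
    then obtain V where V: "finite {i \<in> UNIV. V i \<noteq> topspace (discrete_topology C)}"
        "\<forall>i\<in>UNIV. openin (discrete_topology C) (V i)" "x \<in> PiE UNIV V" "PiE UNIV V \<subseteq> U"
      by (elim exE conjE)
    have "V i \<subseteq> C" for i using V(2) by simp
    then show ?thesis using V by (intro that[of V]) simp_all
  qed
  define R where "R = Max (insert 0 (abs ` {i. V i \<noteq> C}))"
  have R: "\<bar>i\<bar> \<le> R" if "V i \<noteq> C" for i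
    unfolding R_def using V(1) that by (intro Max_ge) auto
  have "0 \<le> R"
    unfolding R_def using V(1) by (intro Max_ge) auto
  have "{y. (\<forall>i. y i \<in> C) \<and> agree 0 R x y} \<subseteq> PiE UNIV V"
  proof clarify
    fix y assume y: "\<forall>i. y i \<in> C" "agree 0 R x y"
    have "y i \<in> V i" for i
    proof (cases "V i = C")
      case False
      then have "y i = x i" using R y(2) by (simp add: agree_def)
      then show ?thesis using V(3) by (simp add: PiE_def Pi_def)
    qed (use y in simp)
    then show "y \<in> PiE UNIV V" by (simp add: PiE_def Pi_def)
  qed
  from subset_trans[OF this V(4)] \<open>0 \<le> R\<close> show ?thesis by (intro exI[of _ R] conjI)
qed

text \<open>The theorem of Curtis, Hedlund and Lyndon.  By continuity, each point has a cylinder on which the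
  symbol at the origin of the image is constant; finitely many of these cylinders cover the compact full
  shift, and the largest of their radii works everywhere.\<close>

theorem local_rule_of_continuous:
  assumes "finite C" and cont: "continuous_map (full_shift C) (full_shift C) f"
  shows "\<exists>R\<ge>0. \<forall>x y. (\<forall>i. x i \<in> C) \<longrightarrow> (\<forall>i. y i \<in> C) \<longrightarrow> agree 0 R x y \<longrightarrow> f x 0 = f y 0"
proof -
  let ?X = "{x :: int \<Rightarrow> 'a. \<forall>i. x i \<in> C}"
  define cyl where "cyl = (\<lambda>R x. {y. (\<forall>i. y i \<in> C) \<and> agree 0 R x y})"
  have proj: "continuous_map (full_shift C) (discrete_topology C) (\<lambda>x. f x 0)"
    using cont unfolding full_shift_def by (simp add: continuous_map_componentwise_UNIV)
  have "\<exists>R\<ge>0. cyl R x \<subseteq> {y \<in> ?X. f y 0 = f x 0}" if "x \<in> ?X" for x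
  proof -
    have "f x \<in> topspace (full_shift C)"
      using that continuous_map_image_subset_topspace[OF cont] unfolding topspace_full_shift by blast
    then have "f x 0 \<in> C" by (simp add: topspace_full_shift)
    then have "openin (full_shift C) {y \<in> topspace (full_shift C). f y 0 \<in> {f x 0}}"
      by (intro openin_continuous_map_preimage[OF proj]) simp
    then have "openin (full_shift C) {y \<in> ?X. f y 0 = f x 0}"
      by (simp add: topspace_full_shift)
    from cylinder_basis[OF this] that show ?thesis by (auto simp: cyl_def)
  qed
  then have "\<forall>x\<in>?X. \<exists>R. cyl R x \<subseteq> {y \<in> ?X. f y 0 = f x 0}" by blast
  then obtain r where r: "\<forall>x\<in>?X. cyl (r x) x \<subseteq> {y \<in> ?X. f y 0 = f x 0}"
    by (rule bchoice[THEN exE])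
  have "compact_space (full_shift C)"
    unfolding full_shift_def compact_space_product_topology
    using \<open>finite C\<close> compact_space_discrete_topology by blast
  moreover have "\<forall>U \<in> (\<lambda>x. cyl (r x) x) ` ?X. openin (full_shift C) U"
  proof clarify
    fix x :: "int \<Rightarrow> 'a" assume "\<forall>i. x i \<in> C"
    then show "openin (full_shift C) (cyl (r x) x)"
      unfolding cyl_def by (intro openin_cylinder) simp
  qed
  moreover have "topspace (full_shift C) \<subseteq> \<Union> ((\<lambda>x. cyl (r x) x) ` ?X)"
  proof
    fix x assume "x \<in> topspace (full_shift C)"
    then have "x \<in> ?X" "x \<in> cyl (r x) x"
      by (simp_all add: topspace_full_shift cyl_def agree_def)
    then show "x \<in> \<Union> ((\<lambda>x. cyl (r x) x) ` ?X)" by blast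
  qed
  ultimately have "\<exists>\<F>. finite \<F> \<and> \<F> \<subseteq> (\<lambda>x. cyl (r x) x) ` ?X \<and> topspace (full_shift C) \<subseteq> \<Union> \<F>"
    unfolding compact_space_alt by blast
  then obtain \<F> where F: "finite \<F>" "\<F> \<subseteq> (\<lambda>x. cyl (r x) x) ` ?X"
      "topspace (full_shift C) \<subseteq> \<Union> \<F>" by (elim exE conjE)
  then obtain P where P: "P \<subseteq> ?X" "finite P" "\<F> = (\<lambda>x. cyl (r x) x) ` P"
    using finite_subset_image[OF F(1,2)] by (elim exE conjE)
  have cover: "?X \<subseteq> (\<Union>x\<in>P. cyl (r x) x)"
    using F(3) unfolding P(3) topspace_full_shift .
  define R where "R = Max (insert 0 (r ` P))"
  have R: "r x \<le> R" if "x \<in> P" for x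
    unfolding R_def using P(2) that by (intro Max_ge) auto
  have "0 \<le> R"
    unfolding R_def using P(2) by (intro Max_ge) auto
  moreover have "f x 0 = f y 0" if "\<forall>i. x i \<in> C" "\<forall>i. y i \<in> C" "agree 0 R x y" for x y
  proof -
    have "x \<in> ?X" using that(1) by simp
    then obtain c where c: "c \<in> P" "x \<in> cyl (r c) c" using cover by blast
    have "y \<in> cyl (r c) c"
      using c that R[OF c(1)] by (auto simp: cyl_def agree_def)
    moreover have "c \<in> ?X" using c(1) P(1) by blast
    then have "cyl (r c) c \<subseteq> {y \<in> ?X. f y 0 = f c 0}" using r by simp
    ultimately have "f x 0 = f c 0" "f y 0 = f c 0" using c(2) by blast+
    then show ?thesis by simp
  qed
  ultimately show ?thesis by blast
qed

text \<open>Comparing images at two different places \<open>i\<close> and \<open>j\<close> makes this notion include commutation with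
  the shift.\<close>

definition block_local :: "'c set \<Rightarrow> int \<Rightarrow> ((int \<Rightarrow> 'c) \<Rightarrow> (int \<Rightarrow> 'c)) \<Rightarrow> bool" where
  "block_local C R F \<longleftrightarrow> (\<forall>x y i j. (\<forall>k. x k \<in> C) \<longrightarrow> (\<forall>k. y k \<in> C) \<longrightarrow>
     (\<forall>d. \<bar>d\<bar> \<le> R \<longrightarrow> x (i + d) = y (j + d)) \<longrightarrow> F x i = F y j)"

lemma shift_aut_translate:
  assumes F: "F \<in> shift_auts C" and x: "\<And>k. x k \<in> C"
  shows "F (\<lambda>k. x (k + i)) = (\<lambda>k. F x (k + i))"
proof (induction i rule: int_induct[where k = 0])
  case base
  then show ?case by simp
next
  case (step1 i)
  have "F (shift (\<lambda>k. x (k + i))) = shift (F (\<lambda>k. x (k + i)))"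
    using F x by (simp add: shift_auts_def topspace_full_shift)
  then show ?case using step1 by (simp add: shift_def algebra_simps)
next
  case (step2 i)
  have "F (shift (\<lambda>k. x (k + (i - 1)))) = shift (F (\<lambda>k. x (k + (i - 1))))"
    using F x by (simp add: shift_auts_def topspace_full_shift)
  then have "(\<lambda>k. F x (k + i)) = shift (F (\<lambda>k. x (k + (i - 1))))"
    using step2 by (simp add: shift_def algebra_simps)
  then have "F x (k + i) = F (\<lambda>k. x (k + (i - 1))) (k + 1)" for k
    unfolding shift_def by metis
  from this[of "k - 1" for k] show ?case by (auto simp: algebra_simps)
qed

lemma shift_auts_bij:
  assumes "F \<in> shift_auts C"
  shows "bij_betw F {x. \<forall>i. x i \<in> C} {x. \<forall>i. x i \<in> C}" "F \<in> extensional {x. \<forall>i. x i \<in> C}"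
proof -
  have "homeomorphic_map (full_shift C) (full_shift C) F" "F \<in> extensional (topspace (full_shift C))"
    using assms by (auto simp: shift_auts_def)
  then show "bij_betw F {x. \<forall>i. x i \<in> C} {x. \<forall>i. x i \<in> C}" "F \<in> extensional {x. \<forall>i. x i \<in> C}"
    unfolding topspace_full_shift[symmetric] bij_betw_def
    using homeomorphic_imp_injective_map homeomorphic_imp_surjective_map by blast+
qed

lemma shift_auts_block_local:
  assumes "finite C" "F \<in> shift_auts C"
  shows "\<exists>R\<ge>0. block_local C R F"
proof -
  have "continuous_map (full_shift C) (full_shift C) F"
    using assms(2) by (simp add: shift_auts_def homeomorphic_imp_continuous_map)
  from local_rule_of_continuous[OF assms(1) this] obtain R where "0 \<le> R" and
    R: "\<And>x y. (\<forall>i. x i \<in> C) \<Longrightarrow> (\<forall>i. y i \<in> C) \<Longrightarrow> agree 0 R x y \<Longrightarrow> F x 0 = F y 0"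
    by blast
  have "F x i = F y j" if "\<forall>k. x k \<in> C" "\<forall>k. y k \<in> C" "\<forall>d. \<bar>d\<bar> \<le> R \<longrightarrow> x (i + d) = y (j + d)" for x y i j
  proof -
    have "F (\<lambda>k. x (k + i)) 0 = F (\<lambda>k. y (k + j)) 0"
      by (rule R) (use that in \<open>auto simp: agree_def add.commute\<close>)
    then show ?thesis
      using that shift_aut_translate[OF assms(2), of x i] shift_aut_translate[OF assms(2), of y j] by simp
  qed
  with \<open>0 \<le> R\<close> show ?thesis unfolding block_local_def by blast
qed

text \<open>Continuity of the inverse needs no proof of its own: a continuous bijection of a compact Hausdorff space
  is a homeomorphism.\<close>

lemma shift_autsI:
  assumes "finite C" and ext: "F \<in> extensional {x. \<forall>i. x i \<in> C}"
    and bij: "bij_betw F {x. \<forall>i. x i \<in> C} {x. \<forall>i. x i \<in> C}" and loc: "block_local C R F"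
  shows "F \<in> shift_auts C"
proof -
  have maps: "\<forall>i. F x i \<in> C" if "\<forall>i. x i \<in> C" for x
    using bij that unfolding bij_betw_def by blast
  have "continuous_map (full_shift C) (discrete_topology C) (\<lambda>x. F x k)" for k
    unfolding continuous_map_def
  proof (intro conjI allI impI)
    show "(\<lambda>x. F x k) \<in> topspace (full_shift C) \<rightarrow> topspace (discrete_topology C)"
      using maps by (auto simp: topspace_full_shift)
    fix U assume "openin (discrete_topology C) U"
    show "openin (full_shift C) {x \<in> topspace (full_shift C). F x k \<in> U}"
    proof (subst openin_subopen, clarify)
      fix x assume x: "x \<in> topspace (full_shift C)" "F x k \<in> U"
      have "openin (full_shift C) {y. (\<forall>i. y i \<in> C) \<and> agree k R x y}"
        using x by (intro openin_cylinder) (auto simp: topspace_full_shift)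
      moreover have "{y. (\<forall>i. y i \<in> C) \<and> agree k R x y} \<subseteq> {x \<in> topspace (full_shift C). F x k \<in> U}"
      proof clarify
        fix y assume y: "\<forall>i. y i \<in> C" "agree k R x y"
        have "F x k = F y k"
          using loc[unfolded block_local_def, rule_format, of x y k k] x y by (simp add: topspace_full_shift agree_def)
        then show "y \<in> topspace (full_shift C) \<and> F y k \<in> U" using x y by (simp add: topspace_full_shift)
      qed
      moreover have "x \<in> {y. (\<forall>i. y i \<in> C) \<and> agree k R x y}"
        using x by (simp add: topspace_full_shift agree_def)
      ultimately show "\<exists>T. openin (full_shift C) T \<and> x \<in> T \<and> T \<subseteq> {x \<in> topspace (full_shift C). F x k \<in> U}"
        by (intro exI conjI)
    qed
  qed
  then have cont: "continuous_map (full_shift C) (full_shift C) F"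
    unfolding full_shift_def continuous_map_componentwise_UNIV by blast
  have "homeomorphic_map (full_shift C) (full_shift C) F"
  proof (rule continuous_imp_homeomorphic_map[OF cont])
    show "compact_space (full_shift C)"
      unfolding full_shift_def compact_space_product_topology
    using \<open>finite C\<close> compact_space_discrete_topology by blast
    show "Hausdorff_space (full_shift C)"
      unfolding full_shift_def Hausdorff_space_product_topology using Hausdorff_space_discrete_topology by blast
  qed (use bij in \<open>auto simp: topspace_full_shift bij_betw_def\<close>)
  moreover have "F (shift x) = shift (F x)" if "\<forall>i. x i \<in> C" for x
  proof
    fix i
    have "F (shift x) i = F x (i + 1)"
      using loc[unfolded block_local_def, rule_format, of "shift x" x i "i + 1"] that by (simp add: shift_def algebra_simps)
    then show "F (shift x) i = shift (F x) i" by (simp add: shift_def)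
  qed
  ultimately show ?thesis
    using ext by (simp add: shift_auts_def topspace_full_shift)
qed

lemma mult_Aut_shift:
  assumes "F \<in> shift_auts C" "G \<in> shift_auts C"
  shows "F \<otimes>\<^bsub>Aut_shift C\<^esub> G = compose {x. \<forall>i. x i \<in> C} F G"
proof -
  have "F \<in> Bij (topspace (full_shift C))" "G \<in> Bij (topspace (full_shift C))"
    using shift_auts_bij assms unfolding Bij_def topspace_full_shift by blast+
  then show ?thesis by (simp add: Aut_shift_def BijGroup_def topspace_full_shift)
qed

section \<open>Folding a cyclic word into an interval\<close>

lemma all_cyc_words_iff: "w \<in> all_cyc_words A \<longleftrightarrow> w \<noteq> [] \<and> set w \<subseteq> A"
  by (auto simp: all_cyc_words_def cyc_words_def Suc_le_eq)

lemma periodic_point_nth: "i < length w \<Longrightarrow> periodic_point w (int i) = w ! i"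
  by (simp add: periodic_point_def)

lemma periodic_point_cong:
  "a mod int (length w) = b mod int (length w) \<Longrightarrow> periodic_point w a = periodic_point w b"
  by (simp add: periodic_point_def)

lemma periodic_point_inject:
  assumes "length v = length w" "periodic_point v = periodic_point w"
  shows "v = w"
  using assms by (intro nth_equalityI) (auto simp flip: periodic_point_nth)

lemma periodic_point_in_set: "w \<noteq> [] \<Longrightarrow> periodic_point w a \<in> set w"
  by (simp add: periodic_point_def nat_less_iff)

lemma periodic_point_map:
  assumes "0 < n"
  shows "periodic_point (map (\<lambda>i. x (int i)) [0..<n]) a = x (a mod int n)"
  using assms by (simp add: periodic_point_def nat_less_iff)

lemma in_set_iff_periodic_point:
  "w \<noteq> [] \<Longrightarrow> c \<in> set w \<longleftrightarrow> (\<exists>a. periodic_point w a = c)"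
  using periodic_point_in_set periodic_point_nth in_set_conv_nth by metis

lemma length_cshift [simp]: "length (cshift j w) = length w"
  by (simp add: cshift_def)

lemma periodic_point_cshift:
  assumes "w \<noteq> []"
  shows "periodic_point (cshift j w) a = periodic_point w (a + j)"
proof -
  let ?n = "int (length w)"
  have n: "0 < ?n" using assms by simp
  have "nat (a mod ?n) < length w" using n by (simp add: nat_less_iff)
  moreover have "(nat (j mod ?n) + nat (a mod ?n)) mod length w = nat ((a + j) mod ?n)"
  proof -
    have "int ((nat (j mod ?n) + nat (a mod ?n)) mod length w) = (j mod ?n + a mod ?n) mod ?n"
      using n by (simp add: zmod_int)
    also have "\<dots> = (a + j) mod ?n" by (simp add: mod_add_eq add.commute)
    finally show ?thesis by linarith
  qed
  ultimately show ?thesis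
    by (simp add: periodic_point_def cshift_def nth_rotate)
qed

lemma periodic_point_zero_pad:
  assumes "length u \<le> n" "0 \<le> d" "d < int n"
  shows "periodic_point (zero_pad z n u) d = (if d < int (length u) then u ! nat d else z)"
  using assms by (auto simp: periodic_point_def zero_pad_def nth_append nat_less_iff)

text \<open>The sites \<open>0, 1, 2, 3, 4, \<dots>\<close> of an interval of length \<open>n\<close> hold the positions
  \<open>0, -1, 1, -2, 2, \<dots>\<close> of a circle of length \<open>n\<close>, so that even sites run forwards and odd sites
  run backwards.  \<open>fold_site n\<close> finds the site of a position and \<open>fold_index\<close> a position at a site; they
  are inverse to each other modulo \<open>n\<close>.\<close>

definition fold_site :: "int \<Rightarrow> int \<Rightarrow> int" where
  "fold_site n a = (if 2 * (a mod n) < n then 2 * (a mod n) else 2 * (n - a mod n) - 1)"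

definition fold_index :: "int \<Rightarrow> int" where
  "fold_index s = (if even s then s div 2 else - ((s + 1) div 2))"

lemma fold_site_bounds: "0 < n \<Longrightarrow> 0 \<le> fold_site n a" "0 < n \<Longrightarrow> fold_site n a < n"
  using pos_mod_bound[of n a] pos_mod_sign[of n a] by (auto simp: fold_site_def)

lemma fold_site_cong: "a mod n = b mod n \<Longrightarrow> fold_site n a = fold_site n b"
  by (simp add: fold_site_def)

lemma fold_index_site:
  assumes "0 < n"
  shows "fold_index (fold_site n a) mod n = a mod n"
proof -
  have "0 \<le> a mod n" "a mod n < n" using assms by simp_all
  have "(- (n - a mod n)) mod n = a mod n"
    by (metis minus_diff_eq mod_diff_right_eq mod_mod_trivial diff_zero mod_self minus_mod_self2)
  moreover have "fold_index (2 * m - 1) = - m" for m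
    by (simp add: fold_index_def)
  ultimately have "fold_index (2 * (n - a mod n) - 1) mod n = a mod n" by metis
  moreover have "fold_index (2 * (a mod n)) mod n = a mod n" by (simp add: fold_index_def)
  ultimately show ?thesis unfolding fold_site_def by simp
qed

lemma fold_site_index:
  assumes "0 \<le> s" "s < n"
  shows "fold_site n (fold_index s) = s"
proof (cases "even s")
  case True
  then obtain k where k: "s = 2 * k" by blast
  then have "k mod n = k" using assms by simp
  then show ?thesis using k assms by (simp add: fold_site_def fold_index_def)
next
  case False
  then obtain k where k: "s = 2 * k + 1" by (elim oddE)
  have "(- (k + 1)) mod n = (n - (k + 1)) mod n" by (metis diff_add_cancel diff_conv_add_uminus mod_add_self1)
  also have "\<dots> = n - (k + 1)" using assms k by (intro mod_pos_pos_trivial) auto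
  finally have "(- (k + 1)) mod n = n - (k + 1)" .
  moreover have "fold_index s = - (k + 1)" using k by (simp add: fold_index_def)
  ultimately have m: "fold_index s mod n = n - (k + 1)" by metis
  show ?thesis unfolding fold_site_def m using k assms by simp
qed

text \<open>One step along the circle, seen in an interval \<open>{l..r}\<close>: two cells to the right (left), unless the end
  of the interval is reached, where the walk changes to the strand of the other parity.\<close>

definition fold_up :: "int \<Rightarrow> int \<Rightarrow> int \<Rightarrow> int" where
  "fold_up l r c = (if c + 2 \<le> r then c + 2 else if c + 1 \<le> r then c + 1 else if l \<le> c - 1 then c - 1 else c)"

definition fold_down :: "int \<Rightarrow> int \<Rightarrow> int \<Rightarrow> int" where
  "fold_down l r c = (if l \<le> c - 2 then c - 2 else if l \<le> c - 1 then c - 1 else if c + 1 \<le> r then c + 1 else c)"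

lemma fold_site_succ:
  assumes "0 < n"
  shows "fold_site n (a + 1) = (if even (fold_site n a) then fold_up 0 (n - 1) (fold_site n a)
    else fold_down 0 (n - 1) (fold_site n a))"
proof -
  define b where "b = a mod n"
  have b: "0 \<le> b" "b < n" using assms by (simp_all add: b_def)
  have "(a + 1) mod n = (b + 1) mod n" by (simp add: b_def mod_add_left_eq)
  also have "\<dots> = (if b + 1 = n then 0 else b + 1)" using b by simp
  finally have b1: "(a + 1) mod n = (if b + 1 = n then 0 else b + 1)" .
  have s: "fold_site n a = (if 2 * b < n then 2 * b else 2 * (n - b) - 1)" by (simp add: fold_site_def b_def)
  show ?thesis
    unfolding s unfolding fold_site_def b1 fold_up_def fold_down_def using b by auto
qed

lemma fold_site_pred:
  assumes "0 < n"
  shows "fold_site n (a - 1) = (if even (fold_site n a) then fold_down 0 (n - 1) (fold_site n a)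
    else fold_up 0 (n - 1) (fold_site n a))"
proof -
  define b where "b = a mod n"
  have b: "0 \<le> b" "b < n" using assms by (simp_all add: b_def)
  have "(a - 1) mod n = (b - 1) mod n" by (simp add: b_def mod_diff_left_eq)
  also have "\<dots> = (if b = 0 then n - 1 else b - 1)" using b by (simp add: zmod_minus1)
  finally have b1: "(a - 1) mod n = (if b = 0 then n - 1 else b - 1)" .
  have s: "fold_site n a = (if 2 * b < n then 2 * b else 2 * (n - b) - 1)" by (simp add: fold_site_def b_def)
  show ?thesis
    unfolding s unfolding fold_site_def b1 fold_up_def fold_down_def using b by auto
qed

section \<open>Cells and runs\<close>

text \<open>Besides a letter, a cell records on which strand of the fold it lies (\<open>backward\<close>), and
  whether there is a nonzero cell to its left (\<open>lft\<close>) and to its right (\<open>rgt\<close>) in its run.  The \<open>tag\<close>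
  makes a cell count as nonzero regardless of its letter.\<close>

datatype 'a cell = Cell (letter: 'a) (backward: bool) (tag: bool) (lft: bool) (rgt: bool)

text \<open>A run may start on either strand; in a run that starts on the backward strand the fold is read in the
  opposite direction.\<close>

definition orient :: "bool \<Rightarrow> int" where "orient b = (if b then - 1 else 1)"

lemma orient_orient [simp]: "orient b * (orient b * a) = a"
  by (simp add: orient_def)

definition run_index :: "(int \<Rightarrow> 'a cell) \<Rightarrow> int \<Rightarrow> int \<Rightarrow> int" where
  "run_index y l c = orient (backward (y l)) * fold_index (c - l)"

definition run_place :: "(int \<Rightarrow> 'a cell) \<Rightarrow> int \<Rightarrow> int \<Rightarrow> int \<Rightarrow> int" where
  "run_place y l r a = l + fold_site (r - l + 1) (orient (backward (y l)) * a)"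

definition run_word :: "(int \<Rightarrow> 'a cell) \<Rightarrow> int \<Rightarrow> int \<Rightarrow> 'a list" where
  "run_word y l r = map (\<lambda>k. letter (y (run_place y l r (int k)))) [0..<nat (r - l + 1)]"

lemma run_place_bounds: "l \<le> r \<Longrightarrow> l \<le> run_place y l r a" "l \<le> r \<Longrightarrow> run_place y l r a \<le> r"
  using fold_site_bounds[of "r - l + 1" "orient (backward (y l)) * a"] by (simp_all add: run_place_def)

lemma run_place_index:
  assumes "l \<le> c" "c \<le> r"
  shows "run_place y l r (run_index y l c) = c"
  using assms by (simp add: run_place_def run_index_def fold_site_index)

lemma run_index_place:
  assumes "l \<le> r"
  shows "run_index y l (run_place y l r a) mod (r - l + 1) = a mod (r - l + 1)"
proof -
  let ?o = "orient (backward (y l))"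
  have "fold_index (fold_site (r - l + 1) (?o * a)) mod (r - l + 1) = (?o * a) mod (r - l + 1)"
    using assms by (intro fold_index_site) simp
  then have "(?o * fold_index (fold_site (r - l + 1) (?o * a))) mod (r - l + 1) = (?o * (?o * a)) mod (r - l + 1)"
    by (intro mod_mult_cong refl)
  then show ?thesis by (simp add: run_index_def run_place_def)
qed

lemma run_place_cong:
  assumes "a mod (r - l + 1) = b mod (r - l + 1)"
  shows "run_place y l r a = run_place y l r b"
proof -
  have "(orient (backward (y l)) * a) mod (r - l + 1) = (orient (backward (y l)) * b) mod (r - l + 1)"
    using assms by (intro mod_mult_cong refl)
  then show ?thesis unfolding run_place_def by (intro arg_cong[of _ _ "\<lambda>s. l + s"] fold_site_cong)
qed

lemma run_place_eq_iff:
  assumes "l \<le> r"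
  shows "run_place y l r a = run_place y l r b \<longleftrightarrow> a mod (r - l + 1) = b mod (r - l + 1)"
  using run_place_cong[of a r l b y] run_index_place[OF assms, of y a] run_index_place[OF assms, of y b] by auto

lemma length_run_word [simp]: "length (run_word y l r) = nat (r - l + 1)"
  by (simp add: run_word_def)

lemma periodic_point_run_word:
  assumes "l \<le> r"
  shows "periodic_point (run_word y l r) a = letter (y (run_place y l r a))"
proof -
  have "periodic_point (run_word y l r) a = letter (y (run_place y l r (a mod int (nat (r - l + 1)))))"
    unfolding run_word_def using assms by (intro periodic_point_map) simp
  then show ?thesis
    using run_place_cong[of "a mod (r - l + 1)" r l a y] assms by simp
qed

lemma letter_eq_periodic_point:
  assumes "l \<le> c" "c \<le> r"
  shows "letter (y c) = periodic_point (run_word y l r) (run_index y l c)"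
  using assms by (simp add: periodic_point_run_word run_place_index)

locale pointed_alphabet =
  fixes A :: "'a set" and z :: 'a
  assumes finite_A: "finite A" and z_in_A: "z \<in> A"
begin

definition nz :: "'a cell \<Rightarrow> bool" where
  "nz c \<longleftrightarrow> letter c \<noteq> z \<or> tag c"

text \<open>Cells \<open>i\<close> and \<open>i + 1\<close> belong to the same run iff they lie on different strands and each label
  is the one that the neighbour implies.\<close>

definition joined :: "(int \<Rightarrow> 'a cell) \<Rightarrow> int \<Rightarrow> bool" where
  "joined y i \<longleftrightarrow> backward (y (i + 1)) = (\<not> backward (y i)) \<and>
     lft (y (i + 1)) = (lft (y i) \<or> nz (y i)) \<and> rgt (y i) = (rgt (y (i + 1)) \<or> nz (y (i + 1)))"

definition is_run :: "(int \<Rightarrow> 'a cell) \<Rightarrow> int \<Rightarrow> int \<Rightarrow> bool" where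
  "is_run y l r \<longleftrightarrow> l \<le> r \<and> (\<forall>k. l \<le> k \<and> k < r \<longrightarrow> joined y k) \<and> \<not> joined y (l - 1) \<and> \<not> joined y r"

definition finite_runs :: "(int \<Rightarrow> 'a cell) \<Rightarrow> bool" where
  "finite_runs y \<longleftrightarrow> (\<forall>i. letter (y i) \<in> A) \<and> (\<forall>i. \<exists>l r. is_run y l r \<and> l \<le> i \<and> i \<le> r)"

lemma run_unique:
  assumes "is_run y l r" "is_run y l' r'" "l \<le> i" "i \<le> r" "l' \<le> i" "i \<le> r'"
  shows "l' = l" "r' = r"
proof -
  have joins: "joined y k" if "l \<le> k \<and> k < r \<or> l' \<le> k \<and> k < r'" for k
    using that assms(1,2) unfolding is_run_def by blast
  have breaks: "\<not> joined y (l - 1)" "\<not> joined y r" "\<not> joined y (l' - 1)" "\<not> joined y r'"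
    using assms(1,2) unfolding is_run_def by blast+
  have a: "\<not> l < l'" using joins[of "l' - 1"] breaks assms by linarith
  have b: "\<not> l' < l" using joins[of "l - 1"] breaks assms by linarith
  have c: "\<not> r < r'" using joins[of r] breaks assms by linarith
  have d: "\<not> r' < r" using joins[of r'] breaks assms by linarith
  show "l' = l" "r' = r" using a b c d by auto
qed

definition lo :: "(int \<Rightarrow> 'a cell) \<Rightarrow> int \<Rightarrow> int" where
  "lo y i = (THE l. \<exists>r. is_run y l r \<and> l \<le> i \<and> i \<le> r)"

definition hi :: "(int \<Rightarrow> 'a cell) \<Rightarrow> int \<Rightarrow> int" where
  "hi y i = (THE r. \<exists>l. is_run y l r \<and> l \<le> i \<and> i \<le> r)"

lemma run_at:
  assumes "is_run y l r" "l \<le> i" "i \<le> r"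
  shows "lo y i = l" "hi y i = r"
  unfolding lo_def hi_def using assms run_unique by (blast intro: the_equality)+

lemma finite_runsD:
  assumes "finite_runs y"
  shows "is_run y (lo y i) (hi y i)" "lo y i \<le> i" "i \<le> hi y i"
  using assms run_at unfolding finite_runs_def by metis+

lemma is_run_le: "is_run y l r \<Longrightarrow> l \<le> r"
  by (simp add: is_run_def)

text \<open>Within a run the labels hold no information of their own, except for the two outermost ones, which state
  what is claimed to lie beyond the ends of the run.\<close>

lemma run_lft:
  assumes "is_run y l r" "l \<le> c" "c \<le> r"
  shows "lft (y c) \<longleftrightarrow> lft (y l) \<or> (\<exists>k. l \<le> k \<and> k < c \<and> nz (y k))"
  using assms(2,3)
proof (induction c rule: int_ge_induct)
  case (step c)
  then have "joined y c" using assms(1) by (simp add: is_run_def)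
  then have "lft (y (c + 1)) \<longleftrightarrow> lft (y c) \<or> nz (y c)" by (simp add: joined_def)
  moreover have "k < c + 1 \<longleftrightarrow> k < c \<or> k = c" for k by auto
  ultimately show ?case using step by auto
qed auto

lemma run_rgt:
  assumes "is_run y l r" "l \<le> c" "c \<le> r"
  shows "rgt (y c) \<longleftrightarrow> rgt (y r) \<or> (\<exists>k. c < k \<and> k \<le> r \<and> nz (y k))"
  using assms(3,2)
proof (induction c rule: int_le_induct)
  case (step c)
  then have "joined y (c - 1)" using assms(1) by (simp add: is_run_def)
  then have "rgt (y (c - 1)) \<longleftrightarrow> rgt (y c) \<or> nz (y c)" by (simp add: joined_def)
  moreover have "c - 1 < k \<longleftrightarrow> c < k \<or> k = c" for k by auto
  ultimately show ?case using step by auto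
qed auto

lemma run_backward:
  assumes "is_run y l r" "l \<le> c" "c \<le> r"
  shows "backward (y c) \<longleftrightarrow> backward (y l) \<noteq> odd (c - l)"
  using assms(2,3)
proof (induction c rule: int_ge_induct)
  case (step c)
  then have "joined y c" using assms(1) by (simp add: is_run_def)
  then have "backward (y (c + 1)) = (\<not> backward (y c))" by (simp add: joined_def)
  then show ?case using step by auto
qed simp

lemma run_place_succ:
  assumes "is_run y l r"
  shows "run_place y l r (a + 1) = (if backward (y (run_place y l r a))
    then fold_down l r (run_place y l r a) else fold_up l r (run_place y l r a))" (is ?succ)
    and "run_place y l r (a - 1) = (if backward (y (run_place y l r a))
    then fold_up l r (run_place y l r a) else fold_down l r (run_place y l r a))" (is ?pred)
proof -
  let ?n = "r - l + 1"
  let ?o = "orient (backward (y l))"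
  let ?s = "fold_site ?n (?o * a)"
  have lr: "l \<le> r" using assms by (rule is_run_le)
  then have n: "0 < ?n" by simp
  have b: "backward (y (l + ?s)) \<longleftrightarrow> backward (y l) \<noteq> odd ?s"
    using run_backward[OF assms, of "l + ?s"] fold_site_bounds[OF n, of "?o * a"] by simp
  have up: "l + fold_up 0 (r - l + 1 - 1) s = fold_up l r (l + s)"
    and down: "l + fold_down 0 (r - l + 1 - 1) s = fold_down l r (l + s)" for s
    by (auto simp: fold_up_def fold_down_def)
  note steps = fold_site_succ[OF n, of "?o * a"] fold_site_pred[OF n, of "?o * a"]
  show ?succ
  proof (cases "backward (y l)")
    case True
    then have "?o * (a + 1) = ?o * a - 1" by (simp add: orient_def)
    then show ?thesis unfolding run_place_def b using True steps(2) by (simp only: up down if_distrib[of "\<lambda>x. l + x"]) simp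
  next
    case False
    then have "?o * (a + 1) = ?o * a + 1" by (simp add: orient_def)
    then show ?thesis unfolding run_place_def b using False steps(1) by (simp only: up down if_distrib[of "\<lambda>x. l + x"]) simp
  qed
  show ?pred
  proof (cases "backward (y l)")
    case True
    then have "?o * (a - 1) = ?o * a + 1" by (simp add: orient_def)
    then show ?thesis unfolding run_place_def b using True steps(1) by (simp only: up down if_distrib[of "\<lambda>x. l + x"]) simp
  next
    case False
    then have "?o * (a - 1) = ?o * a - 1" by (simp add: orient_def)
    then show ?thesis unfolding run_place_def b using False steps(2) by (simp only: up down if_distrib[of "\<lambda>x. l + x"]) simp
  qed
qed

section \<open>Permutations of cyclic words acting on runs\<close>

abbreviation zero_word :: "'a list \<Rightarrow> bool" where
  "zero_word w \<equiv> set w \<subseteq> {z}"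

definition written :: "(int \<Rightarrow> 'a cell) \<Rightarrow> int \<Rightarrow> 'a list \<Rightarrow> (int \<Rightarrow> bool) \<Rightarrow> int \<Rightarrow> bool" where
  "written y l w T k \<longleftrightarrow> periodic_point w (run_index y l k) \<noteq> z \<or> T k"

text \<open>The cell \<open>c\<close> of a run from \<open>l\<close> to \<open>r\<close> after its word and tags were replaced by \<open>w\<close> and \<open>T\<close>: strands
  and the two outermost labels are kept, and all other labels follow.\<close>

definition rewrite_run :: "(int \<Rightarrow> 'a cell) \<Rightarrow> int \<Rightarrow> int \<Rightarrow> 'a list \<Rightarrow> (int \<Rightarrow> bool) \<Rightarrow> int \<Rightarrow> 'a cell" where
  "rewrite_run y l r w T c = Cell (periodic_point w (run_index y l c)) (backward (y c)) (T c)
     (lft (y l) \<or> (\<exists>k. l \<le> k \<and> k < c \<and> written y l w T k))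
     (rgt (y r) \<or> (\<exists>k. c < k \<and> k \<le> r \<and> written y l w T k))"

text \<open>The runs on which a permutation \<open>g\<close> acts by its values and not through its asymptotic part: those
  that claim nothing beyond their ends.  A zero word is shown by a tag in the first cell.  Hence an
  active run always contains a nonzero cell.  Otherwise a permutation that moves a zero word could change
  what the neighbouring cells imply about each other, and a run could merge with the next one.\<close>

definition active :: "(int \<Rightarrow> 'a cell) \<Rightarrow> int \<Rightarrow> int \<Rightarrow> bool" where
  "active y l r \<longleftrightarrow> \<not> lft (y l) \<and> \<not> rgt (y r) \<and>
     (\<forall>k. l \<le> k \<and> k \<le> r \<longrightarrow> tag (y k) = (k = l \<and> zero_word (run_word y l r)))"

definition next_word where
  "next_word g g' y l r = (if active y l r then g (run_word y l r) else g' (run_word y l r))"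

definition next_tag where
  "next_tag g y l r k = (if active y l r then k = l \<and> zero_word (g (run_word y l r)) else tag (y k))"

definition act :: "('a list \<Rightarrow> 'a list) \<Rightarrow> ('a list \<Rightarrow> 'a list) \<Rightarrow> (int \<Rightarrow> 'a cell) \<Rightarrow> (int \<Rightarrow> 'a cell)" where
  "act g g' y c = (let l = lo y c; r = hi y c in
     rewrite_run y l r (next_word g g' y l r) (next_tag g y l r) c)"

lemma act_run:
  assumes "is_run y l r" "l \<le> c" "c \<le> r"
  shows "act g g' y c = rewrite_run y l r (next_word g g' y l r) (next_tag g y l r) c"
  using run_at[OF assms] by (simp add: act_def)

lemma finite_runs_is_run_ends:
  assumes "finite_runs y" "is_run y l r"
  shows "\<exists>r'. is_run y (r + 1) r'" "\<exists>l'. is_run y l' (l - 1)"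
proof -
  obtain l1 r1 where 1: "is_run y l1 r1" "l1 \<le> r + 1" "r + 1 \<le> r1"
    using assms(1) unfolding finite_runs_def by meson
  have "\<not> joined y r" using assms(2) by (simp add: is_run_def)
  have "l1 = r + 1"
  proof (rule ccontr)
    assume "l1 \<noteq> r + 1"
    then have "l1 \<le> r \<and> r < r1" using 1 by simp
    then show False using 1(1) \<open>\<not> joined y r\<close> unfolding is_run_def by blast
  qed
  then show "\<exists>r'. is_run y (r + 1) r'" using 1 by blast
next
  obtain l1 r1 where 1: "is_run y l1 r1" "l1 \<le> l - 1" "l - 1 \<le> r1"
    using assms(1) unfolding finite_runs_def by meson
  have "\<not> joined y (l - 1)" using assms(2) by (simp add: is_run_def)
  have "r1 = l - 1"
  proof (rule ccontr)
    assume "r1 \<noteq> l - 1"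
    then have "l1 \<le> l - 1 \<and> l - 1 < r1" using 1 by simp
    then show False using 1(1) \<open>\<not> joined y (l - 1)\<close> unfolding is_run_def by blast
  qed
  then show "\<exists>l'. is_run y l' (l - 1)" using 1 by blast
qed

lemma run_word_in:
  assumes "finite_runs y" "l \<le> r"
  shows "run_word y l r \<in> all_cyc_words A"
  using assms unfolding all_cyc_words_iff finite_runs_def by (auto simp: run_word_def)

lemma written_somewhere:
  assumes "l \<le> r" "length w = nat (r - l + 1)"
  shows "(\<exists>k. l \<le> k \<and> k \<le> r \<and> written y l w T k) \<longleftrightarrow> \<not> zero_word w \<or> (\<exists>k. l \<le> k \<and> k \<le> r \<and> T k)"
proof -
  have "w \<noteq> []" using assms by auto
  have "(\<exists>k. l \<le> k \<and> k \<le> r \<and> periodic_point w (run_index y l k) \<noteq> z) \<longleftrightarrow> \<not> zero_word w" (is "?L = ?R")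
  proof
    assume ?L
    then show ?R using periodic_point_in_set[OF \<open>w \<noteq> []\<close>] by blast
  next
    assume ?R
    then obtain c where "c \<in> set w" "c \<noteq> z" by blast
    then obtain a where a: "periodic_point w a \<noteq> z"
      using in_set_iff_periodic_point[OF \<open>w \<noteq> []\<close>, of c] by blast
    have "periodic_point w (run_index y l (run_place y l r a)) = periodic_point w a"
      using run_index_place[OF assms(1), of y a] assms by (intro periodic_point_cong) simp
    with a run_place_bounds[OF assms(1), of y a] show ?L
      by (intro exI[of _ "run_place y l r a"]) simp
  qed
  then show ?thesis unfolding written_def by blast
qed

lemma nz_somewhere:
  assumes "l \<le> r"
  shows "(\<exists>k. l \<le> k \<and> k \<le> r \<and> nz (y k)) \<longleftrightarrow>
    \<not> zero_word (run_word y l r) \<or> (\<exists>k. l \<le> k \<and> k \<le> r \<and> tag (y k))"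
proof -
  have "nz (y k) \<longleftrightarrow> written y l (run_word y l r) (\<lambda>k. tag (y k)) k" if "l \<le> k" "k \<le> r" for k
    using letter_eq_periodic_point[OF that, of y] by (simp add: nz_def written_def)
  then show ?thesis
    using written_somewhere[OF assms, of "run_word y l r" y "\<lambda>k. tag (y k)"] by auto
qed

text \<open>On runs that are not active the word \<open>w\<close> is replaced by \<open>g' w\<close>; as the tags stay, \<open>g'\<close> must not
  create or destroy zero words if the emptiness of the run is to be preserved.\<close>

definition admissible :: "('a list \<Rightarrow> 'a list) \<Rightarrow> ('a list \<Rightarrow> 'a list) \<Rightarrow> bool" where
  "admissible g g' \<longleftrightarrow> (\<forall>w \<in> all_cyc_words A.
     g w \<in> all_cyc_words A \<and> length (g w) = length w \<and>
     g' w \<in> all_cyc_words A \<and> length (g' w) = length w \<and> zero_word (g' w) = zero_word w)"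

context
  fixes g g' y
  assumes adm: "admissible g g'" and fin: "finite_runs y"
begin

lemma length_next_word:
  assumes "l \<le> r"
  shows "length (next_word g g' y l r) = nat (r - l + 1)" "next_word g g' y l r \<in> all_cyc_words A"
  using adm run_word_in[OF fin assms] by (auto simp: next_word_def admissible_def)

text \<open>What a run implies about the cells next to it depends only on its outermost labels and on whether it
  contains a nonzero cell.  Both are preserved.\<close>

lemma written_iff_nz_somewhere:
  assumes "l \<le> r"
  shows "(\<exists>k. l \<le> k \<and> k \<le> r \<and> written y l (next_word g g' y l r) (next_tag g y l r) k)
    \<longleftrightarrow> (\<exists>k. l \<le> k \<and> k \<le> r \<and> nz (y k))"
proof (cases "active y l r")
  case True
  have "\<not> zero_word (run_word y l r) \<or> (\<exists>k. l \<le> k \<and> k \<le> r \<and> tag (y k))"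
  proof (cases "zero_word (run_word y l r)")
    case True
    then have "tag (y l)" using \<open>active y l r\<close> assms by (simp add: active_def)
    then show ?thesis using assms by blast
  qed simp
  moreover have "\<not> zero_word (next_word g g' y l r) \<or> (\<exists>k. l \<le> k \<and> k \<le> r \<and> next_tag g y l r k)"
    using True assms by (cases "zero_word (g (run_word y l r))") (auto simp: next_word_def next_tag_def)
  ultimately show ?thesis
    using written_somewhere[OF assms length_next_word(1)[OF assms]] nz_somewhere[OF assms] by blast
next
  case False
  have "zero_word (g' (run_word y l r)) = zero_word (run_word y l r)"
    using adm run_word_in[OF fin assms] by (simp add: admissible_def)
  then show ?thesis
    using written_somewhere[OF assms length_next_word(1)[OF assms], of y "next_tag g y l r"] nz_somewhere[OF assms, of y] False
    by (simp add: next_word_def next_tag_def)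
qed

lemma act_cell:
  assumes "is_run y l r" "l \<le> c" "c \<le> r"
  shows "letter (act g g' y c) = periodic_point (next_word g g' y l r) (run_index y l c)"
    "tag (act g g' y c) = next_tag g y l r c" "backward (act g g' y c) = backward (y c)"
    "nz (act g g' y c) = written y l (next_word g g' y l r) (next_tag g y l r) c"
  using act_run[OF assms] by (simp_all add: rewrite_run_def nz_def written_def)

lemma lft_act:
  assumes "is_run y l r" "l \<le> c" "c \<le> r"
  shows "lft (act g g' y c) \<longleftrightarrow> lft (y l) \<or> (\<exists>k. l \<le> k \<and> k < c \<and> nz (act g g' y k))"
    "rgt (act g g' y c) \<longleftrightarrow> rgt (y r) \<or> (\<exists>k. c < k \<and> k \<le> r \<and> nz (act g g' y k))"
proof -
  have nz: "nz (act g g' y k) = written y l (next_word g g' y l r) (next_tag g y l r) k" if "l \<le> k" "k \<le> r" for k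
    using act_cell(4)[OF assms(1) that] .
  show "lft (act g g' y c) \<longleftrightarrow> lft (y l) \<or> (\<exists>k. l \<le> k \<and> k < c \<and> nz (act g g' y k))"
    using act_run[OF assms, of g g'] nz assms(3) by (auto simp: rewrite_run_def)
  show "rgt (act g g' y c) \<longleftrightarrow> rgt (y r) \<or> (\<exists>k. c < k \<and> k \<le> r \<and> nz (act g g' y k))"
    using act_run[OF assms, of g g'] nz assms(2) by (auto simp: rewrite_run_def)
qed

lemma nz_act_somewhere:
  assumes "is_run y l r"
  shows "(\<exists>k. l \<le> k \<and> k \<le> r \<and> nz (act g g' y k)) \<longleftrightarrow> (\<exists>k. l \<le> k \<and> k \<le> r \<and> nz (y k))"
  using written_iff_nz_somewhere[OF is_run_le[OF assms]] act_cell(4)[OF assms] by blast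

text \<open>The decomposition into runs is preserved: inside a run the new labels are consistent, and across the
  border of two runs the comparison has the same outcome as before.\<close>

lemma joined_act: "joined (act g g' y) i = joined y i"
proof (cases "joined y i")
  case True
  let ?l = "lo y i" and ?r = "hi y i"
  note run = finite_runsD[OF fin, of i]
  have r: "i < ?r" using True run by (cases "i = ?r") (auto simp: is_run_def)
  have split: "k < i + 1 \<longleftrightarrow> k < i \<or> k = i" "i < k \<longleftrightarrow> i + 1 < k \<or> k = i + 1" for k :: int by auto
  have "backward (act g g' y (i + 1)) = (\<not> backward (act g g' y i))"
    using act_cell(3)[OF run(1)] run r True by (simp add: joined_def)
  moreover have "lft (act g g' y (i + 1)) = (lft (act g g' y i) \<or> nz (act g g' y i))"
    using lft_act(1)[OF run(1), of i] lft_act(1)[OF run(1), of "i + 1"] run r unfolding split by auto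
  moreover have "rgt (act g g' y i) = (rgt (act g g' y (i + 1)) \<or> nz (act g g' y (i + 1)))"
    using lft_act(2)[OF run(1), of i] lft_act(2)[OF run(1), of "i + 1"] run r unfolding split by auto
  ultimately show ?thesis using True by (simp add: joined_def)
next
  case False
  let ?l = "lo y i"
  note run = finite_runsD[OF fin, of i]
  have "hi y i = i"
  proof (rule ccontr)
    assume "hi y i \<noteq> i"
    then have "joined y i" using run by (simp add: is_run_def)
    then show False using False by simp
  qed
  then have R1: "is_run y ?l i" "?l \<le> i" using run by simp_all
  obtain r where R2: "is_run y (i + 1) r" using finite_runs_is_run_ends(1)[OF fin R1(1)] by blast
  have "i + 1 \<le> r" using is_run_le[OF R2] .
  have last: "{k. ?l \<le> k \<and> k \<le> i} = insert i {k. ?l \<le> k \<and> k < i}" using R1(2) by auto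
  have "(\<exists>k \<in> {k. ?l \<le> k \<and> k \<le> i}. P k) \<longleftrightarrow> P i \<or> (\<exists>k \<in> {k. ?l \<le> k \<and> k < i}. P k)" for P
    unfolding last by (rule bex_simps)
  then have eq_last: "(\<exists>k. ?l \<le> k \<and> k \<le> i \<and> P k) \<longleftrightarrow> P i \<or> (\<exists>k. ?l \<le> k \<and> k < i \<and> P k)" for P
    by (simp only: Bex_def mem_Collect_eq conj_assoc)
  have first: "{k. i + 1 \<le> k \<and> k \<le> r} = insert (i + 1) {k. i + 1 < k \<and> k \<le> r}"
    using \<open>i + 1 \<le> r\<close> by auto
  have "(\<exists>k \<in> {k. i + 1 \<le> k \<and> k \<le> r}. P k) \<longleftrightarrow> P (i + 1) \<or> (\<exists>k \<in> {k. i + 1 < k \<and> k \<le> r}. P k)" for P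
    unfolding first by (rule bex_simps)
  then have eq_first: "(\<exists>k. i + 1 \<le> k \<and> k \<le> r \<and> P k) \<longleftrightarrow> P (i + 1) \<or> (\<exists>k. i + 1 < k \<and> k \<le> r \<and> P k)" for P
    by (simp only: Bex_def mem_Collect_eq conj_assoc)
  have "lft (act g g' y i) \<or> nz (act g g' y i) \<longleftrightarrow> lft (y i) \<or> nz (y i)"
    using lft_act(1)[OF R1 order_refl] run_lft[OF R1 order_refl] nz_act_somewhere[OF R1(1)]
    unfolding eq_last by blast
  moreover have "rgt (act g g' y (i + 1)) \<or> nz (act g g' y (i + 1)) \<longleftrightarrow> rgt (y (i + 1)) \<or> nz (y (i + 1))"
    using lft_act(2)[OF R2 order_refl \<open>i + 1 \<le> r\<close>] run_rgt[OF R2 order_refl \<open>i + 1 \<le> r\<close>]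
      nz_act_somewhere[OF R2] unfolding eq_first by blast
  moreover have "lft (act g g' y (i + 1)) = lft (y (i + 1))"
    using lft_act(1)[OF R2 order_refl \<open>i + 1 \<le> r\<close>] by auto
  moreover have "rgt (act g g' y i) = rgt (y i)"
    using lft_act(2)[OF R1 order_refl] by auto
  moreover have "backward (act g g' y i) = backward (y i)"
    using act_cell(3)[OF R1 order_refl] .
  moreover have "backward (act g g' y (i + 1)) = backward (y (i + 1))"
    using act_cell(3)[OF R2 order_refl \<open>i + 1 \<le> r\<close>] .
  ultimately show ?thesis unfolding joined_def by simp
qed

lemma is_run_act: "is_run (act g g' y) l r = is_run y l r"
  by (simp add: is_run_def joined_act)

lemma finite_runs_act: "finite_runs (act g g' y)"
  unfolding finite_runs_def is_run_act
proof (intro conjI allI)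
  fix i
  note run = finite_runsD[OF fin, of i]
  have "next_word g g' y (lo y i) (hi y i) \<in> all_cyc_words A"
    using length_next_word(2) is_run_le[OF run(1)] .
  then show "letter (act g g' y i) \<in> A"
    unfolding act_cell(1)[OF run] all_cyc_words_iff using periodic_point_in_set by blast
qed (use finite_runsD[OF fin] in blast)

lemma run_index_act:
  assumes "is_run y l r"
  shows "run_index (act g g' y) l = run_index y l" "run_place (act g g' y) l = run_place y l"
  using act_cell(3)[OF assms order_refl is_run_le[OF assms]]
  by (simp_all add: run_index_def run_place_def fun_eq_iff)

lemma run_word_act:
  assumes "is_run y l r"
  shows "run_word (act g g' y) l r = next_word g g' y l r"
proof (rule periodic_point_inject)
  have lr: "l \<le> r" using assms by (rule is_run_le)
  show "length (run_word (act g g' y) l r) = length (next_word g g' y l r)"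
    using length_next_word(1)[OF lr] by simp
  show "periodic_point (run_word (act g g' y) l r) = periodic_point (next_word g g' y l r)"
  proof
    fix a
    have "periodic_point (run_word (act g g' y) l r) a = letter (act g g' y (run_place y l r a))"
      unfolding periodic_point_run_word[OF lr] run_index_act[OF assms] ..
    also have "\<dots> = periodic_point (next_word g g' y l r) (run_index y l (run_place y l r a))"
      by (rule act_cell[OF assms run_place_bounds[OF lr]])
    also have "\<dots> = periodic_point (next_word g g' y l r) a"
      using run_index_place[OF lr, of y a] length_next_word(1)[OF lr] lr by (intro periodic_point_cong) simp
    finally show "periodic_point (run_word (act g g' y) l r) a = periodic_point (next_word g g' y l r) a" .
  qed
qed

lemma ends_act:
  assumes "is_run y l r"
  shows "lft (act g g' y l) = lft (y l)" "rgt (act g g' y r) = rgt (y r)"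
  using lft_act(1)[OF assms order_refl is_run_le[OF assms]] lft_act(2)[OF assms is_run_le[OF assms] order_refl] by auto

lemma active_act:
  assumes "is_run y l r"
  shows "active (act g g' y) l r = active y l r"
proof (cases "active y l r")
  case True
  then show ?thesis
    unfolding active_def ends_act[OF assms] run_word_act[OF assms]
    using act_cell(2)[OF assms] by (simp add: next_word_def next_tag_def active_def)
next
  case False
  have "zero_word (g' (run_word y l r)) = zero_word (run_word y l r)"
    using adm run_word_in[OF fin is_run_le[OF assms]] by (simp add: admissible_def)
  then show ?thesis using False
    unfolding active_def[of "act g g' y"] ends_act[OF assms] run_word_act[OF assms]
    using act_cell(2)[OF assms] by (simp add: next_word_def next_tag_def) (simp add: active_def)
qed

end

section \<open>Extending a local action to all configurations\<close>

lemma rewrite_run_cong: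
  assumes "run_index y l = run_index y' l'" and "backward (y c) = backward (y' c)"
    and "lft (y l) = lft (y' l)" and "rgt (y r) = rgt (y' r)" and "l = l'" "l \<le> c" "c \<le> r"
    and T: "\<And>k. l \<le> k \<Longrightarrow> k \<le> r \<Longrightarrow> T k = T' k"
  shows "rewrite_run y l r w T c = rewrite_run y' l' r w T' c"
proof -
  have "written y l w T k = written y' l w T' k" if "l \<le> k" "k \<le> r" for k
    using assms(1,5) T[OF that] by (simp add: written_def)
  then show ?thesis
    using assms by (auto simp: rewrite_run_def)
qed

lemma act_compose:
  assumes adm1: "admissible g1 g1'" and adm2: "admissible g2 g2'" and fin: "finite_runs y"
    and g3: "\<And>w. w \<in> all_cyc_words A \<Longrightarrow> g3 w = g1 (g2 w)"
    and g3': "\<And>w. w \<in> all_cyc_words A \<Longrightarrow> g3' w = g1' (g2' w)"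
  shows "act g1 g1' (act g2 g2' y) = act g3 g3' y"
proof
  fix c
  let ?l = "lo y c" and ?r = "hi y c" and ?y = "act g2 g2' y"
  note run = finite_runsD[OF fin, of c]
  note lr = is_run_le[OF run(1)]
  have run2: "is_run ?y ?l ?r" using run(1) by (simp add: is_run_act[OF adm2 fin])
  note word = run_word_act[OF adm2 fin run(1)] and active = active_act[OF adm2 fin run(1)]
  have w: "run_word y ?l ?r \<in> all_cyc_words A" by (rule run_word_in[OF fin lr])
  have words: "next_word g1 g1' ?y ?l ?r = next_word g3 g3' y ?l ?r"
    using g3[OF w] g3'[OF w] by (simp add: next_word_def[of g1] next_word_def[of g3] word active) (simp add: next_word_def)
  have tags: "next_tag g1 ?y ?l ?r k = next_tag g3 y ?l ?r k" if "?l \<le> k" "k \<le> ?r" for k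
    using g3[OF w] act_cell(2)[OF adm2 fin run(1) that]
    by (simp add: next_tag_def[of g1] next_tag_def[of g3] word active) (simp add: next_word_def next_tag_def)
  have "act g1 g1' ?y c = rewrite_run ?y ?l ?r (next_word g1 g1' ?y ?l ?r) (next_tag g1 ?y ?l ?r) c"
    by (rule act_run[OF run2 run(2,3)])
  also have "\<dots> = rewrite_run y ?l ?r (next_word g3 g3' y ?l ?r) (next_tag g3 y ?l ?r) c"
    unfolding words
  proof (rule rewrite_run_cong)
    show "run_index ?y ?l = run_index y ?l" by (rule run_index_act[OF adm2 fin run(1)])
    show "backward (?y c) = backward (y c)" by (rule act_cell(3)[OF adm2 fin run])
    show "lft (?y ?l) = lft (y ?l)" "rgt (?y ?r) = rgt (y ?r)" by (rule ends_act[OF adm2 fin run(1)])+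
  qed (use run tags in simp_all)
  also have "\<dots> = act g3 g3' y c" by (rule act_run[OF run, symmetric])
  finally show "act g1 g1' ?y c = act g3 g3' y c" .
qed

lemma act_cell_eqI:
  assumes run: "is_run y l r" "l \<le> c" "c \<le> r"
    and word: "next_word g g' y l r = run_word y l r"
  shows "act g g' y c = y c"
proof -
  have tags: "next_tag g y l r k = tag (y k)" if "l \<le> k" "k \<le> r" for k
    using word that by (auto simp: next_tag_def next_word_def active_def split: if_splits)
  have "written y l (next_word g g' y l r) (next_tag g y l r) k = nz (y k)" if "l \<le> k" "k \<le> r" for k
    using letter_eq_periodic_point[OF that, of y] tags[OF that] word by (simp add: written_def nz_def)
  then show ?thesis
    using act_run[OF run, of g g'] tags[OF run(2,3)] word letter_eq_periodic_point[OF run(2,3), of y]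
      run_lft[OF run] run_rgt[OF run] run
    by (intro cell.expand) (auto simp: rewrite_run_def)
qed

lemma act_id:
  assumes "finite_runs y" "\<And>w. w \<in> all_cyc_words A \<Longrightarrow> g w = w \<and> g' w = w"
  shows "act g g' y = y"
proof
  fix c
  note run = finite_runsD[OF assms(1), of c]
  have "next_word g g' y (lo y c) (hi y c) = run_word y (lo y c) (hi y c)"
    using assms(2)[OF run_word_in[OF assms(1) is_run_le[OF run(1)]]] by (simp add: next_word_def)
  then show "act g g' y c = y c" by (rule act_cell_eqI[OF run])
qed

lemma is_run_translate: "is_run (\<lambda>k. y (k + t)) l r = is_run y (l + t) (r + t)"
proof -
  have j: "joined (\<lambda>k. y (k + t)) k = joined y (k + t)" for k
    by (simp add: joined_def algebra_simps)
  have "(\<forall>k. l \<le> k \<and> k < r \<longrightarrow> joined y (k + t)) \<longleftrightarrow> (\<forall>k. l + t \<le> k \<and> k < r + t \<longrightarrow> joined y k)" (is "?L = ?R")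
  proof
    assume ?L
    then have "l \<le> k - t \<and> k - t < r \<longrightarrow> joined y (k - t + t)" for k by blast
    then show ?R by (simp add: algebra_simps)
  qed simp
  then show ?thesis unfolding is_run_def j by (simp add: algebra_simps)
qed

lemma act_translate:
  assumes "finite_runs y"
  shows "act g g' (\<lambda>k. y (k + t)) c = act g g' y (c + t)"
proof -
  let ?y = "\<lambda>k. y (k + t)"
  let ?l = "lo y (c + t) - t" and ?r = "hi y (c + t) - t"
  note run = finite_runsD[OF assms, of "c + t"]
  have run': "is_run ?y ?l ?r" "?l \<le> c" "c \<le> ?r" using run by (simp_all add: is_run_translate)
  have idx: "run_index ?y ?l k = run_index y (lo y (c + t)) (k + t)" for k
    by (simp add: run_index_def algebra_simps)
  have "run_place ?y ?l ?r a + t = run_place y (lo y (c + t)) (hi y (c + t)) a" for a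
    by (simp add: run_place_def)
  then have word: "run_word ?y ?l ?r = run_word y (lo y (c + t)) (hi y (c + t))"
    by (simp add: run_word_def)
  have all: "(\<forall>k. ?l \<le> k \<and> k \<le> ?r \<longrightarrow> P (k + t)) \<longleftrightarrow> (\<forall>k. lo y (c + t) \<le> k \<and> k \<le> hi y (c + t) \<longrightarrow> P k)" (is "?L = ?R") for P
  proof
    assume ?L
    then have "?l \<le> k - t \<and> k - t \<le> ?r \<longrightarrow> P (k - t + t)" for k by blast
    then show ?R by simp
  qed simp
  have act: "active ?y ?l ?r = active y (lo y (c + t)) (hi y (c + t))"
    unfolding active_def word
    using all[of "\<lambda>k. tag (y k) = (k = lo y (c + t) \<and> zero_word (run_word y (lo y (c + t)) (hi y (c + t))))"]
    by (simp add: algebra_simps)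
  have nw: "next_word g g' ?y ?l ?r = next_word g g' y (lo y (c + t)) (hi y (c + t))"
    by (simp add: next_word_def word act)
  have nt: "next_tag g ?y ?l ?r k = next_tag g y (lo y (c + t)) (hi y (c + t)) (k + t)" for k
    by (auto simp: next_tag_def word act)
  have wr: "written ?y ?l w (next_tag g ?y ?l ?r) k = written y (lo y (c + t)) w (next_tag g y (lo y (c + t)) (hi y (c + t))) (k + t)" for w k
    unfolding written_def idx nt ..
  have ex: "(\<exists>k. ?l \<le> k \<and> k < c \<and> P (k + t)) \<longleftrightarrow> (\<exists>k. lo y (c + t) \<le> k \<and> k < c + t \<and> P k)" (is "?L = ?R") for P
  proof
    assume ?R
    then obtain k where "lo y (c + t) \<le> k \<and> k < c + t \<and> P k" by blast
    then show ?L by (intro exI[of _ "k - t"]) simp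
  next
    assume ?L
    then obtain k where "?l \<le> k \<and> k < c \<and> P (k + t)" by blast
    then show ?R by (intro exI[of _ "k + t"]) simp
  qed
  have ex2: "(\<exists>k. c < k \<and> k \<le> ?r \<and> P (k + t)) \<longleftrightarrow> (\<exists>k. c + t < k \<and> k \<le> hi y (c + t) \<and> P k)" (is "?L = ?R") for P
  proof
    assume ?R
    then obtain k where "c + t < k \<and> k \<le> hi y (c + t) \<and> P k" by blast
    then show ?L by (intro exI[of _ "k - t"]) simp
  next
    assume ?L
    then obtain k where "c < k \<and> k \<le> ?r \<and> P (k + t)" by blast
    then show ?R by (intro exI[of _ "k + t"]) simp
  qed
  show ?thesis
    unfolding act_run[OF run'] act_run[OF run] nw rewrite_run_def wr idx nt ex ex2 by simp
qed

definition cells :: "'a cell set" where "cells = {c. letter c \<in> A}"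

lemma finite_cells: "finite cells"
proof -
  have "cells \<subseteq> (\<lambda>(a, b, c, d, e). Cell a b c d e) ` (A \<times> UNIV \<times> UNIV \<times> UNIV \<times> UNIV)"
  proof
    fix c assume "c \<in> cells"
    then show "c \<in> (\<lambda>(a, b, c, d, e). Cell a b c d e) ` (A \<times> UNIV \<times> UNIV \<times> UNIV \<times> UNIV)"
      by (cases c) (auto simp: cells_def image_iff)
  qed
  then show ?thesis by (rule finite_subset) (use finite_A in simp)
qed

text \<open>Two adjacent blank cells are never joined, so configurations that are blank outside a finite set
  have finite runs only.\<close>

definition blank :: "'a cell" where "blank = Cell z False True False False"

lemma last_before:
  fixes l i :: int
  assumes "P l" "l \<le> i"
  shows "\<exists>l'. l' \<le> i \<and> P l' \<and> (\<forall>k. l' < k \<and> k \<le> i \<longrightarrow> \<not> P k)"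
  using assms(2)
proof (induction i rule: int_ge_induct)
  case base
  then show ?case using assms(1) by (intro exI[of _ l]) auto
next
  case (step i)
  show ?case
  proof (cases "P (i + 1)")
    case True
    then show ?thesis by (intro exI[of _ "i + 1"]) auto
  next
    case False
    obtain l' where "l' \<le> i" "P l'" "\<forall>k. l' < k \<and> k \<le> i \<longrightarrow> \<not> P k" using step by blast
    moreover have "k \<le> i \<or> k = i + 1" if "k \<le> i + 1" for k using that by auto
    ultimately show ?thesis using False by (intro exI[of _ l']) force
  qed
qed

lemma first_after:
  fixes r i :: int
  assumes "P r" "i \<le> r"
  shows "\<exists>r'. i \<le> r' \<and> P r' \<and> (\<forall>k. i \<le> k \<and> k < r' \<longrightarrow> \<not> P k)"
proof -
  obtain s where s: "s \<le> - i" "P (- s)" "\<forall>k. s < k \<and> k \<le> - i \<longrightarrow> \<not> P (- k)"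
    using last_before[of "\<lambda>k. P (- k)" "- r" "- i"] assms by auto
  have "\<not> P k" if "i \<le> k \<and> k < - s" for k using s(3)[rule_format, of "- k"] that by simp
  then show ?thesis using s by (intro exI[of _ "- s"]) auto
qed

lemma finite_runsI:
  assumes "\<And>i. letter (y i) \<in> A" and left: "\<And>i. \<exists>l \<le> i. \<not> joined y l" and right: "\<And>i. \<exists>r \<ge> i. \<not> joined y r"
  shows "finite_runs y"
  unfolding finite_runs_def
proof (intro conjI allI)
  fix i
  obtain l0 where "l0 \<le> i - 1" "\<not> joined y l0" using left by blast
  then obtain l where l: "l \<le> i - 1" "\<not> joined y l" "\<forall>k. l < k \<and> k \<le> i - 1 \<longrightarrow> joined y k"
    using last_before[of "\<lambda>l. \<not> joined y l" l0 "i - 1"] by auto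
  obtain r0 where "r0 \<ge> i" "\<not> joined y r0" using right by blast
  then obtain r where r: "i \<le> r" "\<not> joined y r" "\<forall>k. i \<le> k \<and> k < r \<longrightarrow> joined y k"
    using first_after[of "\<lambda>l. \<not> joined y l" r0 i] by auto
  have "joined y k" if "l + 1 \<le> k" "k < r" for k
    using l(3)[rule_format, of k] r(3)[rule_format, of k] that by linarith
  then have "is_run y (l + 1) r" using l r by (simp add: is_run_def)
  then show "\<exists>l r. is_run y l r \<and> l \<le> i \<and> i \<le> r" using l r by (intro exI[of _ "l + 1"] exI[of _ r]) simp
qed (rule assms)

lemma not_joined_blank: "y i = blank \<Longrightarrow> y (i + 1) = blank \<Longrightarrow> \<not> joined y i"
  by (simp add: joined_def blank_def nz_def)

definition cutoff :: "int \<Rightarrow> int \<Rightarrow> (int \<Rightarrow> 'a cell) \<Rightarrow> (int \<Rightarrow> 'a cell)" where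
  "cutoff i R y = (\<lambda>k. if \<bar>k - i\<bar> \<le> R then y k else blank)"

lemma agree_cutoff: "agree i R y (cutoff i R y)"
  by (simp add: agree_def cutoff_def)

lemma finite_runs_cutoff:
  assumes "\<And>k. y k \<in> cells"
  shows "finite_runs (cutoff i R y)"
proof (rule finite_runsI)
  show "letter (cutoff i R y k) \<in> A" for k
    using assms z_in_A by (simp add: cutoff_def cells_def blank_def)
  show "\<exists>l \<le> k. \<not> joined (cutoff i R y) l" for k
  proof -
    define m where "m = min k (i - \<bar>R\<bar> - 2)"
    have "m \<le> k" "m \<le> i - \<bar>R\<bar> - 2" by (simp_all add: m_def)
    moreover from this have "\<not> joined (cutoff i R y) m"
      by (intro not_joined_blank) (auto simp: cutoff_def)
    ultimately show ?thesis by blast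
  qed
  show "\<exists>l \<ge> k. \<not> joined (cutoff i R y) l" for k
  proof -
    define m where "m = max k (i + \<bar>R\<bar> + 1)"
    have "k \<le> m" "i + \<bar>R\<bar> + 1 \<le> m" by (simp_all add: m_def)
    moreover from this have "\<not> joined (cutoff i R y) m"
      by (intro not_joined_blank) (auto simp: cutoff_def)
    ultimately show ?thesis by blast
  qed
qed

text \<open>Only configurations with finite runs are compared; elsewhere the ends of a run, and with them \<open>act\<close>,
  have no meaning.\<close>

definition local_act :: "('a list \<Rightarrow> 'a list) \<Rightarrow> ('a list \<Rightarrow> 'a list) \<Rightarrow> int \<Rightarrow> bool" where
  "local_act g g' R \<longleftrightarrow> 0 \<le> R \<and> (\<forall>y y' i. finite_runs y \<longrightarrow> finite_runs y' \<longrightarrow> agree i R y y' \<longrightarrow>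
     act g g' y i = act g g' y' i)"

definition radius :: "('a list \<Rightarrow> 'a list) \<Rightarrow> ('a list \<Rightarrow> 'a list) \<Rightarrow> int" where
  "radius g g' = (SOME R. local_act g g' R)"

definition configs :: "(int \<Rightarrow> 'a cell) set" where "configs = {y. \<forall>i. y i \<in> cells}"

lemma finite_runs_configs: "finite_runs y \<Longrightarrow> y \<in> configs"
  by (simp add: finite_runs_def configs_def cells_def)

text \<open>On an arbitrary configuration the action at \<open>i\<close> is read off from a configuration with finite runs
  that agrees with it near \<open>i\<close>.  By locality the choice of that configuration does not matter.\<close>

definition extend :: "('a list \<Rightarrow> 'a list) \<Rightarrow> ('a list \<Rightarrow> 'a list) \<Rightarrow> (int \<Rightarrow> 'a cell) \<Rightarrow> (int \<Rightarrow> 'a cell)" where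
  "extend g g' = (\<lambda>y \<in> configs. \<lambda>i. act g g' (cutoff i (radius g g') y) i)"

lemma local_act_radius: "local_act g g' R \<Longrightarrow> local_act g g' (radius g g')"
  unfolding radius_def by (rule someI)

lemma extend_eq:
  assumes "local_act g g' R" "y \<in> configs" "finite_runs y'" "agree i (radius g g') y y'"
  shows "extend g g' y i = act g g' y' i"
proof -
  have "agree i (radius g g') (cutoff i (radius g g') y) y'"
    using assms(4) by (simp add: agree_def cutoff_def)
  then show ?thesis
    using local_act_radius[OF assms(1)] assms finite_runs_cutoff[of y]
    by (simp add: extend_def local_act_def configs_def)
qed

lemma extend_finite_runs:
  assumes "local_act g g' R" "finite_runs y"
  shows "extend g g' y = act g g' y"
  using extend_eq[OF assms(1) finite_runs_configs assms(2)] assms(2) by (simp add: fun_eq_iff agree_def)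

lemma extend_in:
  assumes "local_act g g' R" "admissible g g'" "y \<in> configs"
  shows "extend g g' y \<in> configs"
proof -
  have "extend g g' y i \<in> cells" for i
  proof -
    have fin: "finite_runs (cutoff i (radius g g') y)"
      using assms by (intro finite_runs_cutoff) (simp add: configs_def)
    have "extend g g' y i = act g g' (cutoff i (radius g g') y) i" using assms by (simp add: extend_def)
    then show ?thesis
      using finite_runs_configs[OF finite_runs_act[OF assms(2) fin]] by (simp add: configs_def)
  qed
  then show ?thesis by (simp add: configs_def)
qed

lemma extend_compose:
  assumes adm1: "admissible g1 g1'" and adm2: "admissible g2 g2'"
    and loc1: "local_act g1 g1' R1" and loc2: "local_act g2 g2' R2" and loc3: "local_act g3 g3' R3"
    and y: "y \<in> configs"
    and g3: "\<And>w. w \<in> all_cyc_words A \<Longrightarrow> g3 w = g1 (g2 w)"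
    and g3': "\<And>w. w \<in> all_cyc_words A \<Longrightarrow> g3' w = g1' (g2' w)"
  shows "extend g1 g1' (extend g2 g2' y) = extend g3 g3' y"
proof
  fix i
  let ?r1 = "radius g1 g1'" and ?r2 = "radius g2 g2'" and ?r3 = "radius g3 g3'"
  have pos: "0 \<le> ?r1" "0 \<le> ?r2" "0 \<le> ?r3"
    using local_act_radius[OF loc1] local_act_radius[OF loc2] local_act_radius[OF loc3]
    by (simp_all add: local_act_def)
  \<comment> \<open>One window that is large enough for all three actions.\<close>
  let ?y = "cutoff i (?r1 + ?r2 + ?r3) y"
  have fin: "finite_runs ?y" using y by (intro finite_runs_cutoff) (simp add: configs_def)
  have ag: "agree i (?r1 + ?r2 + ?r3) y ?y" by (rule agree_cutoff)
  have "extend g3 g3' y i = act g3 g3' ?y i"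
    using ag pos by (intro extend_eq[OF loc3 y fin]) (auto elim: agree_mono)
  also have "\<dots> = act g1 g1' (act g2 g2' ?y) i"
    using act_compose[OF adm1 adm2 fin, of g3 g3'] g3 g3' by simp
  also have "\<dots> = extend g1 g1' (extend g2 g2' y) i"
  proof (rule extend_eq[OF loc1 extend_in[OF loc2 adm2 y] finite_runs_act[OF adm2 fin], symmetric])
    show "agree i ?r1 (extend g2 g2' y) (act g2 g2' ?y)"
      unfolding agree_def
    proof (intro allI impI)
      fix k assume k: "\<bar>k - i\<bar> \<le> ?r1"
      show "extend g2 g2' y k = act g2 g2' ?y k"
        using k pos by (intro extend_eq[OF loc2 y fin] agree_mono[OF ag]) linarith
    qed
  qed
  finally show "extend g1 g1' (extend g2 g2' y) i = extend g3 g3' y i" ..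
qed

lemma block_local_extend:
  assumes loc: "local_act g g' R"
  shows "block_local cells (radius g g') (extend g g')"
  unfolding block_local_def
proof (intro allI impI)
  fix x y i j
  let ?R = "radius g g'"
  assume x: "\<forall>k. x k \<in> cells" and y: "\<forall>k. y k \<in> cells"
    and eq: "\<forall>d. \<bar>d\<bar> \<le> ?R \<longrightarrow> x (i + d) = y (j + d)"
  have fin: "finite_runs (cutoff i ?R x)" "finite_runs (cutoff j ?R y)"
    using x y by (auto intro: finite_runs_cutoff)
  have "cutoff i ?R x (k + (i - j)) = cutoff j ?R y k" for k
    using eq[rule_format, of "k - j"] by (simp add: cutoff_def algebra_simps)
  then have "(\<lambda>k. cutoff i ?R x (k + (i - j))) = cutoff j ?R y" by blast
  then have "act g g' (cutoff j ?R y) j = act g g' (cutoff i ?R x) i"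
    using act_translate[OF fin(1), of g g' "i - j" j] by simp
  then show "extend g g' x i = extend g g' y j"
    using x y by (simp add: extend_def configs_def)
qed

section \<open>Walking along a folded word\<close>

lemma joined_agree:
  "agree i R y y' \<Longrightarrow> i - R \<le> k \<Longrightarrow> k < i + R \<Longrightarrow> joined y k = joined y' k"
  by (simp add: joined_def agree_def)

lemma run_window_aux:
  assumes run1: "is_run y1 l1 r1" "l1 \<le> i" "i \<le> r1" and run2: "is_run y2 l2 r2" "l2 \<le> i" "i \<le> r2"
    and ag: "agree i R y1 y2" and m: "i - R \<le> m" "m \<le> i + R"
  shows "l1 \<le> m \<Longrightarrow> l2 \<le> m" and "m \<le> r1 \<Longrightarrow> m \<le> r2"
proof -
  show "l2 \<le> m" if "l1 \<le> m"
  proof (rule ccontr)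
    assume "\<not> l2 \<le> m"
    then have "joined y1 (l2 - 1) = joined y2 (l2 - 1)"
      using run2 m by (intro joined_agree[OF ag]) auto
    moreover have "joined y1 (l2 - 1)" using run1 run2 that \<open>\<not> l2 \<le> m\<close> by (simp add: is_run_def)
    ultimately show False using run2(1) by (simp add: is_run_def)
  qed
  show "m \<le> r2" if "m \<le> r1"
  proof (rule ccontr)
    assume "\<not> m \<le> r2"
    then have "joined y1 r2 = joined y2 r2"
      using run2 m by (intro joined_agree[OF ag]) auto
    moreover have "joined y1 r2" using run1 run2 that \<open>\<not> m \<le> r2\<close> by (simp add: is_run_def)
    ultimately show False using run2(1) by (simp add: is_run_def)
  qed
qed

text \<open>How far a run extends is visible inside the window: its end is the first place where two adjacent
  cells are not joined.\<close>

lemma run_window: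
  assumes run1: "is_run y1 l1 r1" "l1 \<le> i" "i \<le> r1" and run2: "is_run y2 l2 r2" "l2 \<le> i" "i \<le> r2"
    and ag: "agree i R y1 y2" and m: "i - R \<le> m" "m \<le> i + R"
  shows "l1 \<le> m \<longleftrightarrow> l2 \<le> m" and "m \<le> r1 \<longleftrightarrow> m \<le> r2"
  using run_window_aux[OF run1 run2 ag m] run_window_aux[OF run2 run1 agree_sym[OF ag] m] by blast+

lemma run_place_agree_aux:
  assumes run1: "is_run y1 l1 r1" "l1 \<le> i" "i \<le> r1" and run2: "is_run y2 l2 r2" "l2 \<le> i" "i \<le> r2"
    and ag: "agree i R y1 y2" and e: "e = 1 \<or> e = - 1"
  shows "2 * int n + 2 \<le> R \<Longrightarrow>
    run_place y1 l1 r1 (run_index y1 l1 i + e * int n) = run_place y2 l2 r2 (run_index y2 l2 i + e * int n)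
    \<and> \<bar>run_place y1 l1 r1 (run_index y1 l1 i + e * int n) - i\<bar> \<le> 2 * int n"
proof (induction n)
  case 0
  then show ?case using run_place_index[OF run1(2,3), of y1] run_place_index[OF run2(2,3), of y2] by simp
next
  case (Suc n)
  let ?a1 = "run_index y1 l1 i + e * int n" and ?a2 = "run_index y2 l2 i + e * int n"
  let ?c = "run_place y1 l1 r1 ?a1"
  have c: "run_place y2 l2 r2 ?a2 = ?c" "\<bar>?c - i\<bar> \<le> 2 * int n" using Suc by auto
  have "backward (y1 ?c) = backward (y2 ?c)"
    using agreeD[OF ag, of ?c] c Suc.prems by simp
  moreover have window: "l1 \<le> m \<longleftrightarrow> l2 \<le> m" "m \<le> r1 \<longleftrightarrow> m \<le> r2" if "\<bar>m - ?c\<bar> \<le> 2" for m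
    using run_window[OF run1 run2 ag, of m] that c Suc.prems by auto
  have "fold_up l1 r1 ?c = fold_up l2 r2 ?c" "fold_down l1 r1 ?c = fold_down l2 r2 ?c"
    using window(1)[of "?c - 2"] window(1)[of "?c - 1"] window(2)[of "?c + 1"] window(2)[of "?c + 2"]
    by (simp_all add: fold_up_def fold_down_def)
  moreover have "\<bar>fold_up l1 r1 ?c - ?c\<bar> \<le> 2" "\<bar>fold_down l1 r1 ?c - ?c\<bar> \<le> 2"
    by (simp_all add: fold_up_def fold_down_def)
  moreover have "run_place y l r (a + e) = (if backward (y (run_place y l r a)) = (e = 1)
      then fold_down l r (run_place y l r a) else fold_up l r (run_place y l r a))" if "is_run y l r" for y l r a
    using e run_place_succ[OF that, of a] by auto
  note this[OF run1(1), of ?a1] this[OF run2(1), of ?a2, unfolded c(1)]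
  ultimately have eq: "run_place y1 l1 r1 (?a1 + e) = run_place y2 l2 r2 (?a2 + e)"
      and near: "\<bar>run_place y1 l1 r1 (?a1 + e) - ?c\<bar> \<le> 2"
    by simp_all
  have triangle: "\<bar>p - i\<bar> \<le> 2 * int (Suc n)" if "\<bar>p - q\<bar> \<le> 2" "\<bar>q - i\<bar> \<le> 2 * int n" for p q :: int
    using that by simp
  have idx: "run_index y1 l1 i + e * int (Suc n) = ?a1 + e" "run_index y2 l2 i + e * int (Suc n) = ?a2 + e"
    by (simp_all add: algebra_simps)
  show ?case
    unfolding idx using eq triangle[OF near c(2)] by (intro conjI)
qed

text \<open>The lengths of the two runs and the offset of \<open>i\<close> in them may be different, but every step of the walk
  is decided by the strand of the current cell and by the ends of the run within distance two.\<close>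

lemma run_place_agree:
  assumes run1: "is_run y1 l1 r1" "l1 \<le> i" "i \<le> r1" and run2: "is_run y2 l2 r2" "l2 \<le> i" "i \<le> r2"
    and ag: "agree i R y1 y2" and R: "2 * \<bar>d\<bar> + 2 \<le> R"
  shows "run_place y1 l1 r1 (run_index y1 l1 i + d) = run_place y2 l2 r2 (run_index y2 l2 i + d)"
proof -
  have "sgn d * int (nat \<bar>d\<bar>) = d" "sgn d = 1 \<or> sgn d = - 1 \<or> d = 0" by (auto simp: sgn_if)
  then show ?thesis
    using run_place_agree_aux[OF run1 run2 ag, of "sgn d" "nat \<bar>d\<bar>"] R
      run_place_index[OF run1(2,3), of y1] run_place_index[OF run2(2,3), of y2] by auto
qed

lemma run_place_near:
  assumes run: "is_run y l r" "l \<le> i" "i \<le> r"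
  shows "\<bar>run_place y l r (run_index y l i + d) - i\<bar> \<le> 2 * \<bar>d\<bar>"
proof -
  have "sgn d * int (nat \<bar>d\<bar>) = d" "sgn d = 1 \<or> sgn d = - 1 \<or> d = 0" by (auto simp: sgn_if)
  then show ?thesis
    using run_place_agree_aux[OF run run, of "2 * \<bar>d\<bar> + 2" "sgn d" "nat \<bar>d\<bar>"]
      run_place_index[OF run(2,3), of y] by (auto simp: agree_def)
qed

lemma in_shift_auts0D:
  assumes "f \<in> shift_auts0 A z"
  shows "f \<in> shift_auts A" "f (\<lambda>_. z) = (\<lambda>_. z)"
  using assms by (simp_all add: shift_auts0_def)

lemma shift_auts0_inverse:
  assumes f: "f \<in> shift_auts0 A z"
  shows "\<exists>f' \<in> shift_auts0 A z. \<forall>x. (\<forall>i. x i \<in> A) \<longrightarrow> f' (f x) = x \<and> f (f' x) = x"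
proof -
  let ?T = "full_shift A"
  let ?X = "{x :: int \<Rightarrow> 'a. \<forall>i. x i \<in> A}"
  have hom: "homeomorphic_map ?T ?T f" using in_shift_auts0D(1)[OF f] by (simp add: shift_auts_def)
  then obtain h where h: "homeomorphic_maps ?T ?T f h" unfolding homeomorphic_map_maps by blast
  then have inv: "h (f x) = x" "f (h x) = x" if "x \<in> ?X" for x
    using that unfolding homeomorphic_maps_def topspace_full_shift by blast+
  define f' where "f' = restrict h ?X"
  have h_in: "h x \<in> ?X" if "x \<in> ?X" for x
    using h continuous_map_image_subset_topspace[of ?T ?T h] that
    unfolding homeomorphic_maps_def topspace_full_shift by blast
  have hom': "homeomorphic_map ?T ?T f'"
  proof (rule homeomorphic_map_eq)
    show "homeomorphic_map ?T ?T h" using h homeomorphic_maps_sym homeomorphic_map_maps by blast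
    show "h x = f' x" if "x \<in> topspace ?T" for x using that by (simp add: f'_def topspace_full_shift)
  qed
  have inj: "inj_on f ?X" using shift_auts_bij(1)[OF in_shift_auts0D(1)[OF f]] by (simp add: bij_betw_def)
  have comm: "f (shift x) = shift (f x)" if "x \<in> ?X" for x
    using in_shift_auts0D(1)[OF f] that by (simp add: shift_auts_def topspace_full_shift)
  have shift_in: "shift x \<in> ?X" if "x \<in> ?X" for x using that by (simp add: shift_def)
  have "f' (shift x) = shift (f' x)" if "x \<in> ?X" for x
  proof -
    have "f (h (shift x)) = f (shift (h x))"
      unfolding comm[OF h_in[OF that]] inv(2)[OF that] inv(2)[OF shift_in[OF that]] ..
    then have "h (shift x) = shift (h x)"
      using inj_onD[OF inj] h_in[OF that] h_in[OF shift_in[OF that]] shift_in by blast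
    then show ?thesis using that shift_in[OF that] by (simp add: f'_def)
  qed
  moreover have "f' (\<lambda>_. z) = (\<lambda>_. z)"
    using inv(1)[of "\<lambda>_. z"] z_in_A in_shift_auts0D(2)[OF f] by (simp add: f'_def)
  ultimately have "f' \<in> shift_auts0 A z"
    using hom' by (simp add: shift_auts0_def shift_auts_def topspace_full_shift f'_def)
  moreover have "f' (f x) = x \<and> f (f' x) = x" if "\<forall>i. x i \<in> A" for x
  proof -
    have "f x \<in> ?X" using shift_auts_bij(1)[OF in_shift_auts0D(1)[OF f]] that by (auto simp: bij_betw_def)
    then show ?thesis using inv[of x] that by (simp add: f'_def)
  qed
  ultimately show ?thesis by blast
qed

lemma periodic_point_configs: "w \<in> all_cyc_words A \<Longrightarrow> \<forall>i. periodic_point w i \<in> A"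
  unfolding all_cyc_words_iff using periodic_point_in_set by blast

lemma shift_auts0_in:
  "f \<in> shift_auts0 A z \<Longrightarrow> \<forall>i. x i \<in> A \<Longrightarrow> f x i \<in> A"
  using shift_auts_bij(1)[OF in_shift_auts0D(1)] by (fastforce simp: bij_betw_def)

lemma induced_perm_props:
  assumes f: "f \<in> shift_auts0 A z" and w: "w \<in> all_cyc_words A"
  shows "periodic_point (induced_perm A f w) = f (periodic_point w)"
    and "length (induced_perm A f w) = length w" and "induced_perm A f w \<in> all_cyc_words A"
proof -
  let ?n = "int (length w)"
  have ind: "induced_perm A f w = map (\<lambda>i. f (periodic_point w) (int i)) [0..<length w]"
    using w by (simp add: induced_perm_def)
  have n: "0 < length w" using w by (simp add: all_cyc_words_iff)
  show len: "length (induced_perm A f w) = length w" by (simp add: ind)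
  have per: "f (periodic_point w) (a mod ?n) = f (periodic_point w) a" for a
  proof -
    have "f (\<lambda>k. periodic_point w (k + (a mod ?n - a))) a = f (periodic_point w) (a mod ?n)"
      using shift_aut_translate[OF in_shift_auts0D(1)[OF f], of "periodic_point w" "a mod ?n - a"]
        periodic_point_configs[OF w] by (simp add: fun_eq_iff)
    moreover have "periodic_point w (k + (a mod ?n - a)) = periodic_point w k" for k
    proof (rule periodic_point_cong)
      have "(a mod ?n - a) mod ?n = 0" unfolding mod_diff_left_eq by simp
      then show "(k + (a mod ?n - a)) mod ?n = k mod ?n"
        by (metis add.right_neutral mod_add_right_eq)
    qed
    ultimately show ?thesis by simp
  qed
  show "periodic_point (induced_perm A f w) = f (periodic_point w)"
    unfolding ind using periodic_point_map[OF n, of "f (periodic_point w)"] per by (simp add: fun_eq_iff)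
  show "induced_perm A f w \<in> all_cyc_words A"
    using n shift_auts0_in[OF f periodic_point_configs[OF w]]
    unfolding all_cyc_words_iff ind by auto
qed

lemma zero_word_iff: "w \<noteq> [] \<Longrightarrow> zero_word w \<longleftrightarrow> periodic_point w = (\<lambda>_. z)"
  using in_set_iff_periodic_point[of w] periodic_point_in_set[of w] by (auto simp: fun_eq_iff)

lemma zero_word_induced_perm:
  assumes f: "f \<in> shift_auts0 A z" and w: "w \<in> all_cyc_words A"
  shows "zero_word (induced_perm A f w) = zero_word w"
proof -
  note p = induced_perm_props[OF f w]
  have "w \<noteq> []" "induced_perm A f w \<noteq> []" using w p(3) by (simp_all add: all_cyc_words_iff)
  moreover have "f (periodic_point w) = (\<lambda>_. z) \<longleftrightarrow> periodic_point w = (\<lambda>_. z)"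
  proof
    assume "f (periodic_point w) = (\<lambda>_. z)"
    then have "f (periodic_point w) = f (\<lambda>_. z)" using in_shift_auts0D(2)[OF f] by simp
    moreover have "inj_on f {x. \<forall>i. x i \<in> A}"
      using shift_auts_bij(1)[OF in_shift_auts0D(1)[OF f]] by (simp add: bij_betw_def)
    ultimately show "periodic_point w = (\<lambda>_. z)"
      using periodic_point_configs[OF w] z_in_A unfolding inj_on_def by simp
  qed (use in_shift_auts0D(2)[OF f] in simp)
  ultimately show ?thesis using p(1) by (simp add: zero_word_iff)
qed

lemma admissible_induced_perm:
  "f \<in> shift_auts0 A z \<Longrightarrow> admissible (induced_perm A f) (induced_perm A f)"
  using induced_perm_props zero_word_induced_perm by (simp add: admissible_def)

section \<open>Locality of the permutations induced by automorphisms\<close>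

text \<open>Nonzero cells neither appear nor disappear except near other nonzero cells.  So a nonzero cell far to the
  left of \<open>i\<close>, before or after the step, is witnessed by the old label at \<open>i - \<rho>\<close>, and all other
  nonzero cells to the left of \<open>i\<close> are close to \<open>i\<close>.\<close>

lemma lft_by_spread:
  assumes adm: "admissible g g'" and fin: "finite_runs y" and run: "is_run y l r" "l \<le> i - \<rho>" "i \<le> r" and "0 \<le> \<rho>"
    and forth: "\<And>c. l \<le> c \<Longrightarrow> c \<le> r \<Longrightarrow> nz (y c) \<Longrightarrow> \<exists>c'. l \<le> c' \<and> c' \<le> r \<and> \<bar>c' - c\<bar> \<le> \<rho> \<and> nz (act g g' y c')"
    and conv: "\<And>c. l \<le> c \<Longrightarrow> c \<le> r \<Longrightarrow> nz (act g g' y c) \<Longrightarrow> \<exists>c'. l \<le> c' \<and> c' \<le> r \<and> \<bar>c' - c\<bar> \<le> \<rho> \<and> nz (y c')"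
  shows "lft (act g g' y i) \<longleftrightarrow> lft (y (i - \<rho>)) \<or> (\<exists>c. l \<le> c \<and> i - 2 * \<rho> \<le> c \<and> c < i \<and> nz (act g g' y c))"
proof -
  have i: "l \<le> i" "i \<le> r" "l \<le> i - \<rho>" "i - \<rho> \<le> r" using run \<open>0 \<le> \<rho>\<close> by auto
  note new = lft_act(1)[OF adm fin run(1) i(1,2)] and old = run_lft[OF run(1) i(3,4)]
  show ?thesis
  proof
    assume "lft (act g g' y i)"
    then consider "lft (y l)" | c where "l \<le> c" "c < i" "nz (act g g' y c)" unfolding new by blast
    then show "lft (y (i - \<rho>)) \<or> (\<exists>c. l \<le> c \<and> i - 2 * \<rho> \<le> c \<and> c < i \<and> nz (act g g' y c))"
    proof cases
      case 1
      then show ?thesis using old by simp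
    next
      case 2
      show ?thesis
      proof (cases "i - 2 * \<rho> \<le> c")
        case True
        then show ?thesis using 2 by blast
      next
        case False
        obtain c' where "l \<le> c'" "c' \<le> r" "\<bar>c' - c\<bar> \<le> \<rho>" "nz (y c')"
          using conv[of c] 2 i by auto
        then have "l \<le> c'" "c' < i - \<rho>" "nz (y c')" using False by auto
        then show ?thesis using old by blast
      qed
    qed
  next
    assume "lft (y (i - \<rho>)) \<or> (\<exists>c. l \<le> c \<and> i - 2 * \<rho> \<le> c \<and> c < i \<and> nz (act g g' y c))"
    then consider "lft (y l)" | c where "l \<le> c" "c < i" "nz (act g g' y c)" | c where "l \<le> c" "c < i - \<rho>" "nz (y c)"
      unfolding old by blast
    then show "lft (act g g' y i)"
    proof cases
      case 3
      then obtain c' where "l \<le> c'" "c' \<le> r" "\<bar>c' - c\<bar> \<le> \<rho>" "nz (act g g' y c')"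
        using forth[of c] i by auto
      then have "l \<le> c'" "c' < i" "nz (act g g' y c')" using 3 by auto
      then show ?thesis unfolding new by blast
    qed (use new in blast)+
  qed
qed

lemma rgt_by_spread:
  assumes adm: "admissible g g'" and fin: "finite_runs y" and run: "is_run y l r" "l \<le> i" "i + \<rho> \<le> r" and "0 \<le> \<rho>"
    and forth: "\<And>c. l \<le> c \<Longrightarrow> c \<le> r \<Longrightarrow> nz (y c) \<Longrightarrow> \<exists>c'. l \<le> c' \<and> c' \<le> r \<and> \<bar>c' - c\<bar> \<le> \<rho> \<and> nz (act g g' y c')"
    and conv: "\<And>c. l \<le> c \<Longrightarrow> c \<le> r \<Longrightarrow> nz (act g g' y c) \<Longrightarrow> \<exists>c'. l \<le> c' \<and> c' \<le> r \<and> \<bar>c' - c\<bar> \<le> \<rho> \<and> nz (y c')"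
  shows "rgt (act g g' y i) \<longleftrightarrow> rgt (y (i + \<rho>)) \<or> (\<exists>c. c \<le> r \<and> c \<le> i + 2 * \<rho> \<and> i < c \<and> nz (act g g' y c))"
proof -
  have i: "l \<le> i" "i \<le> r" "l \<le> i + \<rho>" "i + \<rho> \<le> r" using run \<open>0 \<le> \<rho>\<close> by auto
  note new = lft_act(2)[OF adm fin run(1) i(1,2)] and old = run_rgt[OF run(1) i(3,4)]
  show ?thesis
  proof
    assume "rgt (act g g' y i)"
    then consider "rgt (y r)" | c where "i < c" "c \<le> r" "nz (act g g' y c)" unfolding new by blast
    then show "rgt (y (i + \<rho>)) \<or> (\<exists>c. c \<le> r \<and> c \<le> i + 2 * \<rho> \<and> i < c \<and> nz (act g g' y c))"
    proof cases
      case 1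
      then show ?thesis using old by simp
    next
      case 2
      show ?thesis
      proof (cases "c \<le> i + 2 * \<rho>")
        case True
        then show ?thesis using 2 by blast
      next
        case False
        obtain c' where "l \<le> c'" "c' \<le> r" "\<bar>c' - c\<bar> \<le> \<rho>" "nz (y c')"
          using conv[of c] 2 i by auto
        then have "i + \<rho> < c'" "c' \<le> r" "nz (y c')" using False by auto
        then show ?thesis using old by blast
      qed
    qed
  next
    assume "rgt (y (i + \<rho>)) \<or> (\<exists>c. c \<le> r \<and> c \<le> i + 2 * \<rho> \<and> i < c \<and> nz (act g g' y c))"
    then consider "rgt (y r)" | c where "i < c" "c \<le> r" "nz (act g g' y c)" | c where "i + \<rho> < c" "c \<le> r" "nz (y c)"
      unfolding old by blast
    then show "rgt (act g g' y i)"
    proof cases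
      case 3
      then obtain c' where "l \<le> c'" "c' \<le> r" "\<bar>c' - c\<bar> \<le> \<rho>" "nz (act g g' y c')"
        using forth[of c] i by auto
      then have "i < c'" "c' \<le> r" "nz (act g g' y c')" using 3 by auto
      then show ?thesis unfolding new by blast
    qed (use new in blast)+
  qed
qed

text \<open>If \<open>i - 2 * \<rho>\<close> still lies in the run, the new left label at \<open>i\<close> is given by the preceding formula, which
  is local; otherwise the left end of the run is visible.  The same holds on the right.\<close>

lemma local_act_by_spread:
  assumes adm: "admissible g g'" and "0 \<le> \<rho>" "0 \<le> s"
    and forth: "\<And>y l r c. finite_runs y \<Longrightarrow> is_run y l r \<Longrightarrow> l \<le> c \<Longrightarrow> c \<le> r \<Longrightarrow> nz (y c) \<Longrightarrow>
      \<exists>c'. l \<le> c' \<and> c' \<le> r \<and> \<bar>c' - c\<bar> \<le> \<rho> \<and> nz (act g g' y c')"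
    and conv: "\<And>y l r c. finite_runs y \<Longrightarrow> is_run y l r \<Longrightarrow> l \<le> c \<Longrightarrow> c \<le> r \<Longrightarrow> nz (act g g' y c) \<Longrightarrow>
      \<exists>c'. l \<le> c' \<and> c' \<le> r \<and> \<bar>c' - c\<bar> \<le> \<rho> \<and> nz (y c')"
    and symbols: "\<And>y y' c. finite_runs y \<Longrightarrow> finite_runs y' \<Longrightarrow> agree c s y y' \<Longrightarrow>
      letter (act g g' y c) = letter (act g g' y' c) \<and> tag (act g g' y c) = tag (act g g' y' c)"
  shows "local_act g g' (2 * \<rho> + s + 1)"
  unfolding local_act_def
proof (intro conjI allI impI)
  fix y1 y2 i
  \<comment> \<open>The new labels involve new letters up to \<open>2 * \<rho>\<close> away, and each of these depends on cells up to \<open>s\<close> away.\<close>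
  let ?R = "2 * \<rho> + s + 1"
  assume fin1: "finite_runs y1" and fin2: "finite_runs y2" and ag: "agree i ?R y1 y2"
  define l1 r1 l2 r2 where defs: "l1 = lo y1 i" "r1 = hi y1 i" "l2 = lo y2 i" "r2 = hi y2 i"
  note run1 = finite_runsD[OF fin1, of i, folded defs] and run2 = finite_runsD[OF fin2, of i, folded defs]
  note window = run_window[OF run1 run2 ag]
  have nz: "nz (act g g' y1 c) = nz (act g g' y2 c)" if "\<bar>c - i\<bar> \<le> 2 * \<rho>" for c
    using symbols[OF fin1 fin2 agree_mono[OF ag], of c] that by (auto simp: nz_def)
  have "lft (act g g' y1 i) = lft (act g g' y2 i)"
  proof (cases "l1 \<le> i - 2 * \<rho>")
    case True
    then have le: "l1 \<le> i - 2 * \<rho>" "l2 \<le> i - 2 * \<rho>" using window(1)[of "i - 2 * \<rho>"] \<open>0 \<le> \<rho>\<close> \<open>0 \<le> s\<close> by auto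
    have "lft (y1 (i - \<rho>)) = lft (y2 (i - \<rho>))"
      using agreeD[OF ag, of "i - \<rho>"] \<open>0 \<le> \<rho>\<close> \<open>0 \<le> s\<close> by simp
    moreover have "(\<exists>c. l1 \<le> c \<and> i - 2 * \<rho> \<le> c \<and> c < i \<and> nz (act g g' y1 c))
        \<longleftrightarrow> (\<exists>c. l2 \<le> c \<and> i - 2 * \<rho> \<le> c \<and> c < i \<and> nz (act g g' y2 c))"
    proof -
      have "(l1 \<le> c \<and> i - 2 * \<rho> \<le> c \<and> c < i \<and> nz (act g g' y1 c)) =
          (l2 \<le> c \<and> i - 2 * \<rho> \<le> c \<and> c < i \<and> nz (act g g' y2 c))" for c
        using le nz[of c] by auto
      then show ?thesis by simp
    qed
    moreover have "lft (act g g' y1 i) \<longleftrightarrow> lft (y1 (i - \<rho>)) \<or> (\<exists>c. l1 \<le> c \<and> i - 2 * \<rho> \<le> c \<and> c < i \<and> nz (act g g' y1 c))"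
    proof (rule lft_by_spread[OF adm fin1 run1(1) _ run1(3) \<open>0 \<le> \<rho>\<close>])
      show "l1 \<le> i - \<rho>" using le \<open>0 \<le> \<rho>\<close> by simp
    qed (rule forth[OF fin1 run1(1)] conv[OF fin1 run1(1)]; assumption)+
    moreover have "lft (act g g' y2 i) \<longleftrightarrow> lft (y2 (i - \<rho>)) \<or> (\<exists>c. l2 \<le> c \<and> i - 2 * \<rho> \<le> c \<and> c < i \<and> nz (act g g' y2 c))"
    proof (rule lft_by_spread[OF adm fin2 run2(1) _ run2(3) \<open>0 \<le> \<rho>\<close>])
      show "l2 \<le> i - \<rho>" using le \<open>0 \<le> \<rho>\<close> by simp
    qed (rule forth[OF fin2 run2(1)] conv[OF fin2 run2(1)]; assumption)+
    ultimately show ?thesis by simp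
  next
    case False
    have "l1 \<le> l2" "l2 \<le> l1"
      using window(1)[of l1] window(1)[of l2] window(1)[of "i - 2 * \<rho>"] False run1 run2 \<open>0 \<le> \<rho>\<close> \<open>0 \<le> s\<close> by auto
    then have eq: "l2 = l1" by simp
    have "lft (y1 l1) = lft (y2 l1)"
      using agreeD[OF ag, of l1] False run1 \<open>0 \<le> s\<close> by simp
    moreover have "(l1 \<le> k \<and> k < i \<and> nz (act g g' y1 k)) = (l1 \<le> k \<and> k < i \<and> nz (act g g' y2 k))" for k
      using False nz[of k] by auto
    ultimately show ?thesis
      unfolding lft_act(1)[OF adm fin1 run1] lft_act(1)[OF adm fin2 run2] eq by simp
  qed
  moreover have "rgt (act g g' y1 i) = rgt (act g g' y2 i)"
  proof (cases "i + 2 * \<rho> \<le> r1")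
    case True
    then have le: "i + 2 * \<rho> \<le> r1" "i + 2 * \<rho> \<le> r2" using window(2)[of "i + 2 * \<rho>"] \<open>0 \<le> \<rho>\<close> \<open>0 \<le> s\<close> by auto
    have "rgt (y1 (i + \<rho>)) = rgt (y2 (i + \<rho>))"
      using agreeD[OF ag, of "i + \<rho>"] \<open>0 \<le> \<rho>\<close> \<open>0 \<le> s\<close> by simp
    moreover have "(\<exists>c. c \<le> r1 \<and> c \<le> i + 2 * \<rho> \<and> i < c \<and> nz (act g g' y1 c))
        \<longleftrightarrow> (\<exists>c. c \<le> r2 \<and> c \<le> i + 2 * \<rho> \<and> i < c \<and> nz (act g g' y2 c))"
    proof -
      have "(c \<le> r1 \<and> c \<le> i + 2 * \<rho> \<and> i < c \<and> nz (act g g' y1 c)) =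
          (c \<le> r2 \<and> c \<le> i + 2 * \<rho> \<and> i < c \<and> nz (act g g' y2 c))" for c
        using le nz[of c] by auto
      then show ?thesis by simp
    qed
    moreover have "rgt (act g g' y1 i) \<longleftrightarrow> rgt (y1 (i + \<rho>)) \<or> (\<exists>c. c \<le> r1 \<and> c \<le> i + 2 * \<rho> \<and> i < c \<and> nz (act g g' y1 c))"
    proof (rule rgt_by_spread[OF adm fin1 run1(1,2) _ \<open>0 \<le> \<rho>\<close>])
      show "i + \<rho> \<le> r1" using le \<open>0 \<le> \<rho>\<close> by simp
    qed (rule forth[OF fin1 run1(1)] conv[OF fin1 run1(1)]; assumption)+
    moreover have "rgt (act g g' y2 i) \<longleftrightarrow> rgt (y2 (i + \<rho>)) \<or> (\<exists>c. c \<le> r2 \<and> c \<le> i + 2 * \<rho> \<and> i < c \<and> nz (act g g' y2 c))"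
    proof (rule rgt_by_spread[OF adm fin2 run2(1,2) _ \<open>0 \<le> \<rho>\<close>])
      show "i + \<rho> \<le> r2" using le \<open>0 \<le> \<rho>\<close> by simp
    qed (rule forth[OF fin2 run2(1)] conv[OF fin2 run2(1)]; assumption)+
    ultimately show ?thesis by simp
  next
    case False
    have "r1 \<le> r2" "r2 \<le> r1"
      using window(2)[of r1] window(2)[of r2] window(2)[of "i + 2 * \<rho>"] False run1 run2 \<open>0 \<le> \<rho>\<close> \<open>0 \<le> s\<close> by auto
    then have eq: "r2 = r1" by simp
    have "rgt (y1 r1) = rgt (y2 r1)"
      using agreeD[OF ag, of r1] False run1 \<open>0 \<le> s\<close> by simp
    moreover have "(i < k \<and> k \<le> r1 \<and> nz (act g g' y1 k)) = (i < k \<and> k \<le> r1 \<and> nz (act g g' y2 k))" for k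
      using False nz[of k] by auto
    ultimately show ?thesis
      unfolding lft_act(2)[OF adm fin1 run1] lft_act(2)[OF adm fin2 run2] eq by simp
  qed
  moreover have "backward (act g g' y1 i) = backward (act g g' y2 i)"
    using agreeD[OF ag, of i] \<open>0 \<le> \<rho>\<close> \<open>0 \<le> s\<close>
    unfolding act_cell(3)[OF adm fin1 run1] act_cell(3)[OF adm fin2 run2] by simp
  moreover have "letter (act g g' y1 i) = letter (act g g' y2 i) \<and> tag (act g g' y1 i) = tag (act g g' y2 i)"
    using \<open>0 \<le> \<rho>\<close> by (intro symbols[OF fin1 fin2] agree_mono[OF ag]) simp
  ultimately show "act g g' y1 i = act g g' y2 i" by (metis cell.expand)
qed (use \<open>0 \<le> \<rho>\<close> \<open>0 \<le> s\<close> in simp)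

text \<open>An automorphism that fixes zero turns zeros into zeros away from nonzero letters, and so does its
  inverse.  This gives the two spreading conditions.\<close>

lemma local_act_induced_perm:
  assumes f: "f \<in> shift_auts0 A z"
  shows "\<exists>R. local_act (induced_perm A f) (induced_perm A f) R"
proof -
  let ?g = "induced_perm A f"
  obtain f' where f': "f' \<in> shift_auts0 A z"
    and inv': "\<forall>x. (\<forall>i. x i \<in> A) \<longrightarrow> f' (f x) = x \<and> f (f' x) = x"
    using shift_auts0_inverse[OF f] by (elim bexE)
  have inv: "f' (f x) = x" if "\<forall>i. x i \<in> A" for x using inv' that by simp
  obtain s where s: "0 \<le> s" "block_local A s f"
    using shift_auts_block_local[OF finite_A in_shift_auts0D(1)[OF f]] by blast
  obtain s' where s': "0 \<le> s'" "block_local A s' f'"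
    using shift_auts_block_local[OF finite_A in_shift_auts0D(1)[OF f']] by blast
  note adm = admissible_induced_perm[OF f]
  define pt where "pt y l r = periodic_point (run_word y l r)" for y :: "int \<Rightarrow> 'a cell" and l r
  have pt: "pt y l r a = letter (y (run_place y l r a))" if "is_run y l r" for y l r a
    unfolding pt_def by (rule periodic_point_run_word[OF is_run_le[OF that]])
  have pt_in: "\<forall>a. pt y l r a \<in> A" if "finite_runs y" "is_run y l r" for y l r
    unfolding pt_def using periodic_point_configs run_word_in[OF that(1) is_run_le[OF that(2)]] by blast
  have pt_act: "pt (act ?g ?g y) l r = f (pt y l r)" if "finite_runs y" "is_run y l r" for y l r
    unfolding pt_def run_word_act[OF adm that] next_word_def
    using induced_perm_props(1)[OF f run_word_in[OF that(1) is_run_le[OF that(2)]]] by simp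
  have letter: "letter (act ?g ?g y c) = f (pt y l r) (run_index y l c)"
    if "finite_runs y" "is_run y l r" "l \<le> c" "c \<le> r" for y l r c
    using act_cell(1)[OF adm that] induced_perm_props(1)[OF f run_word_in[OF that(1) is_run_le[OF that(2)]]]
    by (simp add: next_word_def pt_def)
  have tag: "tag (act ?g ?g y c) = tag (y c)" if "finite_runs y" for y c
  proof -
    note run = finite_runsD[OF that, of c]
    have "zero_word (?g (run_word y (lo y c) (hi y c))) = zero_word (run_word y (lo y c) (hi y c))"
      by (rule zero_word_induced_perm[OF f run_word_in[OF that is_run_le[OF run(1)]]])
    then show ?thesis using act_cell(2)[OF adm that run] run by (simp add: next_tag_def active_def)
  qed
  have zeros: "h x a = z" if h: "h \<in> shift_auts0 A z" "block_local A t h" "\<forall>k. x k \<in> A" "\<forall>d. \<bar>d\<bar> \<le> t \<longrightarrow> x (a + d) = z" for h t x a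
  proof -
    have "h x a = h (\<lambda>_. z) a"
      using h(2)[unfolded block_local_def, rule_format, of x "\<lambda>_. z" a a] h(3,4) z_in_A by simp
    then show ?thesis using in_shift_auts0D(2)[OF h(1)] by simp
  qed
  \<comment> \<open>Letters are read at walking distance at most \<open>s\<close> or \<open>s'\<close>, and one step covers at most two cells.\<close>
  let ?\<rho> = "2 * s + 2 * s'"
  have "local_act ?g ?g (2 * ?\<rho> + (2 * s + 2) + 1)"
  proof (rule local_act_by_spread[OF adm])
    fix y l r c
    assume fin: "finite_runs y" and run: "is_run y l r" "l \<le> c" "c \<le> r"
    note lr = is_run_le[OF run(1)]
    let ?a = "run_index y l c"
    {
      assume nz: "nz (y c)"
      show "\<exists>c'. l \<le> c' \<and> c' \<le> r \<and> \<bar>c' - c\<bar> \<le> ?\<rho> \<and> nz (act ?g ?g y c')"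
      proof (cases "tag (y c)")
        case True
        then show ?thesis using run s s' tag[OF fin] by (intro exI[of _ c]) (simp add: nz_def)
      next
        case False
        then have "letter (y c) \<noteq> z" using nz by (simp add: nz_def)
        then have "pt y l r ?a \<noteq> z" using run_place_index[OF run(2,3), of y] by (simp add: pt[OF run(1)])
        then have "f' (f (pt y l r)) ?a \<noteq> z" using inv[OF pt_in[OF fin run(1)]] by simp
        then obtain d where d: "\<bar>d\<bar> \<le> s'" "f (pt y l r) (?a + d) \<noteq> z"
          using zeros[OF f' s'(2), of "f (pt y l r)" ?a] shift_auts0_in[OF f pt_in[OF fin run(1)]] by blast
        let ?c = "run_place y l r (?a + d)"
        have "letter (act ?g ?g y ?c) = pt (act ?g ?g y) l r (?a + d)"
          using pt[of "act ?g ?g y" l r "?a + d"] run(1) run_index_act[OF adm fin run(1)]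
          by (simp add: is_run_act[OF adm fin])
        also have "\<dots> = f (pt y l r) (?a + d)" by (simp add: pt_act[OF fin run(1)])
        finally have "letter (act ?g ?g y ?c) \<noteq> z" using d(2) by simp
        then show ?thesis
          using run_place_near[OF run, of d] run_place_bounds[OF lr, of y] d(1) s(1)
          by (intro exI[of _ ?c]) (simp add: nz_def)
      qed
    next
      assume nz: "nz (act ?g ?g y c)"
      show "\<exists>c'. l \<le> c' \<and> c' \<le> r \<and> \<bar>c' - c\<bar> \<le> ?\<rho> \<and> nz (y c')"
      proof (cases "tag (y c)")
        case True
        then show ?thesis using run s s' by (intro exI[of _ c]) (simp add: nz_def)
      next
        case False
        then have "letter (act ?g ?g y c) \<noteq> z" using nz tag[OF fin] by (simp add: nz_def)
        then have "f (pt y l r) ?a \<noteq> z" by (simp add: letter[OF fin run])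
        then obtain d where d: "\<bar>d\<bar> \<le> s" "pt y l r (?a + d) \<noteq> z"
          using zeros[OF f s(2) pt_in[OF fin run(1)], of ?a] by blast
        then show ?thesis
          using run_place_near[OF run, of d] run_place_bounds[OF lr, of y] s'(1)
          by (intro exI[of _ "run_place y l r (?a + d)"]) (simp add: nz_def pt[OF run(1)])
      qed
    }
  next
    fix y y' :: "int \<Rightarrow> 'a cell" and c
    assume fin: "finite_runs y" "finite_runs y'" and ag: "agree c (2 * s + 2) y y'"
    define l1 r1 l2 r2 where defs: "l1 = lo y c" "r1 = hi y c" "l2 = lo y' c" "r2 = hi y' c"
    note run1 = finite_runsD[OF fin(1), of c, folded defs] and run2 = finite_runsD[OF fin(2), of c, folded defs]
    have "pt y l1 r1 (run_index y l1 c + d) = pt y' l2 r2 (run_index y' l2 c + d)" if "\<bar>d\<bar> \<le> s" for d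
    proof -
      have "run_place y l1 r1 (run_index y l1 c + d) = run_place y' l2 r2 (run_index y' l2 c + d)"
        using that by (intro run_place_agree[OF run1 run2 ag]) simp
      moreover have "y (run_place y l1 r1 (run_index y l1 c + d)) = y' (run_place y l1 r1 (run_index y l1 c + d))"
        using run_place_near[OF run1, of d] that by (intro agreeD[OF ag]) simp
      ultimately show ?thesis by (simp add: pt[OF run1(1)] pt[OF run2(1)])
    qed
    then have "f (pt y l1 r1) (run_index y l1 c) = f (pt y' l2 r2) (run_index y' l2 c)"
      using s(2) pt_in[OF fin(1) run1(1)] pt_in[OF fin(2) run2(1)] unfolding block_local_def by blast
    moreover have "y c = y' c" using s(1) by (intro agreeD[OF ag]) simp
    ultimately show "letter (act ?g ?g y c) = letter (act ?g ?g y' c) \<and> tag (act ?g ?g y c) = tag (act ?g ?g y' c)"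
      by (simp add: letter[OF fin(1) run1] letter[OF fin(2) run2] tag[OF fin(1)] tag[OF fin(2)])
  qed (use s s' in simp_all)
  then show ?thesis by blast
qed

section \<open>Locality of AFO permutations and of permutations of one length\<close>

definition id_words :: "'a list \<Rightarrow> 'a list" where "id_words = (\<lambda>w \<in> all_cyc_words A. w)"

lemma id_words_eq [simp]: "w \<in> all_cyc_words A \<Longrightarrow> id_words w = w"
  by (simp add: id_words_def)

lemma admissible_id_words:
  assumes "\<And>w. w \<in> all_cyc_words A \<Longrightarrow> p w \<in> all_cyc_words A \<and> length (p w) = length w"
  shows "admissible p id_words"
  using assms by (simp add: admissible_def)

lemma act_visible:
  assumes run1: "is_run y1 l r" and run2: "is_run y2 l r" and eq: "\<And>k. l \<le> k \<Longrightarrow> k \<le> r \<Longrightarrow> y1 k = y2 k"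
    and c: "l \<le> c" "c \<le> r"
  shows "act g g' y1 c = act g g' y2 c"
proof -
  have lr: "l \<le> r" using run1 by (rule is_run_le)
  have ends: "y1 l = y2 l" "y1 r = y2 r" using eq lr by auto
  have idx: "run_index y1 l = run_index y2 l" "run_place y1 l r = run_place y2 l r"
    by (simp_all add: run_index_def run_place_def fun_eq_iff ends)
  have word: "run_word y1 l r = run_word y2 l r"
    unfolding run_word_def idx(2) using eq run_place_bounds[OF lr, of y2] by simp
  have "active y1 l r = active y2 l r" unfolding active_def word ends using eq by auto
  then have "next_word g g' y1 l r = next_word g g' y2 l r"
    and "\<And>k. l \<le> k \<Longrightarrow> k \<le> r \<Longrightarrow> next_tag g y1 l r k = next_tag g y2 l r k"
    using eq by (simp_all add: next_word_def next_tag_def word)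
  then show ?thesis
    unfolding act_run[OF run1 c] act_run[OF run2 c]
    using idx(1) ends eq[OF c] c by (simp only:) (intro rewrite_run_cong; simp)
qed

lemma visible_run_eq:
  assumes run1: "is_run y1 l1 r1" "l1 \<le> i" "i \<le> r1" and run2: "is_run y2 l2 r2" "l2 \<le> i" "i \<le> r2"
    and ag: "agree i R y1 y2" and len: "r1 - l1 + 1 < R"
  shows "l2 = l1" "r2 = r1"
proof -
  note w = run_window[OF run1 run2 ag]
  have "l2 \<le> l1" using w(1)[of l1] len run1 by simp
  moreover have "\<not> l2 \<le> l1 - 1" using w(1)[of "l1 - 1"] len run1 by simp
  ultimately show "l2 = l1" by simp
  have "r1 \<le> r2" using w(2)[of r1] len run1 by simp
  moreover have "\<not> r1 + 1 \<le> r2" using w(2)[of "r1 + 1"] len run1 by simp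
  ultimately show "r2 = r1" by simp
qed

text \<open>A run that fits into the window is acted on in the same way in both configurations, whatever the
  permutation is.\<close>

lemma act_visible_window:
  assumes run1: "is_run y1 l1 r1" "l1 \<le> i" "i \<le> r1" and run2: "is_run y2 l2 r2" "l2 \<le> i" "i \<le> r2"
    and ag: "agree i R y1 y2" and len: "r1 - l1 + 1 < R"
  shows "act g g' y1 i = act g g' y2 i"
proof (rule act_visible)
  note eq = visible_run_eq[OF assms]
  show "is_run y1 l1 r1" "l1 \<le> i" "i \<le> r1" using run1 by auto
  show "is_run y2 l1 r1" using run2(1) unfolding eq .
  show "y1 k = y2 k" if "l1 \<le> k" "k \<le> r1" for k
    using that len run1 by (intro agreeD[OF ag]) auto
qed

lemma local_act_local_perm:
  assumes p: "p \<in> local_perms A m"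
  shows "local_act p id_words (int m + 1)"
  unfolding local_act_def
proof (intro conjI allI impI)
  fix y1 y2 i
  assume fin: "finite_runs y1" "finite_runs y2" and ag: "agree i (int m + 1) y1 y2"
  note run1 = finite_runsD[OF fin(1), of i] and run2 = finite_runsD[OF fin(2), of i]
  have same: "act p id_words y i = y i"
    if fin: "finite_runs y" and run: "is_run y l r" "l \<le> i" "i \<le> r" and len: "r - l + 1 \<noteq> int m" for y l r
  proof (rule act_cell_eqI[OF run])
    have "run_word y l r \<in> all_cyc_words A - cyc_words A m"
      using run_word_in[OF fin is_run_le[OF run(1)]] is_run_le[OF run(1)] len by (auto simp: cyc_words_def)
    then show "next_word p id_words y l r = run_word y l r"
      using p by (simp add: next_word_def local_perms_def)
  qed
  show "act p id_words y1 i = act p id_words y2 i"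
  proof (cases "hi y1 i - lo y1 i + 1 = int m \<or> hi y2 i - lo y2 i + 1 = int m")
    case True
    then show ?thesis
      using act_visible_window[OF run1 run2 ag] act_visible_window[OF run2 run1 agree_sym[OF ag]] by force
  next
    case False
    then show ?thesis
      using same[OF fin(1) run1] same[OF fin(2) run2] agreeD[OF ag, of i] by simp
  qed
qed simp

lemma run_place_dist:
  assumes "is_run y l r"
  shows "\<bar>run_place y l r (a + d) - run_place y l r a\<bar> \<le> 2 * \<bar>d\<bar>"
proof -
  have lr: "l \<le> r" using assms by (rule is_run_le)
  let ?c = "run_place y l r a"
  have "(run_index y l ?c + d) mod (r - l + 1) = (a + d) mod (r - l + 1)"
    using run_index_place[OF lr, of y a] by (metis mod_add_left_eq)
  then have "run_place y l r (run_index y l ?c + d) = run_place y l r (a + d)" by (rule run_place_cong)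
  then show ?thesis using run_place_near[OF assms run_place_bounds[OF lr, of y a], of d] by simp
qed

text \<open>If \<open>v\<close> is a cyclic shift of \<open>u\<close> padded by zeros, the nonzero letters of a run with the word \<open>v\<close> are
  found by walking along \<open>u\<close> from the cell where it starts.\<close>

lemma padded_letters:
  assumes lr: "l \<le> r" and len: "int (length u) \<le> r - l + 1"
    and v: "\<And>a. periodic_point v a = periodic_point (zero_pad z (nat (r - l + 1)) u) (a - s)"
    and lv: "length v = nat (r - l + 1)"
  shows "0 \<le> e \<Longrightarrow> e < int (length u) \<Longrightarrow> periodic_point v (run_index y l (run_place y l r (s + e))) = u ! nat e"
    and "l \<le> c \<Longrightarrow> c \<le> r \<Longrightarrow> periodic_point v (run_index y l c) \<noteq> z \<Longrightarrow>
      \<exists>e. 0 \<le> e \<and> e < int (length u) \<and> c = run_place y l r (s + e)"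
proof -
  let ?n = "r - l + 1"
  have lu: "length u \<le> nat ?n" using len by simp
  assume e: "0 \<le> e" "e < int (length u)"
  have "periodic_point v (run_index y l (run_place y l r (s + e))) = periodic_point v (s + e)"
    using run_index_place[OF lr, of y "s + e"] lr by (intro periodic_point_cong) (simp add: lv)
  also have "\<dots> = periodic_point (zero_pad z (nat ?n) u) e" by (simp add: v)
  also have "\<dots> = u ! nat e" using e len by (subst periodic_point_zero_pad[OF lu]) auto
  finally show "periodic_point v (run_index y l (run_place y l r (s + e))) = u ! nat e" .
next
  let ?n = "r - l + 1"
  have lu: "length u \<le> nat ?n" using len by simp
  assume c: "l \<le> c" "c \<le> r" and nz: "periodic_point v (run_index y l c) \<noteq> z"
  define e where "e = (run_index y l c - s) mod ?n"
  have e: "0 \<le> e" "e < ?n"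
    using lr pos_mod_sign[of ?n] pos_mod_bound[of ?n] unfolding e_def by (simp_all del: pos_mod_bound)
  have "length (zero_pad z (nat ?n) u) = nat ?n" using len by (simp add: zero_pad_def)
  then have "periodic_point v (run_index y l c) = periodic_point (zero_pad z (nat ?n) u) e"
    unfolding v e_def using lr by (intro periodic_point_cong) simp
  then have "e < int (length u)"
    using nz e periodic_point_zero_pad[OF lu e(1), of z] lr by (simp split: if_splits)
  moreover have "(s + e) mod ?n = run_index y l c mod ?n"
    unfolding e_def mod_add_right_eq by simp
  then have "run_place y l r (s + e) = c"
    using run_place_cong run_place_index[OF c, of y] by metis
  ultimately show "\<exists>e. 0 \<le> e \<and> e < int (length u) \<and> c = run_place y l r (s + e)"
    using e by blast
qed

end

text \<open>The data of an AFO permutation, which are existentially quantified in \<open>AFO_perms\<close>.\<close>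

locale AFO_permutation = pointed_alphabet +
  fixes n0 :: nat and us :: "'a list list" and \<pi> :: "nat \<Rightarrow> nat" and ns :: "nat \<Rightarrow> int" and p :: "'a list \<Rightarrow> 'a list"
  assumes p_bij: "p \<in> Bij (all_cyc_words A)"
    and us_safe: "safe A z n0 us"
    and \<pi>_perm: "\<pi> permutes {..<length us}"
    and p_short: "\<And>w. w \<in> all_cyc_words A \<Longrightarrow> length w < n0 \<Longrightarrow> p w = w"
    and p_moves: "\<And>n i j. n0 \<le> n \<Longrightarrow> i < length us \<Longrightarrow>
      p (cshift j (zero_pad z n (us ! i))) = cshift (j + ns i) (zero_pad z n (us ! \<pi> i))"
    and p_fixes: "\<And>w. w \<in> all_cyc_words A \<Longrightarrow> n0 \<le> length w \<Longrightarrow>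
      (\<nexists>i j. i < length us \<and> w = cshift j (zero_pad z (length w) (us ! i))) \<Longrightarrow> p w = w"
begin

lemma us_word:
  assumes "i < length us"
  shows "us ! i \<noteq> []" "hd (us ! i) \<noteq> z" "length (us ! i) \<le> n0"
  using us_safe nth_mem[OF assms] unfolding safe_def by blast+

lemma \<pi>_less: "i < length us \<Longrightarrow> \<pi> i < length us"
  using permutes_in_image[OF \<pi>_perm, of i] by simp

lemma length_pad: "i < length us \<Longrightarrow> n0 \<le> n \<Longrightarrow> length (zero_pad z n (us ! i)) = n"
  using us_word(3)[of i] by (simp add: zero_pad_def)

lemma p_in: "w \<in> all_cyc_words A \<Longrightarrow> p w \<in> all_cyc_words A"
  using p_bij by (auto simp: Bij_def bij_betw_def)

lemma length_p: "w \<in> all_cyc_words A \<Longrightarrow> length (p w) = length w"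
proof (cases "n0 \<le> length w \<and> (\<exists>i j. i < length us \<and> w = cshift j (zero_pad z (length w) (us ! i)))")
  case True
  then obtain i j where ij: "i < length us" "w = cshift j (zero_pad z (length w) (us ! i))" by blast
  have "p w = cshift (j + ns i) (zero_pad z (length w) (us ! \<pi> i))"
    using p_moves[of "length w" i j] True ij by simp
  then show ?thesis using length_pad[OF \<pi>_less[OF ij(1)]] True by simp
next
  case False
  assume "w \<in> all_cyc_words A"
  then show ?thesis using False p_short p_fixes by (metis not_le)
qed

lemma admissible_p: "admissible p id_words"
  using p_in length_p by (intro admissible_id_words) simp

text \<open>In terms of walking distance from the cell where \<open>u\<^sub>i\<close> starts, \<open>M\<close> bounds both the cells of \<open>u\<^sub>i\<close> and the
  cells of the shifted \<open>u\<close> that replaces it.  In the run these are at most \<open>2 * M\<close> cells away.\<close>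

definition M :: int where "M = int n0 + (\<Sum>i<length us. \<bar>ns i\<bar>)"

lemma M_bound: "i < length us \<Longrightarrow> int n0 + \<bar>ns i\<bar> \<le> M"
  unfolding M_def using member_le_sum[of i "{..<length us}" "\<lambda>i. \<bar>ns i\<bar>"] by simp

lemma M_ge: "int n0 \<le> M"
  by (simp add: M_def sum_nonneg)

text \<open>The position \<open>b\<close> is where \<open>us ! i\<close> starts in the cyclic word.  As \<open>cshift\<close> moves letters
  to lower positions, this is \<open>cshift (- b)\<close>, and the new word starts at \<open>b - ns i\<close>.\<close>

definition moved :: "(int \<Rightarrow> 'a cell) \<Rightarrow> int \<Rightarrow> int \<Rightarrow> nat \<Rightarrow> int \<Rightarrow> bool" where
  "moved y l r i b \<longleftrightarrow> is_run y l r \<and> active y l r \<and> int n0 \<le> r - l + 1 \<and> i < length us \<and>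
     run_word y l r = cshift (- b) (zero_pad z (nat (r - l + 1)) (us ! i))"

lemma moved_or_fixed:
  assumes fin: "finite_runs y" and run: "is_run y l r" and not_moved: "\<nexists>i b. moved y l r i b"
  shows "next_word p id_words y l r = run_word y l r"
proof -
  have w: "run_word y l r \<in> all_cyc_words A" by (rule run_word_in[OF fin is_run_le[OF run]])
  have "p (run_word y l r) = run_word y l r" if act: "active y l r"
  proof (cases "length (run_word y l r) < n0")
    case True
    then show ?thesis using p_short[OF w] by simp
  next
    case False
    then have len: "int n0 \<le> r - l + 1" using is_run_le[OF run] by simp
    have "\<nexists>i j. i < length us \<and> run_word y l r = cshift j (zero_pad z (length (run_word y l r)) (us ! i))"
    proof (intro notI, elim exE conjE)
      fix i j assume "i < length us" "run_word y l r = cshift j (zero_pad z (length (run_word y l r)) (us ! i))"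
      then have "moved y l r i (- j)" using act run len is_run_le[OF run] by (simp add: moved_def)
      then show False using not_moved by blast
    qed
    then show ?thesis using p_fixes[OF w] False by simp
  qed
  then show ?thesis using w by (simp add: next_word_def)
qed

context
  fixes y l r i b
  assumes fin: "finite_runs y" and moved: "moved y l r i b"
begin

lemma moved_run: "is_run y l r" "l \<le> r" "i < length us" "int n0 \<le> r - l + 1" "active y l r"
  using moved is_run_le by (auto simp: moved_def)

lemma moved_lengths: "int (length (us ! i)) \<le> r - l + 1" "int (length (us ! \<pi> i)) \<le> r - l + 1"
  using us_word(3)[OF moved_run(3)] us_word(3)[OF \<pi>_less[OF moved_run(3)]] moved_run(4) by linarith+

lemma moved_word:
  "periodic_point (run_word y l r) a = periodic_point (zero_pad z (nat (r - l + 1)) (us ! i)) (a - b)"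
proof -
  have "zero_pad z (nat (r - l + 1)) (us ! i) \<noteq> []" using us_word(1)[OF moved_run(3)] by (simp add: zero_pad_def)
  from periodic_point_cshift[OF this, of "- b" a] show ?thesis using moved by (simp add: moved_def)
qed

lemma moved_next_word:
  "periodic_point (next_word p id_words y l r) a = periodic_point (zero_pad z (nat (r - l + 1)) (us ! \<pi> i)) (a - (b - ns i))"
  "length (next_word p id_words y l r) = nat (r - l + 1)"
proof -
  have "p (run_word y l r) = cshift (- b + ns i) (zero_pad z (nat (r - l + 1)) (us ! \<pi> i))"
    using moved p_moves[of "nat (r - l + 1)" i "- b"] moved_run(4) by (simp add: moved_def)
  moreover have "zero_pad z (nat (r - l + 1)) (us ! \<pi> i) \<noteq> []"
    using us_word(1)[OF \<pi>_less[OF moved_run(3)]] by (simp add: zero_pad_def)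
  ultimately show "periodic_point (next_word p id_words y l r) a
      = periodic_point (zero_pad z (nat (r - l + 1)) (us ! \<pi> i)) (a - (b - ns i))"
    using moved_run(5) by (simp add: next_word_def periodic_point_cshift algebra_simps)
  show "length (next_word p id_words y l r) = nat (r - l + 1)"
    by (rule length_next_word(1)[OF admissible_p fin moved_run(2)])
qed

lemma start_letter: "periodic_point (zero_pad z n (us ! i)) 0 = hd (us ! i)"
  and start_letter': "periodic_point (zero_pad z n (us ! \<pi> i)) 0 = hd (us ! \<pi> i)"
  using us_word(1)[OF moved_run(3)] us_word(1)[OF \<pi>_less[OF moved_run(3)]]
  by (simp_all add: periodic_point_def zero_pad_def hd_append hd_conv_nth nth_append)

lemma moved_not_zero: "\<not> zero_word (run_word y l r)" "\<not> zero_word (next_word p id_words y l r)"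
proof -
  have "periodic_point (run_word y l r) b \<noteq> z"
    using moved_word[of b] start_letter us_word(2)[OF moved_run(3)] by simp
  moreover have "run_word y l r \<noteq> []" using moved_run(2) length_run_word[of y l r] by force
  ultimately show "\<not> zero_word (run_word y l r)" using periodic_point_in_set by blast
  have "periodic_point (next_word p id_words y l r) (b - ns i) \<noteq> z"
    using moved_next_word(1)[of "b - ns i"] start_letter' us_word(2)[OF \<pi>_less[OF moved_run(3)]] by simp
  moreover have "next_word p id_words y l r \<noteq> []" using moved_run(2) moved_next_word(2) by force
  ultimately show "\<not> zero_word (next_word p id_words y l r)" using periodic_point_in_set by blast
qed

lemma moved_tags:
  assumes "l \<le> c" "c \<le> r"
  shows "\<not> tag (y c)" "\<not> tag (act p id_words y c)"
proof -
  show "\<not> tag (y c)" using moved_run(5) moved_not_zero(1) assms by (simp add: active_def)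
  have "\<not> zero_word (p (run_word y l r))" using moved_not_zero(2) moved_run(5) by (simp add: next_word_def)
  then show "\<not> tag (act p id_words y c)"
    using act_cell(2)[OF admissible_p fin moved_run(1) assms] moved_run(5) by (simp add: next_tag_def)
qed

lemma moved_old_letters:
  shows "0 \<le> e \<Longrightarrow> e < int (length (us ! i)) \<Longrightarrow> letter (y (run_place y l r (b + e))) = us ! i ! nat e"
    and "l \<le> c \<Longrightarrow> c \<le> r \<Longrightarrow> nz (y c) \<Longrightarrow> \<exists>e. 0 \<le> e \<and> e < int (length (us ! i)) \<and> c = run_place y l r (b + e)"
proof -
  note P = padded_letters[OF moved_run(2) moved_lengths(1) moved_word length_run_word, of _ y]
  assume "0 \<le> e" "e < int (length (us ! i))"
  then show "letter (y (run_place y l r (b + e))) = us ! i ! nat e"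
    using P(1)[of e] letter_eq_periodic_point[OF run_place_bounds[OF moved_run(2), of y "b + e"], of y] by simp
next
  note P = padded_letters[OF moved_run(2) moved_lengths(1) moved_word length_run_word, of _ y]
  assume c: "l \<le> c" "c \<le> r" and "nz (y c)"
  then have "periodic_point (run_word y l r) (run_index y l c) \<noteq> z"
    using letter_eq_periodic_point[OF c, of y] moved_tags(1)[OF c] by (simp add: nz_def)
  then show "\<exists>e. 0 \<le> e \<and> e < int (length (us ! i)) \<and> c = run_place y l r (b + e)"
    by (rule P(2)[OF c])
qed

lemma moved_new_letters:
  shows "0 \<le> e \<Longrightarrow> e < int (length (us ! \<pi> i)) \<Longrightarrow> letter (act p id_words y (run_place y l r (b + (e - ns i)))) = us ! \<pi> i ! nat e"
    and "l \<le> c \<Longrightarrow> c \<le> r \<Longrightarrow> nz (act p id_words y c) \<Longrightarrow>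
      \<exists>e. 0 \<le> e \<and> e < int (length (us ! \<pi> i)) \<and> c = run_place y l r (b + (e - ns i))"
proof -
  note P = padded_letters[OF moved_run(2) moved_lengths(2) moved_next_word, of _ y]
  have shift: "b - ns i + e = b + (e - ns i)" for e by simp
  {
    assume "0 \<le> e" "e < int (length (us ! \<pi> i))"
    then show "letter (act p id_words y (run_place y l r (b + (e - ns i)))) = us ! \<pi> i ! nat e"
      using P(1)[of e, unfolded shift]
        act_cell(1)[OF admissible_p fin moved_run(1) run_place_bounds[OF moved_run(2), of y "b + (e - ns i)"]] by simp
  next
    assume c: "l \<le> c" "c \<le> r" and "nz (act p id_words y c)"
    then have "periodic_point (next_word p id_words y l r) (run_index y l c) \<noteq> z"
      using act_cell(1)[OF admissible_p fin moved_run(1) c] moved_tags(2)[OF c] by (simp add: nz_def)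
    then show "\<exists>e. 0 \<le> e \<and> e < int (length (us ! \<pi> i)) \<and> c = run_place y l r (b + (e - ns i))"
      using P(2)[OF c, unfolded shift] by blast
  }
qed

lemma moved_near:
  assumes "l \<le> c" "c \<le> r"
  shows "nz (y c) \<Longrightarrow> \<bar>c - run_place y l r b\<bar> \<le> 2 * M"
    and "nz (act p id_words y c) \<Longrightarrow> \<bar>c - run_place y l r b\<bar> \<le> 2 * M"
proof -
  assume "nz (y c)"
  then obtain e where e: "0 \<le> e" "e < int (length (us ! i))" "c = run_place y l r (b + e)"
    using moved_old_letters(2)[OF assms] by blast
  then show "\<bar>c - run_place y l r b\<bar> \<le> 2 * M"
    using run_place_dist[OF moved_run(1), of b e] us_word(3)[OF moved_run(3)] M_ge by linarith
next
  assume "nz (act p id_words y c)"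
  then obtain e where e: "0 \<le> e" "e < int (length (us ! \<pi> i))" "c = run_place y l r (b + (e - ns i))"
    using moved_new_letters(2)[OF assms] by blast
  have "\<bar>e - ns i\<bar> \<le> M"
    using e us_word(3)[OF \<pi>_less[OF moved_run(3)]] M_bound[OF moved_run(3)] by linarith
  then show "\<bar>c - run_place y l r b\<bar> \<le> 2 * M"
    unfolding e(3) by (intro order_trans[OF run_place_dist[OF moved_run(1), of b "e - ns i"]]) simp
qed

lemma moved_nz_start: "nz (y (run_place y l r b))" "nz (act p id_words y (run_place y l r (b - ns i)))"
  using moved_old_letters(1)[of 0] moved_new_letters(1)[of 0] us_word[OF moved_run(3)]
    us_word[OF \<pi>_less[OF moved_run(3)]] by (auto simp: nz_def hd_conv_nth)

text \<open>To a cell that is far from both the old and the new nonzero letters, they all lie on the same side, so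
  that its labels do not change either.\<close>

lemma moved_far:
  assumes c: "l \<le> c" "c \<le> r" and far: "2 * M < \<bar>c - run_place y l r b\<bar>"
  shows "act p id_words y c = y c"
proof -
  let ?c0 = "run_place y l r b" and ?c1 = "run_place y l r (b - ns i)"
  have ends: "\<not> lft (y l)" "\<not> rgt (y r)" using moved_run(5) by (simp_all add: active_def)
  have c0: "l \<le> ?c0" "?c0 \<le> r" "l \<le> ?c1" "?c1 \<le> r" using run_place_bounds[OF moved_run(2), of y] by blast+
  have near: "\<bar>k - ?c0\<bar> \<le> 2 * M" if "l \<le> k" "k \<le> r" "nz (y k) \<or> nz (act p id_words y k)" for k
    using that moved_near[OF that(1,2)] by blast
  have c1: "\<bar>?c1 - ?c0\<bar> \<le> 2 * M" by (rule near) (use c0 moved_nz_start in auto)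
  have "\<not> nz (y c)" "\<not> nz (act p id_words y c)" using near[OF c] far by auto
  then have "letter (act p id_words y c) = letter (y c)" "tag (act p id_words y c) = tag (y c)" by (simp_all add: nz_def)
  moreover have "lft (act p id_words y c) = lft (y c)"
  proof -
    have "lft (y c) \<longleftrightarrow> ?c0 < c"
      unfolding run_lft[OF moved_run(1) c] using ends near[of _] far moved_nz_start(1) c0 c
      by (smt (verit))
    moreover have "lft (act p id_words y c) \<longleftrightarrow> ?c0 < c"
      unfolding lft_act(1)[OF admissible_p fin moved_run(1) c] using ends near[of _] far moved_nz_start(2) c0 c1 c
      by (smt (verit))
    ultimately show ?thesis by simp
  qed
  moreover have "rgt (act p id_words y c) = rgt (y c)"
  proof -
    have "rgt (y c) \<longleftrightarrow> c < ?c0"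
      unfolding run_rgt[OF moved_run(1) c] using ends near[of _] far moved_nz_start(1) c0 c
      by (smt (verit))
    moreover have "rgt (act p id_words y c) \<longleftrightarrow> c < ?c0"
      unfolding lft_act(2)[OF admissible_p fin moved_run(1) c] using ends near[of _] far moved_nz_start(2) c0 c1 c
      by (smt (verit))
    ultimately show ?thesis by simp
  qed
  moreover have "backward (act p id_words y c) = backward (y c)"
    by (rule act_cell(3)[OF admissible_p fin moved_run(1) c])
  ultimately show ?thesis by (metis cell.expand)
qed

end
end

context AFO_permutation begin

text \<open>The cell \<open>x\<close> is within \<open>2 * M\<close> of the start of the nonzero part, which in turn is within \<open>2 * M\<close> of all
  old and new nonzero cells.  The window of radius \<open>4 * M + 4\<close> around \<open>x\<close> thus contains these cells,
  and the next ones on either side.\<close>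

context
  fixes y1 l1 r1 y2 l2 r2 i b x
  assumes fin1: "finite_runs y1" and fin2: "finite_runs y2"
    and moved1: "moved y1 l1 r1 i b" and run1: "is_run y1 l1 r1" "l1 \<le> x" "x \<le> r1"
    and run2: "is_run y2 l2 r2" "l2 \<le> x" "x \<le> r2"
    and ag: "agree x (4 * M + 4) y1 y2" and near: "\<bar>x - run_place y1 l1 r1 b\<bar> \<le> 2 * M"
begin

definition start :: int where "start = run_place y1 l1 r1 b"

lemma near_start: "\<bar>x - start\<bar> \<le> 2 * M" using near by (simp add: start_def)

lemma start_run1: "l1 \<le> start" "start \<le> r1"
  unfolding start_def using run_place_bounds[OF is_run_le[OF run1(1)]] by blast+

lemmas window_x = run_window[OF run1 run2 ag]

lemma start_run2: "l2 \<le> start" "start \<le> r2"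
  using window_x[of start] start_run1 near_start M_ge by auto

lemma walk_from_start:
  assumes "\<bar>d\<bar> \<le> M"
  shows "run_place y1 l1 r1 (b + d) = run_place y2 l2 r2 (run_index y2 l2 start + d)"
proof -
  have ag': "agree start (2 * M + 2) y1 y2" using near_start by (intro agree_mono[OF ag]) simp
  have "(b + d) mod (r1 - l1 + 1) = (run_index y1 l1 start + d) mod (r1 - l1 + 1)"
    using run_index_place[OF is_run_le[OF run1(1)], of y1 b] unfolding start_def by (metis mod_add_left_eq)
  then have "run_place y1 l1 r1 (b + d) = run_place y1 l1 r1 (run_index y1 l1 start + d)"
    by (rule run_place_cong)
  also have "\<dots> = run_place y2 l2 r2 (run_index y2 l2 start + d)"
    using assms by (intro run_place_agree[OF run1(1) start_run1 run2(1) start_run2 ag']) simp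
  finally show ?thesis .
qed

text \<open>In the first run there is nothing to the left of the small nonzero part.  The second run shares a cell
  that says so: the cell just outside that part, or else the left end of the run.\<close>

lemma nothing_left: "\<not> lft (y2 l2) \<and> (\<forall>k. l2 \<le> k \<and> k < start - 2 * M - 1 \<longrightarrow> \<not> nz (y2 k))"
proof (cases "l1 \<le> start - 2 * M - 1")
  case True
  let ?m = "start - 2 * M - 1"
  have m: "\<bar>?m - x\<bar> \<le> 4 * M + 4" using near_start M_ge by auto
  have m1: "?m \<le> r1" using start_run1(2) M_ge by linarith
  have m2: "l2 \<le> ?m" "?m \<le> r2" using window_x(1)[of ?m] True m start_run2(2) M_ge by auto
  have "\<not> nz (y1 k)" if "l1 \<le> k" "k < ?m" for k
  proof
    assume "nz (y1 k)"
    then have "\<bar>k - start\<bar> \<le> 2 * M"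
      using moved_near(1)[OF fin1 moved1 that(1)] that(2) m1 by (simp add: start_def)
    then show False using that(2) by linarith
  qed
  moreover have "\<not> lft (y1 l1)" using moved1 by (simp add: moved_def active_def)
  ultimately have "\<not> lft (y1 ?m)" using run_lft[OF run1(1) True m1] by blast
  moreover have "y1 ?m = y2 ?m" by (rule agreeD[OF ag m])
  ultimately show ?thesis using run_lft[OF run2(1) m2] by simp
next
  case False
  then have l1: "\<bar>l1 - x\<bar> \<le> 4 * M + 2" using near_start run1(2) M_ge by auto
  have "l2 \<le> l1" "\<not> l2 \<le> l1 - 1" using window_x(1)[of l1] window_x(1)[of "l1 - 1"] l1 by auto
  then have "l2 = l1" by simp
  moreover have "y1 l1 = y2 l1" using l1 by (intro agreeD[OF ag]) simp
  moreover have "\<not> lft (y1 l1)" using moved1 by (simp add: moved_def active_def)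
  ultimately show ?thesis using False by auto
qed

lemma nothing_right: "\<not> rgt (y2 r2) \<and> (\<forall>k. start + 2 * M + 1 < k \<and> k \<le> r2 \<longrightarrow> \<not> nz (y2 k))"
proof (cases "start + 2 * M + 1 \<le> r1")
  case True
  let ?m = "start + 2 * M + 1"
  have m: "\<bar>?m - x\<bar> \<le> 4 * M + 4" using near_start M_ge by auto
  have m1: "l1 \<le> ?m" using start_run1(1) M_ge by linarith
  have m2: "l2 \<le> ?m" "?m \<le> r2" using window_x(2)[of ?m] True m start_run2(1) M_ge by auto
  have "\<not> nz (y1 k)" if "?m < k" "k \<le> r1" for k
  proof
    assume "nz (y1 k)"
    then have "\<bar>k - start\<bar> \<le> 2 * M"
      using moved_near(1)[OF fin1 moved1 _ that(2)] that(1) m1 by (simp add: start_def)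
    then show False using that(1) by linarith
  qed
  moreover have "\<not> rgt (y1 r1)" using moved1 by (simp add: moved_def active_def)
  ultimately have "\<not> rgt (y1 ?m)" using run_rgt[OF run1(1) m1 True] by blast
  moreover have "y1 ?m = y2 ?m" by (rule agreeD[OF ag m])
  ultimately show ?thesis using run_rgt[OF run2(1) m2] by simp
next
  case False
  then have r1: "\<bar>r1 - x\<bar> \<le> 4 * M + 2" using near_start run1(3) M_ge by auto
  have "r1 \<le> r2" "\<not> r1 + 1 \<le> r2" using window_x(2)[of r1] window_x(2)[of "r1 + 1"] r1 by auto
  then have "r2 = r1" by simp
  moreover have "y1 r1 = y2 r1" using r1 by (intro agreeD[OF ag]) simp
  moreover have "\<not> rgt (y1 r1)" using moved1 by (simp add: moved_def active_def)
  ultimately show ?thesis using False by auto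
qed

lemma nz_transfer:
  assumes "l2 \<le> k" "k \<le> r2" "nz (y2 k)"
  shows "y1 k = y2 k" "l1 \<le> k" "k \<le> r1"
proof -
  have "\<not> k < start - 2 * M - 1" "\<not> start + 2 * M + 1 < k"
    using nothing_left nothing_right assms by blast+
  then have k: "\<bar>k - x\<bar> \<le> 4 * M + 2" using near_start by linarith
  then show "y1 k = y2 k" by (intro agreeD[OF ag]) simp
  show "l1 \<le> k" "k \<le> r1" using window_x[of k] assms(1,2) k by auto
qed

lemma long_run2: "int n0 \<le> r2 - l2 + 1"
proof (rule ccontr)
  assume short: "\<not> int n0 \<le> r2 - l2 + 1"
  then have "l1 = l2" "r1 = r2"
    using M_ge by (intro visible_run_eq[OF run2 run1 agree_sym[OF ag]]; linarith)+
  then show False using short moved1 by (simp add: moved_def)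
qed

text \<open>All nonzero cells of the second run lie in the window, and they are those of the first run.
  Walking from the common start, one reads the same padded word in a circle of possibly different length.\<close>

lemma moved2: "moved y2 l2 r2 i (run_index y2 l2 start)"
proof -
  let ?b = "run_index y2 l2 start" and ?n = "r2 - l2 + 1" and ?u = "us ! i"
  have lr: "l2 \<le> r2" using run2(1) by (rule is_run_le)
  have i: "i < length us" using moved1 by (simp add: moved_def)
  have len: "length ?u \<le> nat ?n" using us_word(3)[OF i] long_run2 by linarith
  have pad: "length (zero_pad z (nat ?n) ?u) = nat ?n" using len by (simp add: zero_pad_def)
  have untagged: "\<not> tag (y2 k)" if "l2 \<le> k" "k \<le> r2" for k
    using nz_transfer[OF that] moved_tags(1)[OF fin1 moved1, of k] by (auto simp: nz_def)
  have word: "run_word y2 l2 r2 = cshift (- ?b) (zero_pad z (nat ?n) ?u)"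
  proof (rule periodic_point_inject)
    show "length (run_word y2 l2 r2) = length (cshift (- ?b) (zero_pad z (nat ?n) ?u))" by (simp add: pad)
    have ne: "zero_pad z (nat ?n) ?u \<noteq> []" using us_word(1)[OF i] by (simp add: zero_pad_def)
    show "periodic_point (run_word y2 l2 r2) = periodic_point (cshift (- ?b) (zero_pad z (nat ?n) ?u))"
    proof
      fix a
      define d where "d = (a - ?b) mod ?n"
      have d: "0 \<le> d" "d < ?n" 
        using lr pos_mod_sign[of ?n] pos_mod_bound[of ?n] unfolding d_def by (simp_all del: pos_mod_bound)
      have cong: "(?b + d) mod ?n = a mod ?n" unfolding d_def mod_add_right_eq by simp
      let ?k = "run_place y2 l2 r2 (?b + d)"
      have k: "l2 \<le> ?k" "?k \<le> r2" by (rule run_place_bounds[OF lr])+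
      have old: "periodic_point (run_word y2 l2 r2) a = letter (y2 ?k)"
        unfolding periodic_point_run_word[OF lr] run_place_cong[OF cong] ..
      have "periodic_point (cshift (- ?b) (zero_pad z (nat ?n) ?u)) a = periodic_point (zero_pad z (nat ?n) ?u) d"
        unfolding periodic_point_cshift[OF ne] d_def using lr by (intro periodic_point_cong) (simp add: pad)
      also have "\<dots> = (if d < int (length ?u) then ?u ! nat d else z)"
        using d lr by (intro periodic_point_zero_pad[OF len]) auto
      also have "\<dots> = letter (y2 ?k)"
      proof (cases "d < int (length ?u)")
        case True
        have "\<bar>d\<bar> \<le> M" using True d us_word(3)[OF i] M_ge by linarith
        then have place: "run_place y1 l1 r1 (b + d) = ?k" by (rule walk_from_start)
        have "\<bar>?k - start\<bar> \<le> 2 * M"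
          using run_place_dist[OF run1(1), of b d] \<open>\<bar>d\<bar> \<le> M\<close> unfolding place start_def by linarith
        then have "y1 ?k = y2 ?k" using near_start M_ge by (intro agreeD[OF ag]) linarith
        then show ?thesis
          using moved_old_letters(1)[OF fin1 moved1 d(1) True] True unfolding place by simp
      next
        case False
        have "\<not> nz (y2 ?k)"
        proof
          assume nz: "nz (y2 ?k)"
          then obtain e where e: "0 \<le> e" "e < int (length ?u)" "?k = run_place y1 l1 r1 (b + e)"
            using nz_transfer[OF k nz] moved_old_letters(2)[OF fin1 moved1, of ?k] by auto
          have "\<bar>e\<bar> \<le> M" using e us_word(3)[OF i] M_ge by linarith
          then have "?k = run_place y2 l2 r2 (?b + e)" using e(3) walk_from_start by simp
          then have "(?b + d) mod ?n = (?b + e) mod ?n" unfolding run_place_eq_iff[OF lr] .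
          then have "(?b + d - ?b) mod ?n = (?b + e - ?b) mod ?n" by (rule mod_diff_cong) simp
          then have "d mod ?n = e mod ?n" by simp
          moreover have "e < ?n" using e(2) len lr by linarith
          ultimately have "d = e" using d e(1) by simp
          then show False using e(2) False by simp
        qed
        then show ?thesis using False by (simp add: nz_def)
      qed
      finally show "periodic_point (run_word y2 l2 r2) a = periodic_point (cshift (- ?b) (zero_pad z (nat ?n) ?u)) a"
        unfolding old ..
    qed
  qed
  have "run_place y2 l2 r2 ?b = start" by (rule run_place_index[OF start_run2])
  moreover have "run_place y1 l1 r1 b = run_place y2 l2 r2 ?b" using walk_from_start[of 0] M_ge by simp
  ultimately have start: "start = run_place y1 l1 r1 b" by simp
  have "letter (y1 start) \<noteq> z"
    using moved_nz_start(1)[OF fin1 moved1] moved_tags(1)[OF fin1 moved1 start_run1] unfolding start nz_def by simp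
  moreover have "y1 start = y2 start" using near_start M_ge by (intro agreeD[OF ag]) linarith
  ultimately have "periodic_point (run_word y2 l2 r2) ?b \<noteq> z"
    using letter_eq_periodic_point[OF start_run2, of y2] by simp
  moreover have "run_word y2 l2 r2 \<noteq> []" using length_run_word[of y2 l2 r2] lr by force
  ultimately have "\<not> zero_word (run_word y2 l2 r2)" using periodic_point_in_set by blast
  then have "active y2 l2 r2"
    using untagged nothing_left nothing_right by (simp add: active_def)
  then show ?thesis using run2(1) long_run2 i word by (simp add: moved_def)
qed

lemma place_transfer:
  assumes "0 \<le> e" "e < int (length (us ! \<pi> i))"
  shows "run_place y1 l1 r1 (b + (e - ns i)) = run_place y2 l2 r2 (run_index y2 l2 start + (e - ns i))"
proof (rule walk_from_start)
  have i: "i < length us" using moved1 by (simp add: moved_def)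
  show "\<bar>e - ns i\<bar> \<le> M" using assms us_word(3)[OF \<pi>_less[OF i]] M_bound[OF i] by linarith
qed

lemma new_letter_transfer:
  shows "l1 \<le> k \<Longrightarrow> k \<le> r1 \<Longrightarrow> nz (act p id_words y1 k) \<Longrightarrow>
      l2 \<le> k \<and> k \<le> r2 \<and> letter (act p id_words y2 k) = letter (act p id_words y1 k)"
    and "l2 \<le> k \<Longrightarrow> k \<le> r2 \<Longrightarrow> nz (act p id_words y2 k) \<Longrightarrow>
      l1 \<le> k \<and> k \<le> r1 \<and> letter (act p id_words y2 k) = letter (act p id_words y1 k)"
proof -
  have both: "l1 \<le> k \<and> k \<le> r1 \<and> l2 \<le> k \<and> k \<le> r2 \<and> letter (act p id_words y2 k) = letter (act p id_words y1 k)"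
    if e: "0 \<le> e" "e < int (length (us ! \<pi> i))" and k: "k = run_place y1 l1 r1 (b + (e - ns i))" for e
  proof (intro conjI)
    have k2: "k = run_place y2 l2 r2 (run_index y2 l2 start + (e - ns i))"
      unfolding k by (rule place_transfer[OF e])
    show "l1 \<le> k" "k \<le> r1" unfolding k by (rule run_place_bounds[OF is_run_le[OF run1(1)]])+
    show "l2 \<le> k" "k \<le> r2" unfolding k2 by (rule run_place_bounds[OF is_run_le[OF run2(1)]])+
    have "letter (act p id_words y1 k) = us ! \<pi> i ! nat e"
      unfolding k by (rule moved_new_letters(1)[OF fin1 moved1 e])
    moreover have "letter (act p id_words y2 k) = us ! \<pi> i ! nat e"
      unfolding k2 by (rule moved_new_letters(1)[OF fin2 moved2 e])
    ultimately show "letter (act p id_words y2 k) = letter (act p id_words y1 k)" by simp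
  qed
  {
    assume "l1 \<le> k" "k \<le> r1" "nz (act p id_words y1 k)"
    from moved_new_letters(2)[OF fin1 moved1 this]
    obtain e where "0 \<le> e" "e < int (length (us ! \<pi> i))" "k = run_place y1 l1 r1 (b + (e - ns i))"
      by (elim exE conjE)
    then show "l2 \<le> k \<and> k \<le> r2 \<and> letter (act p id_words y2 k) = letter (act p id_words y1 k)"
      using both by blast
  next
    assume "l2 \<le> k" "k \<le> r2" "nz (act p id_words y2 k)"
    from moved_new_letters(2)[OF fin2 moved2 this]
    obtain e where e: "0 \<le> e" "e < int (length (us ! \<pi> i))"
        "k = run_place y2 l2 r2 (run_index y2 l2 start + (e - ns i))"
      by (elim exE conjE)
    have "k = run_place y1 l1 r1 (b + (e - ns i))" unfolding e(3) by (rule place_transfer[OF e(1,2), symmetric])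
    then show "l1 \<le> k \<and> k \<le> r1 \<and> letter (act p id_words y2 k) = letter (act p id_words y1 k)"
      using both[OF e(1,2)] by blast
  }
qed

lemma new_nz_iff:
  "l1 \<le> k \<and> k \<le> r1 \<and> nz (act p id_words y1 k) \<longleftrightarrow> l2 \<le> k \<and> k \<le> r2 \<and> nz (act p id_words y2 k)"
proof
  assume a: "l1 \<le> k \<and> k \<le> r1 \<and> nz (act p id_words y1 k)"
  then have "letter (act p id_words y1 k) \<noteq> z" using moved_tags(2)[OF fin1 moved1, of k] by (simp add: nz_def)
  moreover have "l2 \<le> k \<and> k \<le> r2 \<and> letter (act p id_words y2 k) = letter (act p id_words y1 k)"
    using a by (intro new_letter_transfer(1)) simp_all
  ultimately show "l2 \<le> k \<and> k \<le> r2 \<and> nz (act p id_words y2 k)" by (simp add: nz_def)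
next
  assume a: "l2 \<le> k \<and> k \<le> r2 \<and> nz (act p id_words y2 k)"
  then have "letter (act p id_words y2 k) \<noteq> z" using moved_tags(2)[OF fin2 moved2, of k] by (simp add: nz_def)
  moreover have "l1 \<le> k \<and> k \<le> r1 \<and> letter (act p id_words y2 k) = letter (act p id_words y1 k)"
    using a by (intro new_letter_transfer(2)) simp_all
  ultimately show "l1 \<le> k \<and> k \<le> r1 \<and> nz (act p id_words y1 k)" by (simp add: nz_def)
qed

text \<open>In both configurations the new letters are found by the same walk from the same cell.\<close>

lemma act_near: "act p id_words y1 x = act p id_words y2 x"
proof -
  have ends: "\<not> lft (y1 l1)" "\<not> rgt (y1 r1)" using moved1 by (simp_all add: moved_def active_def)
  have tags: "\<not> tag (act p id_words y1 x)" "\<not> tag (act p id_words y2 x)"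
    using moved_tags(2)[OF fin1 moved1 run1(2,3)] moved_tags(2)[OF fin2 moved2 run2(2,3)] by simp_all
  moreover have "letter (act p id_words y1 x) = letter (act p id_words y2 x)"
  proof (cases "nz (act p id_words y1 x)")
    case True
    then show ?thesis using new_letter_transfer(1)[OF run1(2,3)] by simp
  next
    case False
    then have "\<not> nz (act p id_words y2 x)" using new_nz_iff[of x] run1 run2 by blast
    then show ?thesis using False by (simp add: nz_def)
  qed
  moreover have "lft (act p id_words y1 x) = lft (act p id_words y2 x)"
  proof -
    have "(l1 \<le> k \<and> k < x \<and> nz (act p id_words y1 k)) = (l2 \<le> k \<and> k < x \<and> nz (act p id_words y2 k))" for k
      using new_nz_iff[of k] run1(3) run2(3) by auto
    then show ?thesis
      unfolding lft_act(1)[OF admissible_p fin1 run1] lft_act(1)[OF admissible_p fin2 run2]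
      using ends nothing_left by simp
  qed
  moreover have "rgt (act p id_words y1 x) = rgt (act p id_words y2 x)"
  proof -
    have "(x < k \<and> k \<le> r1 \<and> nz (act p id_words y1 k)) = (x < k \<and> k \<le> r2 \<and> nz (act p id_words y2 k))" for k
      using new_nz_iff[of k] run1(2) run2(2) by auto
    then show ?thesis
      unfolding lft_act(2)[OF admissible_p fin1 run1] lft_act(2)[OF admissible_p fin2 run2]
      using ends nothing_right by simp
  qed
  moreover have "backward (act p id_words y1 x) = backward (act p id_words y2 x)"
    unfolding act_cell(3)[OF admissible_p fin1 run1] act_cell(3)[OF admissible_p fin2 run2]
    using agreeD[OF ag, of x] M_ge by simp
  ultimately show ?thesis by (intro cell.expand conjI) simp_all
qed

end

lemma local_act_AFO: "local_act p id_words (4 * M + 4)"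
  unfolding local_act_def
proof (intro conjI allI impI)
  fix y1 y2 x
  assume fin: "finite_runs y1" "finite_runs y2" and ag: "agree x (4 * M + 4) y1 y2"
  note run1 = finite_runsD[OF fin(1), of x] and run2 = finite_runsD[OF fin(2), of x]
  have cases: "act p id_words y x = y x \<or> (\<exists>i b. moved y (lo y x) (hi y x) i b \<and>
      \<bar>x - run_place y (lo y x) (hi y x) b\<bar> \<le> 2 * M)" if fin: "finite_runs y" for y
  proof (cases "\<exists>i b. moved y (lo y x) (hi y x) i b")
    case True
    then obtain i b where m: "moved y (lo y x) (hi y x) i b" by blast
    show ?thesis
    proof (cases "\<bar>x - run_place y (lo y x) (hi y x) b\<bar> \<le> 2 * M")
      case True
      then show ?thesis using m by blast
    next
      case False
      then show ?thesis using moved_far[OF fin m finite_runsD(2,3)[OF fin, of x]] by simp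
    qed
  next
    case False
    then show ?thesis
      using act_cell_eqI[OF finite_runsD[OF fin, of x] moved_or_fixed[OF fin finite_runsD(1)[OF fin]]] by blast
  qed
  have same: "y1 x = y2 x" using agreeD[OF ag, of x] M_ge by simp
  from cases[OF fin(1)] show "act p id_words y1 x = act p id_words y2 x"
  proof (elim disjE exE conjE)
    fix i b assume "moved y1 (lo y1 x) (hi y1 x) i b" "\<bar>x - run_place y1 (lo y1 x) (hi y1 x) b\<bar> \<le> 2 * M"
    then show ?thesis by (intro act_near[OF fin _ run1 run2 ag])
  next
    assume fixed1: "act p id_words y1 x = y1 x"
    from cases[OF fin(2)] show ?thesis
    proof (elim disjE exE conjE)
      fix i b assume "moved y2 (lo y2 x) (hi y2 x) i b" "\<bar>x - run_place y2 (lo y2 x) (hi y2 x) b\<bar> \<le> 2 * M"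
      then show ?thesis by (intro act_near[OF fin(2,1) _ run2 run1 agree_sym[OF ag], symmetric])
    next
      assume "act p id_words y2 x = y2 x"
      then show ?thesis using fixed1 same by simp
    qed
  qed
qed (use M_ge in simp)

end

section \<open>The asymptotic part of a permutation\<close>

context pointed_alphabet begin

text \<open>\<open>g'\<close> describes what \<open>g\<close> does to sufficiently long repetitions of a word; words with the same periodic
  point are repetitions of a common word.\<close>

definition shadow :: "('a list \<Rightarrow> 'a list) \<Rightarrow> ('a list \<Rightarrow> 'a list) \<Rightarrow> bool" where
  "shadow g g' \<longleftrightarrow> (\<forall>w \<in> all_cyc_words A. \<exists>K. \<forall>v \<in> all_cyc_words A.
     K \<le> length v \<longrightarrow> periodic_point v = periodic_point w \<longrightarrow> periodic_point (g v) = periodic_point (g' w))"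

definition good :: "('a list \<Rightarrow> 'a list) \<Rightarrow> ('a list \<Rightarrow> 'a list) \<Rightarrow> bool" where
  "good g g' \<longleftrightarrow> g \<in> Bij (all_cyc_words A) \<and> g' \<in> extensional (all_cyc_words A) \<and>
     admissible g g' \<and> shadow g g' \<and> (\<exists>R. local_act g g' R)"

lemma admissibleD:
  assumes "admissible g g'" "w \<in> all_cyc_words A"
  shows "g w \<in> all_cyc_words A" "length (g w) = length w" "g' w \<in> all_cyc_words A" "length (g' w) = length w"
    "zero_word (g' w) = zero_word w"
  using assms by (auto simp: admissible_def)

lemma long_repetition:
  assumes w: "w \<in> all_cyc_words A"
  shows "\<exists>v \<in> all_cyc_words A. K \<le> length v \<and> periodic_point v = periodic_point w"
proof -
  let ?m = "length w"
  let ?n = "Suc K * ?m"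
  have m: "0 < ?m" using w by (simp add: all_cyc_words_iff)
  let ?v = "map (\<lambda>i. periodic_point w (int i)) [0..<?n]"
  have n: "0 < ?n" using m by simp
  have "periodic_point ?v a = periodic_point w a" for a
  proof -
    have "periodic_point ?v a = periodic_point w (a mod int ?n)" by (rule periodic_point_map[OF n])
    also have "\<dots> = periodic_point w a"
      by (rule periodic_point_cong) (simp only: of_nat_mult mod_mod_cancel dvd_triv_right)
    finally show ?thesis .
  qed
  then have "periodic_point ?v = periodic_point w" by blast
  moreover have "?v \<in> all_cyc_words A"
    using n periodic_point_configs[OF w] unfolding all_cyc_words_iff by auto
  moreover have "K * 1 \<le> Suc K * ?m" using m by (intro mult_le_mono) (simp_all only: Suc_le_eq One_nat_def le_SucI order_refl)
  then have "K \<le> length ?v" by simp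
  ultimately show ?thesis by blast
qed

text \<open>Every word has arbitrarily long repetitions, and a word is determined by its periodic point and length.\<close>

lemma good_unique:
  assumes "good g g'" "good g g''"
  shows "g' = g''"
proof (rule extensionalityI)
  fix w assume w: "w \<in> all_cyc_words A"
  obtain K1 where K1: "\<forall>v \<in> all_cyc_words A. K1 \<le> length v \<longrightarrow> periodic_point v = periodic_point w
      \<longrightarrow> periodic_point (g v) = periodic_point (g' w)"
    using assms(1) w unfolding good_def shadow_def by meson
  obtain K2 where K2: "\<forall>v \<in> all_cyc_words A. K2 \<le> length v \<longrightarrow> periodic_point v = periodic_point w
      \<longrightarrow> periodic_point (g v) = periodic_point (g'' w)"
    using assms(2) w unfolding good_def shadow_def by meson
  obtain v where "v \<in> all_cyc_words A" "max K1 K2 \<le> length v" "periodic_point v = periodic_point w"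
    using long_repetition[OF w] by blast
  then have "periodic_point (g' w) = periodic_point (g'' w)" using K1 K2 by fastforce
  moreover have "length (g' w) = length (g'' w)"
    using assms admissibleD(4)[OF _ w] by (auto simp: good_def)
  ultimately show "g' w = g'' w" by (intro periodic_point_inject)
qed (use assms in \<open>auto simp: good_def\<close>)

lemma local_act_compose:
  assumes adm1: "admissible g1 g1'" and adm2: "admissible g2 g2'"
    and loc1: "local_act g1 g1' R1" and loc2: "local_act g2 g2' R2"
    and g3: "\<And>w. w \<in> all_cyc_words A \<Longrightarrow> g3 w = g1 (g2 w)"
    and g3': "\<And>w. w \<in> all_cyc_words A \<Longrightarrow> g3' w = g1' (g2' w)"
  shows "local_act g3 g3' (R1 + R2)"
  unfolding local_act_def
proof (intro conjI allI impI)
  show "0 \<le> R1 + R2" using loc1 loc2 by (simp add: local_act_def)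
  fix y y' i
  assume fin: "finite_runs y" "finite_runs y'" and ag: "agree i (R1 + R2) y y'"
  have "agree i R1 (act g2 g2' y) (act g2 g2' y')"
    unfolding agree_def
  proof (intro allI impI)
    fix k assume "\<bar>k - i\<bar> \<le> R1"
    then have "agree k R2 y y'" by (intro agree_mono[OF ag]) linarith
    then show "act g2 g2' y k = act g2 g2' y' k" using loc2 fin by (simp add: local_act_def)
  qed
  then have "act g1 g1' (act g2 g2' y) i = act g1 g1' (act g2 g2' y') i"
    using loc1 finite_runs_act[OF adm2 fin(1)] finite_runs_act[OF adm2 fin(2)] by (simp add: local_act_def)
  then show "act g3 g3' y i = act g3 g3' y' i"
    using act_compose[OF adm1 adm2 fin(1), of g3 g3'] act_compose[OF adm1 adm2 fin(2), of g3 g3'] g3 g3' by simp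
qed

lemma good_compose:
  assumes good1: "good g1 g1'" and good2: "good g2 g2'"
  shows "good (compose (all_cyc_words A) g1 g2) (compose (all_cyc_words A) g1' g2')"
proof -
  let ?X = "all_cyc_words A"
  have adm: "admissible g1 g1'" "admissible g2 g2'" and sh: "shadow g1 g1'" "shadow g2 g2'"
    and bij: "g1 \<in> Bij ?X" "g2 \<in> Bij ?X"
    using assms by (auto simp: good_def)
  have eq: "compose ?X f h w = f (h w)" if "w \<in> ?X" for f h w using that by (simp add: compose_def)
  have "admissible (compose ?X g1 g2) (compose ?X g1' g2')"
    using admissibleD[OF adm(1)] admissibleD[OF adm(2)] by (simp add: admissible_def eq)
  moreover have "shadow (compose ?X g1 g2) (compose ?X g1' g2')"
    unfolding shadow_def
  proof
    fix w assume w: "w \<in> ?X"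
    obtain K2 where K2: "\<forall>v \<in> ?X. K2 \<le> length v \<longrightarrow> periodic_point v = periodic_point w
        \<longrightarrow> periodic_point (g2 v) = periodic_point (g2' w)"
      using sh(2) w unfolding shadow_def by meson
    obtain K1 where K1: "\<forall>v \<in> ?X. K1 \<le> length v \<longrightarrow> periodic_point v = periodic_point (g2' w)
        \<longrightarrow> periodic_point (g1 v) = periodic_point (g1' (g2' w))"
      using sh(1) admissibleD(3)[OF adm(2) w] unfolding shadow_def by meson
    show "\<exists>K. \<forall>v \<in> ?X. K \<le> length v \<longrightarrow> periodic_point v = periodic_point w \<longrightarrow>
        periodic_point (compose ?X g1 g2 v) = periodic_point (compose ?X g1' g2' w)"
    proof (intro exI[of _ "max K1 K2"] ballI impI)
      fix v assume v: "v \<in> ?X" "max K1 K2 \<le> length v" "periodic_point v = periodic_point w"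
      have "periodic_point (g2 v) = periodic_point (g2' w)" using K2 v by simp
      then have "periodic_point (g1 (g2 v)) = periodic_point (g1' (g2' w))"
        using K1 v admissibleD(1,2)[OF adm(2) v(1)] by simp
      then show "periodic_point (compose ?X g1 g2 v) = periodic_point (compose ?X g1' g2' w)"
        using v w by (simp add: eq)
    qed
  qed
  moreover have "\<exists>R. local_act (compose ?X g1 g2) (compose ?X g1' g2') R"
    using local_act_compose[OF adm, of _ _ "compose ?X g1 g2" "compose ?X g1' g2'"] assms eq
    unfolding good_def by blast
  ultimately show ?thesis
    using compose_Bij[OF bij] by (simp add: good_def)
qed

lemma good_induced_perm:
  assumes f: "f \<in> shift_auts0 A z"
  shows "good (induced_perm A f) (induced_perm A f)"
    and "\<exists>f' \<in> shift_auts0 A z. restrict (inv_into (all_cyc_words A) (induced_perm A f)) (all_cyc_words A) = induced_perm A f'"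
proof -
  let ?X = "all_cyc_words A"
  obtain f' where f': "f' \<in> shift_auts0 A z"
    and inv: "\<forall>x. (\<forall>i. x i \<in> A) \<longrightarrow> f' (f x) = x \<and> f (f' x) = x"
    using shift_auts0_inverse[OF f] by (elim bexE)
  have cancel: "induced_perm A h' (induced_perm A h w) = w"
    if h: "h \<in> shift_auts0 A z" "h' \<in> shift_auts0 A z" and hh: "\<forall>x. (\<forall>i. x i \<in> A) \<longrightarrow> h' (h x) = x" and w: "w \<in> ?X" for h h' w
  proof (rule periodic_point_inject)
    note p = induced_perm_props[OF h(1) w] and p' = induced_perm_props[OF h(2)]
    show "length (induced_perm A h' (induced_perm A h w)) = length w" using p p'(2) by simp
    show "periodic_point (induced_perm A h' (induced_perm A h w)) = periodic_point w"
      using p'(1)[OF p(3)] p(1) hh periodic_point_configs[OF w] by simp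
  qed
  have c1: "induced_perm A f' (induced_perm A f w) = w" if "w \<in> ?X" for w
    using cancel[OF f f' _ that] inv by simp
  have c2: "induced_perm A f (induced_perm A f' w) = w" if "w \<in> ?X" for w
    using cancel[OF f' f _ that] inv by simp
  have bij: "bij_betw (induced_perm A f) ?X ?X"
    by (rule bij_betw_byWitness[where f' = "induced_perm A f'"])
      (use c1 c2 induced_perm_props(3)[OF f] induced_perm_props(3)[OF f'] in auto)
  have ext: "induced_perm A h \<in> extensional ?X" for h by (simp add: induced_perm_def)
  have "shadow (induced_perm A f) (induced_perm A f)"
    unfolding shadow_def using induced_perm_props(1)[OF f] by auto
  then show "good (induced_perm A f) (induced_perm A f)"
    using bij ext admissible_induced_perm[OF f] local_act_induced_perm[OF f] by (simp add: good_def Bij_def)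
  have "restrict (inv_into ?X (induced_perm A f)) ?X = induced_perm A f'"
  proof (rule extensionalityI)
    fix w assume w: "w \<in> ?X"
    have "inv_into ?X (induced_perm A f) w = induced_perm A f' w"
      using bij c2[OF w] induced_perm_props(3)[OF f' w] by (intro inv_into_f_eq) (auto simp: bij_betw_def)
    then show "restrict (inv_into ?X (induced_perm A f)) ?X w = induced_perm A f' w" using w by simp
  qed (auto simp: ext)
  then show "\<exists>f' \<in> shift_auts0 A z. restrict (inv_into ?X (induced_perm A f)) ?X = induced_perm A f'"
    using f' by blast
qed

lemma id_words_ext: "id_words \<in> extensional (all_cyc_words A)"
  by (simp add: id_words_def)

lemma local_perms_length:
  assumes p: "p \<in> local_perms A m" and w: "w \<in> all_cyc_words A"
  shows "length (p w) = length w"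
proof (cases "w \<in> cyc_words A m")
  case True
  then have "p w \<in> cyc_words A m" using p by (auto simp: local_perms_def)
  then show ?thesis using True by (simp add: cyc_words_def)
next
  case False
  then show ?thesis using p w by (simp add: local_perms_def)
qed

lemma good_local_perm:
  assumes p: "p \<in> local_perms A m" and "1 \<le> m"
  shows "good p id_words" and "restrict (inv_into (all_cyc_words A) p) (all_cyc_words A) \<in> local_perms A m"
proof -
  let ?X = "all_cyc_words A"
  let ?q = "restrict (inv_into ?X p) ?X"
  have bij: "p \<in> Bij ?X" and fix_p: "\<And>w. w \<in> ?X - cyc_words A m \<Longrightarrow> p w = w"
    using p by (auto simp: local_perms_def)
  have inX: "p w \<in> ?X" if "w \<in> ?X" for w using bij that by (auto simp: Bij_def bij_betw_def)
  note len = local_perms_length[OF p]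
  have "shadow p id_words"
    unfolding shadow_def
  proof (intro ballI exI[of _ "Suc m"] impI)
    fix w v assume "w \<in> ?X" "v \<in> ?X" "Suc m \<le> length v" "periodic_point v = periodic_point w"
    then show "periodic_point (p v) = periodic_point (id_words w)" using fix_p[of v] by (simp add: cyc_words_def)
  qed
  then show "good p id_words"
    using bij id_words_ext admissible_id_words[of p] inX len local_act_local_perm[OF p] by (auto simp: good_def)
  have q_bij: "?q \<in> Bij ?X" by (rule restrict_inv_into_Bij[OF bij])
  have inj: "inj_on p ?X" and surj: "p ` ?X = ?X" using bij by (auto simp: Bij_def bij_betw_def)
  have "?q w = w" if "w \<in> ?X - cyc_words A m" for w
    using that fix_p[OF that] inv_into_f_f[OF inj, of w] by simp
  moreover have "?q w \<in> cyc_words A m" if "w \<in> cyc_words A m" for w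
  proof -
    have w: "w \<in> ?X" using that \<open>1 \<le> m\<close> by (auto simp: cyc_words_def all_cyc_words_iff)
    have "inv_into ?X p w \<in> ?X" "p (inv_into ?X p w) = w"
      using w surj by (auto intro: inv_into_into f_inv_into_f)
    then have "inv_into ?X p w \<in> cyc_words A m"
      using len[of "inv_into ?X p w"] that by (auto simp: cyc_words_def all_cyc_words_iff)
    then show ?thesis using w by simp
  qed
  ultimately show "?q \<in> local_perms A m" using q_bij unfolding local_perms_def by blast
qed

end

context AFO_permutation begin

text \<open>A long word with a short period is not of the form \<open>\<sigma>\<^sup>j(u 0 \<dots> 0)\<close>: the zeros would fill a whole period, but \<open>u\<close>
  starts with a nonzero letter.\<close>

lemma shadow_AFO: "shadow p id_words"
  unfolding shadow_def
proof
  let ?X = "all_cyc_words A"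
  fix w assume w: "w \<in> ?X"
  let ?m = "length w"
  have m: "0 < ?m" using w by (simp add: all_cyc_words_iff)
  show "\<exists>K. \<forall>v \<in> ?X. K \<le> length v \<longrightarrow> periodic_point v = periodic_point w \<longrightarrow>
      periodic_point (p v) = periodic_point (id_words w)"
  \<comment> \<open>In a word of length at least \<open>n0 + ?m\<close> the zeros that follow \<open>u\<close> fill a period of \<open>w\<close>.\<close>
  proof (intro exI[of _ "n0 + ?m"] ballI impI)
    fix v assume v: "v \<in> ?X" "n0 + ?m \<le> length v" "periodic_point v = periodic_point w"
    have "\<nexists>i j. i < length us \<and> v = cshift j (zero_pad z (length v) (us ! i))"
    proof (intro notI, elim exE conjE)
      fix i j assume i: "i < length us" and vi: "v = cshift j (zero_pad z (length v) (us ! i))"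
      let ?u = "us ! i"
      note u = us_word[OF i]
      have ne: "zero_pad z (length v) ?u \<noteq> []" using u(1) by (simp add: zero_pad_def)
      have pp: "periodic_point w a = periodic_point (zero_pad z (length v) ?u) (a + j)" for a
        using periodic_point_cshift[OF ne, of j a] vi v(3) by metis
      have zero: "periodic_point w (int (length ?u) - j + e) = z" if "0 \<le> e" "e < int ?m" for e
      proof -
        have "periodic_point (zero_pad z (length v) ?u) (int (length ?u) + e) = z"
          using that v(2) u(3) by (subst periodic_point_zero_pad) auto
        then show ?thesis unfolding pp by (simp add: algebra_simps)
      qed
      have "periodic_point w (- j) = z"
      proof -
        let ?e = "(- int (length ?u)) mod int ?m"
        have "periodic_point w (- j) = periodic_point w (int (length ?u) - j + ?e)"
        proof (rule periodic_point_cong)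
          have "(int (length ?u) - j + ?e) mod int ?m = (int (length ?u) - j + (- int (length ?u))) mod int ?m"
            by (rule mod_add_right_eq)
          then show "- j mod int ?m = (int (length ?u) - j + ?e) mod int ?m" by simp
        qed
        then show ?thesis using zero[of ?e] m by simp
      qed
      moreover have "periodic_point w (- j) = hd ?u"
        unfolding pp using u(1) by (simp add: periodic_point_def zero_pad_def nth_append hd_conv_nth)
      ultimately show False using u(2) by simp
    qed
    then have "p v = v" using p_fixes[OF v(1)] v(2) by simp
    then show "periodic_point (p v) = periodic_point (id_words w)" using v(3) w by simp
  qed
qed

lemma good_AFO: "good p id_words"
  using p_bij id_words_ext admissible_p shadow_AFO local_act_AFO by (auto simp: good_def)

lemma pad_in: "i < length us \<Longrightarrow> n0 \<le> n \<Longrightarrow> cshift j (zero_pad z n (us ! i)) \<in> all_cyc_words A"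
proof -
  assume i: "i < length us" and n: "n0 \<le> n"
  have "set (us ! i) \<subseteq> A" using us_safe nth_mem[OF i] unfolding safe_def by blast
  then show ?thesis
    using us_word(1)[OF i] z_in_A by (auto simp: all_cyc_words_iff cshift_def zero_pad_def split: if_splits)
qed

text \<open>The inverse belongs to the same safe set, with the inverse permutation and the opposite shifts.\<close>

lemma inverse_AFO: "restrict (inv_into (all_cyc_words A) p) (all_cyc_words A) \<in> AFO_perms A z"
proof -
  let ?X = "all_cyc_words A"
  let ?q = "restrict (inv_into ?X p) ?X"
  have q_bij: "?q \<in> Bij ?X" by (rule restrict_inv_into_Bij[OF p_bij])
  have inj: "inj_on p ?X" using p_bij by (auto simp: Bij_def bij_betw_def)
  have q: "?q (p w) = w" if "w \<in> ?X" for w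
    using inv_into_f_f[OF inj that] p_in[OF that] by simp
  define \<rho> where "\<rho> = inv_into UNIV \<pi>"
  have \<rho>: "\<rho> permutes {..<length us}" unfolding \<rho>_def by (rule permutes_inv[OF \<pi>_perm])
  have \<pi>\<rho>: "\<pi> (\<rho> i) = i" for i unfolding \<rho>_def by (rule permutes_inverses[OF \<pi>_perm])
  have "?q (cshift j (zero_pad z n (us ! i))) = cshift (j + - ns (\<rho> i)) (zero_pad z n (us ! \<rho> i))"
    if n: "n0 \<le> n" and i: "i < length us" for n i j
  proof -
    have \<rho>i: "\<rho> i < length us" using permutes_in_image[OF \<rho>, of i] i by simp
    have "p (cshift (j + - ns (\<rho> i)) (zero_pad z n (us ! \<rho> i))) = cshift j (zero_pad z n (us ! i))"
      using p_moves[OF n \<rho>i, of "j + - ns (\<rho> i)"] by (simp add: \<pi>\<rho>)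
    then show ?thesis using q[OF pad_in[OF \<rho>i n]] by metis
  qed
  moreover have "?q w = w" if "w \<in> ?X" "length w < n0" for w
    using q[OF that(1)] p_short[OF that] by simp
  moreover have "?q w = w" if "w \<in> ?X" "n0 \<le> length w"
      "\<nexists>i j. i < length us \<and> w = cshift j (zero_pad z (length w) (us ! i))" for w
    using q[OF that(1)] p_fixes[OF that] by simp
  ultimately show ?thesis
    unfolding AFO_perms_def using q_bij us_safe \<rho>
    by (intro CollectI conjI exI[of _ n0] exI[of _ us] exI[of _ \<rho>] exI[of _ "\<lambda>i. - ns (\<rho> i)"]) blast+
qed

end

context pointed_alphabet begin

lemma AFO_permsE:
  assumes "p \<in> AFO_perms A z"
  shows "\<exists>n0 us \<pi> ns. AFO_permutation A z n0 us \<pi> ns p"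
proof -
  obtain n0 us \<pi> ns where
    "p \<in> Bij (all_cyc_words A)" "safe A z n0 us" "\<pi> permutes {..<length us}"
    "\<forall>w \<in> all_cyc_words A. length w < n0 \<longrightarrow> p w = w"
    "\<forall>n \<ge> n0. \<forall>i < length us. \<forall>j.
        p (cshift j (zero_pad z n (us ! i))) = cshift (j + ns i) (zero_pad z n (us ! \<pi> i))"
    "\<forall>w \<in> all_cyc_words A. n0 \<le> length w \<longrightarrow>
        (\<nexists>i j. i < length us \<and> w = cshift j (zero_pad z (length w) (us ! i))) \<longrightarrow> p w = w"
    using assms unfolding AFO_perms_def by (elim CollectE exE conjE)
  then have "AFO_permutation A z n0 us \<pi> ns p" by unfold_locales (blast | simp)+
  then show ?thesis by blast
qed

lemma generators_good:
  assumes "g \<in> generators A z"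
  shows "\<exists>g'. good g g'"
  using assms unfolding generators_def
proof (elim UnE UN_E imageE)
  fix f assume "g = induced_perm A f" "f \<in> shift_auts0 A z"
  then show ?thesis using good_induced_perm(1) by blast
next
  assume "g \<in> AFO_perms A z"
  from AFO_permsE[OF this] obtain n0 us \<pi> ns where "AFO_permutation A z n0 us \<pi> ns g" by blast
  then have "good g id_words" by (rule AFO_permutation.good_AFO)
  then show ?thesis by blast
next
  fix n :: nat assume "n \<in> {1..}" "g \<in> local_perms A n"
  then show ?thesis using good_local_perm(1)[of g n] by auto
qed

lemma generators_inv:
  assumes "g \<in> generators A z"
  shows "inv\<^bsub>BijGroup (all_cyc_words A)\<^esub> g \<in> generators A z"
proof -
  obtain g' where "good g g'" using generators_good[OF assms] by blast
  then have "g \<in> Bij (all_cyc_words A)" by (simp add: good_def)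
  then have inv: "inv\<^bsub>BijGroup (all_cyc_words A)\<^esub> g = restrict (inv_into (all_cyc_words A) g) (all_cyc_words A)"
    by (rule inv_BijGroup)
  show ?thesis
    using assms unfolding generators_def inv
  proof (elim UnE UN_E imageE)
    fix f assume f: "g = induced_perm A f" "f \<in> shift_auts0 A z"
    have "restrict (inv_into (all_cyc_words A) g) (all_cyc_words A) \<in> induced_perm A ` shift_auts0 A z"
      using good_induced_perm(2)[OF f(2)] unfolding f(1) by blast
    then show "restrict (inv_into (all_cyc_words A) g) (all_cyc_words A)
        \<in> induced_perm A ` shift_auts0 A z \<union> AFO_perms A z \<union> (\<Union>n\<in>{1..}. local_perms A n)" by blast
  next
    assume "g \<in> AFO_perms A z"
    from AFO_permsE[OF this] obtain n0 us \<pi> ns where "AFO_permutation A z n0 us \<pi> ns g" by blast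
    then have "restrict (inv_into (all_cyc_words A) g) (all_cyc_words A) \<in> AFO_perms A z"
      by (rule AFO_permutation.inverse_AFO)
    then show "restrict (inv_into (all_cyc_words A) g) (all_cyc_words A)
        \<in> induced_perm A ` shift_auts0 A z \<union> AFO_perms A z \<union> (\<Union>n\<in>{1..}. local_perms A n)" by blast
  next
    fix n :: nat assume "n \<in> {1..}" "g \<in> local_perms A n"
    then show "restrict (inv_into (all_cyc_words A) g) (all_cyc_words A)
        \<in> induced_perm A ` shift_auts0 A z \<union> AFO_perms A z \<union> (\<Union>n\<in>{1..}. local_perms A n)"
      using good_local_perm(2)[of g n] by auto
  qed
qed

end

section \<open>The embedding\<close>

lemma carrier_Aut_shift: "carrier (Aut_shift C) = shift_auts C"
  by (simp add: Aut_shift_def)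

lemma Aut_shift_rename:
  assumes fin: "finite C" and inj: "inj_on code C"
  shows "\<exists>T. T \<in> mon (Aut_shift C) (Aut_shift (code ` C))"
proof -
  let ?X = "{x :: int \<Rightarrow> 'a. \<forall>i. x i \<in> C}" and ?Y = "{y :: int \<Rightarrow> 'b. \<forall>i. y i \<in> code ` C}"
  define dec where "dec = inv_into C code"
  have dec: "dec (code c) = c" if "c \<in> C" for c using inv_into_f_f[OF inj that] by (simp add: dec_def)
  have dec_in: "dec b \<in> C" "code (dec b) = b" if "b \<in> code ` C" for b
    using that by (auto simp: dec)
  define e where "e = (\<lambda>(x :: int \<Rightarrow> 'a) i. code (x i))"
  define d where "d = (\<lambda>(y :: int \<Rightarrow> 'b) i. dec (y i))"
  have ed: "d (e x) = x" if "x \<in> ?X" for x using that by (auto simp: d_def e_def dec)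
  have de: "e (d y) = y" if "y \<in> ?Y" for y using that by (auto simp: d_def e_def dec_in)
  have e_in: "e x \<in> ?Y" if "x \<in> ?X" for x using that by (auto simp: e_def)
  have d_in: "d y \<in> ?X" if "y \<in> ?Y" for y using that by (auto simp: d_def dec_in)
  define T where "T F = restrict (\<lambda>y. e (F (d y))) ?Y" for F
  have F_in: "F x \<in> ?X" if "F \<in> shift_auts C" "x \<in> ?X" for F x
    using shift_auts_bij(1)[OF that(1)] that(2) by (auto simp: bij_betw_def)
  have T_in: "T F \<in> shift_auts (code ` C)" if F: "F \<in> shift_auts C" for F
  proof -
    obtain R where R: "block_local C R F" using shift_auts_block_local[OF fin F] by blast
    have "block_local (code ` C) R (T F)"
      unfolding block_local_def
    proof (intro allI impI)
      fix x y i j assume x: "\<forall>k. x k \<in> code ` C" and y: "\<forall>k. y k \<in> code ` C"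
        and eq: "\<forall>r. \<bar>r\<bar> \<le> R \<longrightarrow> x (i + r) = y (j + r)"
      have "F (d x) i = F (d y) j"
        using R[unfolded block_local_def, rule_format, of "d x" "d y" i j] d_in[of x] d_in[of y] x y eq
        by (simp add: d_def)
      then show "T F x i = T F y j" using x y by (simp add: T_def e_def)
    qed
    moreover have "bij_betw (T F) ?Y ?Y"
    proof -
      have "bij_betw (e \<circ> (F \<circ> d)) ?Y ?Y"
      proof (intro bij_betw_trans)
        show "bij_betw d ?Y ?X"
          by (rule bij_betw_byWitness[where f' = e]) (use ed de e_in d_in in auto)
        show "bij_betw F ?X ?X" by (rule shift_auts_bij(1)[OF F])
        show "bij_betw e ?X ?Y"
          by (rule bij_betw_byWitness[where f' = d]) (use ed de e_in d_in in auto)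
      qed
      then show ?thesis by (rule bij_betw_cong[THEN iffD1, rotated]) (simp add: T_def)
    qed
    ultimately show ?thesis using fin by (intro shift_autsI) (simp_all add: T_def)
  qed
  have T_mult: "T (compose ?X F G) = compose ?Y (T F) (T G)" if "F \<in> shift_auts C" "G \<in> shift_auts C" for F G
  proof (rule extensionalityI)
    fix y assume y: "y \<in> ?Y"
    have "d (e (G (d y))) = G (d y)" by (intro ed F_in[OF that(2)] d_in y)
    moreover have "e (G (d y)) \<in> ?Y" by (intro e_in F_in[OF that(2)] d_in y)
    ultimately show "T (compose ?X F G) y = compose ?Y (T F) (T G) y"
      using y d_in[OF y] by (simp add: T_def compose_def)
  qed (simp_all add: T_def compose_def)
  have "T \<in> hom (Aut_shift C) (Aut_shift (code ` C))"
  proof (rule homI, unfold carrier_Aut_shift)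
    show "T F \<in> shift_auts (code ` C)" if "F \<in> shift_auts C" for F by (rule T_in[OF that])
    show "T (F \<otimes>\<^bsub>Aut_shift C\<^esub> G) = T F \<otimes>\<^bsub>Aut_shift (code ` C)\<^esub> T G"
      if "F \<in> shift_auts C" "G \<in> shift_auts C" for F G
      unfolding mult_Aut_shift[OF that] mult_Aut_shift[OF T_in[OF that(1)] T_in[OF that(2)]] by (rule T_mult[OF that])
  qed
  moreover have "inj_on T (shift_auts C)"
  proof (rule inj_onI)
    fix F G assume F: "F \<in> shift_auts C" and G: "G \<in> shift_auts C" and eq: "T F = T G"
    show "F = G"
    proof (rule extensionalityI[OF shift_auts_bij(2)[OF F] shift_auts_bij(2)[OF G]])
      fix x assume x: "x \<in> ?X"
      have "T F (e x) = T G (e x)" using eq by simp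
      then have "e (F x) = e (G x)" using e_in[OF x] ed[OF x] by (simp add: T_def)
      then have "d (e (F x)) = d (e (G x))" by simp
      then show "F x = G x" using ed[OF F_in[OF F x]] ed[OF F_in[OF G x]] by simp
    qed
  qed
  ultimately show ?thesis unfolding mon_def carrier_Aut_shift by blast
qed

context pointed_alphabet begin

definition encode_nz :: "'a list \<Rightarrow> int \<Rightarrow> bool" where
  "encode_nz w k \<longleftrightarrow> periodic_point w (fold_index k) \<noteq> z \<or> k = 0 \<and> zero_word w"

text \<open>An active run with a given word, surrounded by blank cells.\<close>

definition encode :: "'a list \<Rightarrow> int \<Rightarrow> 'a cell" where
  "encode w k = (if 0 \<le> k \<and> k < int (length w)
     then Cell (periodic_point w (fold_index k)) (odd k) (k = 0 \<and> zero_word w)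
       (\<exists>m. 0 \<le> m \<and> m < k \<and> encode_nz w m) (\<exists>m. k < m \<and> m < int (length w) \<and> encode_nz w m)
     else blank)"

lemma encode_run:
  assumes w: "w \<in> all_cyc_words A"
  shows "is_run (encode w) 0 (int (length w) - 1)" and "finite_runs (encode w)"
    and "run_word (encode w) 0 (int (length w) - 1) = w" and "active (encode w) 0 (int (length w) - 1)"
proof -
  let ?n = "int (length w)"
  have n: "0 < ?n" using w by (simp add: all_cyc_words_iff)
  have nz: "nz (encode w k) = encode_nz w k" if "0 \<le> k" "k < ?n" for k
    using that by (simp add: encode_def nz_def encode_nz_def)
  have inside: "joined (encode w) k" if "0 \<le> k" "k < ?n - 1" for k
  proof -
    have "(\<exists>m. 0 \<le> m \<and> m < k + 1 \<and> encode_nz w m) \<longleftrightarrow> (\<exists>m. 0 \<le> m \<and> m < k \<and> encode_nz w m) \<or> encode_nz w k"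
    proof -
      have split: "0 \<le> m \<and> m < k + 1 \<and> P m \<longleftrightarrow> (0 \<le> m \<and> m < k \<and> P m) \<or> (m = k \<and> P k)" for m P
        using that by (cases "m = k") auto
      show ?thesis unfolding split ex_disj_distrib by simp
    qed
    moreover have "(\<exists>m. k < m \<and> m < ?n \<and> encode_nz w m) \<longleftrightarrow>
        (\<exists>m. k + 1 < m \<and> m < ?n \<and> encode_nz w m) \<or> encode_nz w (k + 1)"
    proof -
      have split: "k < m \<and> m < ?n \<and> P m \<longleftrightarrow> (k + 1 < m \<and> m < ?n \<and> P m) \<or> (m = k + 1 \<and> P (k + 1))" for m P
        using that by (cases "m = k + 1") auto
      show ?thesis unfolding split ex_disj_distrib by simp
    qed
    ultimately show ?thesis
      using that nz[of k] nz[of "k + 1"] by (simp add: joined_def encode_def)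
  qed
  have ends: "\<not> lft (encode w 0)" "\<not> rgt (encode w (?n - 1))"
  proof -
    have "\<not> (0 \<le> m \<and> m < 0)" "\<not> (?n - 1 < m \<and> m < ?n)" for m :: int by linarith+
    then show "\<not> lft (encode w 0)" "\<not> rgt (encode w (?n - 1))"
      using n unfolding encode_def by (simp_all add: conj_assoc[symmetric] del: conj_assoc)
  qed
  have "encode w (- 1) = blank" "encode w ?n = blank" by (simp_all add: encode_def)
  then have left: "\<not> joined (encode w) (- 1)" and right: "\<not> joined (encode w) (?n - 1)"
    using ends by (simp_all add: joined_def blank_def nz_def)
  show run: "is_run (encode w) 0 (?n - 1)"
    using n inside left right by (simp add: is_run_def)
  show fin: "finite_runs (encode w)"
  proof (rule finite_runsI)
    show "letter (encode w k) \<in> A" for k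
      using periodic_point_configs[OF w] z_in_A by (simp add: encode_def blank_def)
    show "\<exists>l \<le> k. \<not> joined (encode w) l" for k
    proof -
      define m where "m = min k (- 2)"
      have "m \<le> k" "m \<le> - 2" by (simp_all add: m_def)
      moreover from this have "\<not> joined (encode w) m" by (intro not_joined_blank) (auto simp: encode_def)
      ultimately show ?thesis by blast
    qed
    show "\<exists>l \<ge> k. \<not> joined (encode w) l" for k
    proof -
      define m where "m = max k ?n"
      have "k \<le> m" "?n \<le> m" by (simp_all add: m_def)
      moreover from this have "\<not> joined (encode w) m" by (intro not_joined_blank) (auto simp: encode_def)
      ultimately show ?thesis by blast
    qed
  qed
  have forward: "\<not> backward (encode w 0)" using n by (simp add: encode_def)
  then have index: "run_index (encode w) 0 k = fold_index k" for k by (simp add: run_index_def orient_def)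
  have lr: "0 \<le> ?n - 1" using n by simp
  show word: "run_word (encode w) 0 (?n - 1) = w"
  proof (rule periodic_point_inject)
    show "length (run_word (encode w) 0 (?n - 1)) = length w" by simp
    show "periodic_point (run_word (encode w) 0 (?n - 1)) = periodic_point w"
    proof
      fix a
      let ?c = "run_place (encode w) 0 (?n - 1) a"
      have c: "0 \<le> ?c" "?c \<le> ?n - 1" by (rule run_place_bounds[OF lr])+
      have "periodic_point (run_word (encode w) 0 (?n - 1)) a = letter (encode w ?c)"
        by (rule periodic_point_run_word[OF lr])
      also have "\<dots> = periodic_point w (fold_index ?c)" using c by (simp add: encode_def)
      also have "\<dots> = periodic_point w a"
        using run_index_place[OF lr, of "encode w" a] unfolding index by (intro periodic_point_cong) simp
      finally show "periodic_point (run_word (encode w) 0 (?n - 1)) a = periodic_point w a" .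
    qed
  qed
  show "active (encode w) 0 (?n - 1)"
    unfolding active_def word using ends by (simp add: encode_def)
qed

lemma act_determines:
  assumes "good g g'" "good h h'" "\<And>y. finite_runs y \<Longrightarrow> act g g' y = act h h' y"
  shows "g = h"
proof (rule extensionalityI)
  fix w assume w: "w \<in> all_cyc_words A"
  note enc = encode_run[OF w]
  have "run_word (act g g' (encode w)) 0 (int (length w) - 1) = run_word (act h h' (encode w)) 0 (int (length w) - 1)"
    using assms(3)[OF enc(2)] by simp
  then show "g w = h w"
    using run_word_act[OF _ enc(2,1)] assms(1,2) enc(3,4) by (simp add: good_def next_word_def)
qed (use assms in \<open>auto simp: good_def Bij_def\<close>)

lemma good_one: "good id_words id_words"
proof -
  have "id_words \<in> local_perms A 1"
    using id_Bij[of "all_cyc_words A"] by (auto simp: local_perms_def id_words_def cyc_words_def all_cyc_words_iff)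
  then show ?thesis using good_local_perm(1) by blast
qed

lemma Bij_mult:
  "g \<in> Bij X \<Longrightarrow> h \<in> Bij X \<Longrightarrow> g \<otimes>\<^bsub>BijGroup X\<^esub> h = compose X g h"
  by (simp add: BijGroup_def)

lemma generate_good:
  assumes "g \<in> generate (BijGroup (all_cyc_words A)) (generators A z)"
  shows "\<exists>g'. good g g'"
  using assms
proof induction
  case one
  have "\<one>\<^bsub>BijGroup (all_cyc_words A)\<^esub> = id_words" by (simp add: BijGroup_def id_words_def)
  then show ?case using good_one by metis
next
  case (incl g)
  then show ?case by (rule generators_good)
next
  case (inv g)
  then show ?case by (rule generators_good[OF generators_inv])
next
  case (eng g h)
  then obtain g' h' where good: "good g g'" "good h h'" by blast
  then have "g \<otimes>\<^bsub>BijGroup (all_cyc_words A)\<^esub> h = compose (all_cyc_words A) g h"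
    by (intro Bij_mult) (simp_all add: good_def)
  then show ?case using good_compose[OF good] by auto
qed

lemma extend_one:
  assumes "y \<in> configs"
  shows "extend id_words id_words y = y"
proof
  fix i
  obtain R where "local_act id_words id_words R" using good_one by (auto simp: good_def)
  then have "local_act id_words id_words (radius id_words id_words)" by (rule local_act_radius)
  then have pos: "0 \<le> radius id_words id_words" by (simp add: local_act_def)
  have fin: "finite_runs (cutoff i (radius id_words id_words) y)"
    using assms by (intro finite_runs_cutoff) (simp add: configs_def)
  have "extend id_words id_words y i = act id_words id_words (cutoff i (radius id_words id_words) y) i" using assms by (simp add: extend_def)
  also have "\<dots> = y i" using act_id[OF fin, of id_words id_words] pos by (simp add: cutoff_def)
  finally show "extend id_words id_words y i = y i" .
qed

lemma extend_good_compose: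
  assumes "good g g'" "good h h'" "y \<in> configs"
  shows "extend g g' (extend h h' y) = extend (compose (all_cyc_words A) g h) (compose (all_cyc_words A) g' h') y"
proof -
  obtain R1 R2 R3 where "local_act g g' R1" "local_act h h' R2"
      "local_act (compose (all_cyc_words A) g h) (compose (all_cyc_words A) g' h') R3"
    using assms(1,2) good_compose[OF assms(1,2)] unfolding good_def by blast
  then show ?thesis
    using assms by (intro extend_compose) (auto simp: good_def compose_def)
qed

text \<open>A local action need not extend to a bijection just because it is bijective on a dense set; the
  inverse has to be local as well.  Its asymptotic part is the inverse of \<open>g'\<close> by uniqueness.\<close>

lemma extend_in_shift_auts:
  assumes good: "good g g'" "good h h'"
    and inv: "compose (all_cyc_words A) g h = id_words" "compose (all_cyc_words A) h g = id_words"
  shows "extend g g' \<in> shift_auts cells"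
proof -
  have "compose (all_cyc_words A) g' h' = id_words"
    using good_unique[OF good_compose[OF good, unfolded inv] good_one] .
  moreover have "compose (all_cyc_words A) h' g' = id_words"
    using good_unique[OF good_compose[OF good(2,1), unfolded inv] good_one] .
  ultimately have cancel: "extend g g' (extend h h' y) = y" "extend h h' (extend g g' y) = y" if "y \<in> configs" for y
    using extend_good_compose[OF good that] extend_good_compose[OF good(2,1) that] extend_one[OF that] inv by simp_all
  obtain R where R: "local_act g g' R" using good(1) by (auto simp: good_def)
  obtain R' where R': "local_act h h' R'" using good(2) by (auto simp: good_def)
  have adm: "admissible g g'" "admissible h h'" using good by (simp_all add: good_def)
  have configs: "configs = {x. \<forall>i. x i \<in> cells}" by (simp add: configs_def)
  show ?thesis
  proof (rule shift_autsI[OF finite_cells, folded configs])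
    show "extend g g' \<in> extensional configs" by (simp add: extend_def)
    show "bij_betw (extend g g') configs configs"
      by (rule bij_betw_byWitness[where f' = "extend h h'"])
        (use cancel extend_in[OF R adm(1)] extend_in[OF R' adm(2)] in auto)
    show "block_local cells (radius g g') (extend g g')" by (rule block_local_extend[OF R])
  qed
qed

text \<open>Asymptotic parts are unique, hence multiplicative, and so is the map to the extended actions.  It is
  injective because the action on the run that encodes a word reveals the image of that word.\<close>

theorem perm_group_embeds: "\<exists>h. h \<in> mon (perm_group A z) (Aut_shift cells)"
proof -
  let ?X = "all_cyc_words A"
  let ?G = "generate (BijGroup ?X) (generators A z)"
  define \<theta> where "\<theta> g = (SOME g'. good g g')" for g
  have \<theta>: "good g (\<theta> g)" if "g \<in> ?G" for g
    unfolding \<theta>_def by (rule someI_ex[OF generate_good[OF that]])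
  have Bij: "g \<in> Bij ?X" if "g \<in> ?G" for g using \<theta>[OF that] by (simp add: good_def)
  interpret Bij: group "BijGroup ?X" by (rule group_BijGroup)
  have sub: "generators A z \<subseteq> carrier (BijGroup ?X)"
    using generators_good by (auto simp: BijGroup_def good_def)
  have mult: "g \<otimes>\<^bsub>BijGroup ?X\<^esub> h = compose ?X g h" if "g \<in> ?G" "h \<in> ?G" for g h
    by (rule Bij_mult[OF Bij[OF that(1)] Bij[OF that(2)]])
  have one: "\<one>\<^bsub>BijGroup ?X\<^esub> = id_words" by (simp add: BijGroup_def id_words_def)
  define h where "h g = extend g (\<theta> g)" for g
  have h_in: "h g \<in> shift_auts cells" if g: "g \<in> ?G" for g
  proof -
    let ?i = "inv\<^bsub>BijGroup ?X\<^esub> g"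
    have i: "?i \<in> ?G" by (rule Bij.generate_m_inv_closed[OF sub g])
    have "g \<in> carrier (BijGroup ?X)" using Bij[OF g] by (simp add: BijGroup_def)
    then have "compose ?X g ?i = id_words" "compose ?X ?i g = id_words"
      using mult[OF g i] mult[OF i g] one Bij.r_inv Bij.l_inv by simp_all
    then show ?thesis unfolding h_def by (rule extend_in_shift_auts[OF \<theta>[OF g] \<theta>[OF i]])
  qed
  have h_mult: "h (compose ?X g1 g2) = compose configs (h g1) (h g2)" if g: "g1 \<in> ?G" "g2 \<in> ?G" for g1 g2
  proof (rule extensionalityI)
    have "compose ?X g1 g2 \<in> ?G" using generate.eng[OF g] mult[OF g] by simp
    then have eq: "\<theta> (compose ?X g1 g2) = compose ?X (\<theta> g1) (\<theta> g2)"
      using good_unique[OF \<theta> good_compose[OF \<theta>[OF g(1)] \<theta>[OF g(2)]]] by blast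
    have compose_eq: "compose configs F F' y = F (F' y)" if "y \<in> configs" for F F' y
      using that by (simp add: compose_def)
    fix y assume y: "y \<in> configs"
    show "h (compose ?X g1 g2) y = compose configs (h g1) (h g2) y"
      unfolding compose_eq[OF y] h_def eq by (rule extend_good_compose[OF \<theta>[OF g(1)] \<theta>[OF g(2)] y, symmetric])
  qed (simp_all add: h_def extend_def compose_def)
  have carrier: "carrier (perm_group A z) = ?G" by (simp add: perm_group_def)
  have mult': "g1 \<otimes>\<^bsub>perm_group A z\<^esub> g2 = compose ?X g1 g2" if "g1 \<in> ?G" "g2 \<in> ?G" for g1 g2
    using mult[OF that] by (simp add: perm_group_def)
  have configs: "configs = {x. \<forall>i. x i \<in> cells}" by (simp add: configs_def)
  have "h \<in> hom (perm_group A z) (Aut_shift cells)"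
    unfolding hom_def carrier
    using h_in h_mult mult' mult_Aut_shift[OF h_in h_in, folded configs]
    by (auto simp: Aut_shift_def)
  moreover have "inj_on h ?G"
  proof (rule inj_onI)
    fix g1 g2 assume g: "g1 \<in> ?G" "g2 \<in> ?G" and eq: "h g1 = h g2"
    obtain R1 where R1: "local_act g1 (\<theta> g1) R1" using \<theta>[OF g(1)] by (auto simp: good_def)
    obtain R2 where R2: "local_act g2 (\<theta> g2) R2" using \<theta>[OF g(2)] by (auto simp: good_def)
    have "act g1 (\<theta> g1) y = act g2 (\<theta> g2) y" if "finite_runs y" for y
      using extend_finite_runs[OF R1 that] extend_finite_runs[OF R2 that] eq by (simp add: h_def)
    then show "g1 = g2" by (rule act_determines[OF \<theta>[OF g(1)] \<theta>[OF g(2)]])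
  qed
  ultimately show ?thesis unfolding mon_def carrier by blast
qed

lemma group_perm_group: "group (perm_group A z)"
proof -
  interpret Bij: group "BijGroup (all_cyc_words A)" by (rule group_BijGroup)
  have sub: "generators A z \<subseteq> carrier (BijGroup (all_cyc_words A))"
    using generators_good by (auto simp: BijGroup_def good_def)
  show ?thesis
    unfolding perm_group_def
    by (rule subgroup.subgroup_is_group[OF Bij.generate_is_subgroup[OF sub] group_BijGroup])
qed

end

theorem theorem3:
  fixes A :: "'a set" and z :: 'a
  assumes "finite A" and "z \<in> A"
  shows "embeds_in_Aut_shift (perm_group A z)"
proof -
  interpret pointed_alphabet A z by unfold_locales (fact assms)+
  obtain code :: "'a cell \<Rightarrow> nat" where inj: "inj_on code cells"
    using finite_imp_inj_to_nat_seg[OF finite_cells] by blast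
  obtain h where h: "h \<in> mon (perm_group A z) (Aut_shift cells)" using perm_group_embeds by blast
  obtain T where T: "T \<in> mon (Aut_shift cells) (Aut_shift (code ` cells))"
    using Aut_shift_rename[OF finite_cells inj] by blast
  have "T \<circ> h \<in> mon (perm_group A z) (Aut_shift (code ` cells))" by (rule mon_compose[OF h T])
  moreover have "2 \<le> card (code ` cells)"
  proof -
    have "{Cell z False False False False, blank} \<subseteq> cells" using z_in_A by (simp add: cells_def blank_def)
    moreover have "card {Cell z False False False False, blank} = 2" by (simp add: blank_def)
    ultimately have "2 \<le> card cells" using card_mono[OF finite_cells] by metis
    then show ?thesis by (simp add: card_image[OF inj])
  qed
  ultimately show ?thesis
    unfolding embeds_in_Aut_shift_def using group_perm_group finite_imageI[OF finite_cells] by blast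
qed

end
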